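(* Let $\lambda,\nu\ge 0$, let $f\in\mathcal C^1(\mathbb R_+,\mathbb R_+)$ be non-decreasing with $f(0)=0$ and with derivative of at most linear growth, let $K\in L^1(\mathbb R_+,\mathbb R_+)$ with $\|K\|_{L^1(\mathbb R_+)}=1$ (for simplicity), and let $G_0:\mathbb R_+\to\mathbb R_+$ be non-decreasing with $G_0(0)=0$. Assume that for every $S>0$ there exists a weak solution $(W^{(S)},X^{(S)})$ on $[0,S]$ to $$X^{(S)}_t=G_0(t)+\int_0^tK(t-s)\bigl(-\lambda X^{(S)}_s+\nu W^{(S)}_{f(X^{(S)}_s)}\bigr)\,ds,\qquad t\le S,$$ for the input $(G_0,K,f,\lambda,\nu)$. Fix $T>0$ and set $X^n_t:=X^{(nT)}_{nt}$, $t\in[0,T]$, and $W^n:=W^{(nT)}$. Then the following hold as $n\to\infty$: - If $G_0(t)\to G_0^*\in\mathbb R_+$ as $t\to+\infty$, then $(W^n,X^n)\Rightarrow(W^*,X^* )$ weakly in $D^\circ[0,T]$, where $W^*$ is a standard Brownian motion and $X^*$ is the constant process $$X^*_t:=\inf\{s\ge 0:(1+\lambda)s-\nu W^*_{f(s)}>G_0^*\},\qquad t\le T.$$ - If there exists a sequence $c_n\downarrow 0$ such that, defining $$G_0^n(t):=c_nG_0(nt),\quad f^n(x):=c_n^2f(x/c_n),\quad \widetilde W^n_t:=c_nW^n_{t/c_n^2},\qquad t,x\ge 0,$$ we have $G_0^n\to G_0^*$ pointwise on $[0,T]$ for some continuous function $G_0^*$, and $f^n\to f^*$ locally uniformly on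 $\mathbb R_+$, then $(\widetilde W^n,c_nX^n)\Rightarrow(W^*,X^* )$ weakly in $D^\circ[0,T]$, where $W^*$ is a standard Brownian motion and $$X^*_t:=\inf\{s\ge 0:(1+\lambda)s-\nu W^*_{f^*(s)}>G_0^*(t)\},\qquad t\le T.$$
   Context: Weak solution: $(W,X)$ is a weak solution on $[0,T]$ for the input $(G_0,K,f,\lambda,\nu)$ if there is a filtered probability space $(\Omega,\mathcal F,(\mathcal G_t)_{t\ge 0},\mathbb P)$ supporting a $(\mathcal G_t)_{t\ge 0}$-Brownian motion $W$ and a non-decreasing continuous process $(X_t)_{t\le T}$ starting from $0$ such that: (i) for every $t\in[0,T]$, $f(X_t)$ is a $(\mathcal G_s)_{s\ge 0}$-stopping time; (ii) $(W_{f(X_t)})_{t\le T}$ is a martingale with respect to its own filtration; (iii) $X_t=G_0(t)+\int_0^tK(t-s)(-\lambda X_s+\nu W_{f(X_s)})\,ds$ holds $\mathbb P$-almost surely on $[0,T]$. Locally uniform convergence $f^n\to f^*$ on $\mathbb R_+$ means: for every $x\in\mathbb R_+$, $\limsup_{n\to\infty}\sup\{|f^n(s)-f^*(r)|:s,r\in[x-\delta,x+\delta]\cap\mathbb R_+\}\to0$ as $\delta\to0$. $C[0,\infty)$ denotes the continuous paths $[0,\infty)\to\mathbb R$ with uniform convergence on compacts. $D^\uparrow[0,T]$ denotes the non-negative non-decreasing càdlàg paths $[0,T]\to\mathbb R$, equipped with Skorokhod's $M_1$ topology ($\tau^n\to\tau$ in $M_1$ if and only if $\tau^n(t)\to\tau(t)$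 for all $t$ in a dense subset of $[0,T]$ containing $0$ and $T$). $D^\circ[0,T]:=\{(\phi,\tau):\phi\in C[0,\infty),\ \tau\in D^\uparrow[0,T]\}$ carries the product topology.
   Formalization: In the first bullet the M_1 topology is taken with the convention τ(0−)=0, so convergence at t=0 is not required; with the stated topology the claim fails whenever G_0^*>0, since X^n_0=0 while X^*_0>0 almost surely. *)

theory Defs
  imports "HOL-Probability.Probability"
begin

section \<open>Filtrations, Brownian motion, martingales\<close>

text \<open>
  Time is \<open>[0, \<infinity>)\<close>, encoded in \<^typ>\<open>real\<close>. The values \<open>F t\<close> of a filtration at \<open>t < 0\<close> carry no
  information: a filtration on \<open>[0, \<infinity>)\<close> extends to the library's \<^const>\<open>filtration\<close> by
  \<open>F t = F 0\<close> for \<open>t < 0\<close>, and \<^const>\<open>stopping_time\<close> is insensitive to \<open>t < 0\<close> for times that are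
  non-negative.
\<close>

definition filtered_prob_space :: "'a measure \<Rightarrow> (real \<Rightarrow> 'a measure) \<Rightarrow> bool" where
  "filtered_prob_space M F \<longleftrightarrow>
     prob_space M \<and> filtration (space M) F \<and> (\<forall>t. subalgebra M (F t))"

definition natural_filtration :: "'a measure \<Rightarrow> (real \<Rightarrow> 'a \<Rightarrow> real) \<Rightarrow> real \<Rightarrow> 'a measure" where
  "natural_filtration M Y t =
     sigma (space M) {Y s -` A \<inter> space M | s A. s \<in> {0..t} \<and> A \<in> sets borel}"

text \<open>
  All paths, not only almost all, are continuous, so that \<open>B\<close> is a random element of \<open>C[0, \<infinity>)\<close>.
\<close>

definition brownian_motion ::
  "'a measure \<Rightarrow> (real \<Rightarrow> 'a measure) \<Rightarrow> (real \<Rightarrow> 'a \<Rightarrow> real) \<Rightarrow> bool" where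
  "brownian_motion M F B \<longleftrightarrow>
     filtered_prob_space M F \<and>
     (\<forall>t\<ge>0. B t \<in> borel_measurable (F t)) \<and>
     (\<forall>\<omega>\<in>space M. continuous_on {0..} (\<lambda>t. B t \<omega>)) \<and>
     (AE \<omega> in M. B 0 \<omega> = 0) \<and>
     (\<forall>s t. 0 \<le> s \<and> s < t \<longrightarrow>
        distributed M lborel (\<lambda>\<omega>. B t \<omega> - B s \<omega>) (normal_density 0 (sqrt (t - s))) \<and>
        prob_space.indep_set M (sets (F s))
          (sets (vimage_algebra (space M) (\<lambda>\<omega>. B t \<omega> - B s \<omega>) borel)))"

definition standard_brownian_motion :: "'a measure \<Rightarrow> (real \<Rightarrow> 'a \<Rightarrow> real) \<Rightarrow> bool" where
  "standard_brownian_motion M B \<longleftrightarrow> brownian_motion M (natural_filtration M B) B"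

definition martingale_on ::
  "'a measure \<Rightarrow> (real \<Rightarrow> 'a measure) \<Rightarrow> real set \<Rightarrow> (real \<Rightarrow> 'a \<Rightarrow> real) \<Rightarrow> bool" where
  "martingale_on M F I Y \<longleftrightarrow>
     (\<forall>t\<in>I. subalgebra M (F t) \<and> Y t \<in> borel_measurable (F t) \<and> integrable M (Y t)) \<and>
     (\<forall>s\<in>I. \<forall>t\<in>I. s \<le> t \<longrightarrow> (AE \<omega> in M. real_cond_exp M (F s) (Y t) \<omega> = Y s \<omega>))"

section \<open>Weak solutions\<close>

definition weak_solution ::
  "'a measure \<Rightarrow> (real \<Rightarrow> 'a measure) \<Rightarrow> (real \<Rightarrow> 'a \<Rightarrow> real) \<Rightarrow> (real \<Rightarrow> 'a \<Rightarrow> real) \<Rightarrow> real \<Rightarrow>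
   (real \<Rightarrow> real) \<Rightarrow> (real \<Rightarrow> real) \<Rightarrow> (real \<Rightarrow> real) \<Rightarrow> real \<Rightarrow> real \<Rightarrow> bool" where
  "weak_solution M F W X S G\<^sub>0 K f lam \<nu> \<longleftrightarrow>
     brownian_motion M F W \<and>
     (\<forall>t\<in>{0..S}. X t \<in> borel_measurable M) \<and>
     (\<forall>\<omega>\<in>space M. X 0 \<omega> = 0 \<and> mono_on {0..S} (\<lambda>t. X t \<omega>) \<and> continuous_on {0..S} (\<lambda>t. X t \<omega>)) \<and>
     (\<forall>t\<in>{0..S}. stopping_time F (\<lambda>\<omega>. f (X t \<omega>))) \<and>
     martingale_on M (natural_filtration M (\<lambda>t \<omega>. W (f (X t \<omega>)) \<omega>)) {0..S}
       (\<lambda>t \<omega>. W (f (X t \<omega>)) \<omega>) \<and>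
     (AE \<omega> in M. \<forall>t\<in>{0..S}.
        X t \<omega> = G\<^sub>0 t +
          (LINT s:{0..t}|lborel. K (t - s) * (- lam * X s \<omega> + \<nu> * W (f (X s \<omega>)) \<omega>)))"

section \<open>Path spaces\<close>

text \<open>Paths are functions on \<^typ>\<open>real\<close> that are \<^const>\<open>undefined\<close> off their time interval.\<close>

definition C_paths :: "(real \<Rightarrow> real) set" where
  "C_paths = {\<phi> \<in> extensional {0..}. continuous_on {0..} \<phi>}"

definition C_topology :: "(real \<Rightarrow> real) topology" where
  "C_topology = topology (\<lambda>U. U \<subseteq> C_paths \<and>
     (\<forall>\<phi>\<in>U. \<exists>N. \<exists>\<epsilon>>0. \<forall>\<psi>\<in>C_paths. (\<forall>t\<in>{0..N}. \<bar>\<psi> t - \<phi> t\<bar> < \<epsilon>) \<longrightarrow> \<psi> \<in> U))"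

definition cadlag_on :: "real \<Rightarrow> (real \<Rightarrow> real) \<Rightarrow> bool" where
  "cadlag_on T \<tau> \<longleftrightarrow>
     (\<forall>t\<in>{0..<T}. (\<tau> \<longlongrightarrow> \<tau> t) (at_right t)) \<and> (\<forall>t\<in>{0<..T}. \<exists>l. (\<tau> \<longlongrightarrow> l) (at_left t))"

definition D_up_paths :: "real \<Rightarrow> (real \<Rightarrow> real) set" where
  "D_up_paths T = {\<tau> \<in> extensional {0..T}.
     (\<forall>t\<in>{0..T}. 0 \<le> \<tau> t) \<and> mono_on {0..T} \<tau> \<and> cadlag_on T \<tau>}"

text \<open>
  Skorokhod's \<open>M\<^sub>1\<close> topology is defined by parametric representations of completed graphs
  (Whitt, \<^emph>\<open>Stochastic-Process Limits\<close>, Section 12.3). The parameter \<open>a\<close> below is the value taken as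
  \<open>\<tau>(0-)\<close>. There are two conventions:

  \<^item> \<open>\<tau>(0-) = \<tau>(0)\<close>, the usual one on \<open>[0, T]\<close>. On non-decreasing paths, convergence is pointwise
    convergence on a dense subset of \<open>[0, T]\<close> that contains \<open>0\<close> and \<open>T\<close>.
  \<^item> \<open>\<tau>(0-) = 0\<close>, where a path with \<open>\<tau>(0) > 0\<close> has a jump at time \<open>0\<close> (Whitt, Section 13.6.2). On
    non-negative non-decreasing paths, convergence is pointwise convergence on a dense subset of
    \<open>[0, T]\<close> that contains \<open>T\<close>.

  Processes started from \<open>0\<close> can only converge to a limit that is positive at time \<open>0\<close> under the second
  convention, because evaluation at \<open>0\<close> is continuous under the first.
\<close>

definition left_value :: "real \<Rightarrow> (real \<Rightarrow> real) \<Rightarrow> real \<Rightarrow> real" where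
  "left_value a \<tau> t = (if t = 0 then a else Lim (at_left t) \<tau>)"

definition completed_graph :: "real \<Rightarrow> real \<Rightarrow> (real \<Rightarrow> real) \<Rightarrow> (real \<times> real) set" where
  "completed_graph T a \<tau> = {(t, z). t \<in> {0..T} \<and> z \<in> closed_segment (left_value a \<tau> t) (\<tau> t)}"

definition graph_le ::
  "real \<Rightarrow> (real \<Rightarrow> real) \<Rightarrow> real \<times> real \<Rightarrow> real \<times> real \<Rightarrow> bool" where
  "graph_le a \<tau> p q \<longleftrightarrow> fst p < fst q \<or>
     (fst p = fst q \<and> \<bar>snd p - left_value a \<tau> (fst p)\<bar> \<le> \<bar>snd q - left_value a \<tau> (fst q)\<bar>)"

definition parametric_rep ::
  "real \<Rightarrow> real \<Rightarrow> (real \<Rightarrow> real) \<Rightarrow> (real \<Rightarrow> real \<times> real) \<Rightarrow> bool" where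
  "parametric_rep T a \<tau> \<gamma> \<longleftrightarrow>
     continuous_on {0..1} \<gamma> \<and> \<gamma> ` {0..1} = completed_graph T a \<tau> \<and>
     (\<forall>s\<in>{0..1}. \<forall>s'\<in>{0..1}. s \<le> s' \<longrightarrow> graph_le a \<tau> (\<gamma> s) (\<gamma> s'))"

definition M1_dist ::
  "real \<Rightarrow> ((real \<Rightarrow> real) \<Rightarrow> real) \<Rightarrow> (real \<Rightarrow> real) \<Rightarrow> (real \<Rightarrow> real) \<Rightarrow> real" where
  "M1_dist T init \<tau> \<sigma> = Inf {SUP s\<in>{0..1}.
       max \<bar>fst (\<gamma> s) - fst (\<eta> s)\<bar> \<bar>snd (\<gamma> s) - snd (\<eta> s)\<bar> | \<gamma> \<eta>.
       parametric_rep T (init \<tau>) \<tau> \<gamma> \<and> parametric_rep T (init \<sigma>) \<sigma> \<eta>}"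

definition M1_topology_init ::
  "real \<Rightarrow> ((real \<Rightarrow> real) \<Rightarrow> real) \<Rightarrow> (real \<Rightarrow> real) topology" where
  "M1_topology_init T init = topology (\<lambda>U. U \<subseteq> D_up_paths T \<and>
     (\<forall>\<tau>\<in>U. \<exists>\<epsilon>>0. \<forall>\<sigma>\<in>D_up_paths T. M1_dist T init \<tau> \<sigma> < \<epsilon> \<longrightarrow> \<sigma> \<in> U))"

definition M1_topology :: "real \<Rightarrow> (real \<Rightarrow> real) topology" where
  "M1_topology T = M1_topology_init T (\<lambda>\<tau>. \<tau> 0)"

definition M1_topology_0 :: "real \<Rightarrow> (real \<Rightarrow> real) topology" where
  "M1_topology_0 T = M1_topology_init T (\<lambda>\<tau>. 0)"

definition D_circ :: "real \<Rightarrow> ((real \<Rightarrow> real) \<times> (real \<Rightarrow> real)) topology" where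
  "D_circ T = prod_topology C_topology (M1_topology T)"

definition D_circ_0 :: "real \<Rightarrow> ((real \<Rightarrow> real) \<times> (real \<Rightarrow> real)) topology" where
  "D_circ_0 T = prod_topology C_topology (M1_topology_0 T)"

lemma openin_C_topology:
  "openin C_topology U \<longleftrightarrow> U \<subseteq> C_paths \<and>
     (\<forall>\<phi>\<in>U. \<exists>N. \<exists>\<epsilon>>0. \<forall>\<psi>\<in>C_paths. (\<forall>t\<in>{0..N}. \<bar>\<psi> t - \<phi> t\<bar> < \<epsilon>) \<longrightarrow> \<psi> \<in> U)"
proof -
  let ?P = "\<lambda>U \<phi> N \<epsilon>. \<forall>\<psi>\<in>C_paths. (\<forall>t\<in>{0..N::real}. \<bar>\<psi> t - \<phi> t\<bar> < (\<epsilon>::real)) \<longrightarrow> \<psi> \<in> U"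
  have "istopology (\<lambda>U. U \<subseteq> C_paths \<and> (\<forall>\<phi>\<in>U. \<exists>N. \<exists>\<epsilon>>0. ?P U \<phi> N \<epsilon>))"
    unfolding istopology_def
  proof (intro conjI allI impI)
    fix U V
    assume U: "U \<subseteq> C_paths \<and> (\<forall>\<phi>\<in>U. \<exists>N. \<exists>\<epsilon>>0. ?P U \<phi> N \<epsilon>)"
      and V: "V \<subseteq> C_paths \<and> (\<forall>\<phi>\<in>V. \<exists>N. \<exists>\<epsilon>>0. ?P V \<phi> N \<epsilon>)"
    show "U \<inter> V \<subseteq> C_paths" using U by blast
    show "\<forall>\<phi>\<in>U \<inter> V. \<exists>N. \<exists>\<epsilon>>0. ?P (U \<inter> V) \<phi> N \<epsilon>"
    proof
      fix \<phi> assume "\<phi> \<in> U \<inter> V"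
      then have "\<exists>N. \<exists>\<epsilon>>0. ?P U \<phi> N \<epsilon>" "\<exists>N. \<exists>\<epsilon>>0. ?P V \<phi> N \<epsilon>"
        using U V by simp_all
      then obtain N1 e1 N2 e2
        where e: "e1 > 0" "e2 > 0" and P: "?P U \<phi> N1 e1" "?P V \<phi> N2 e2"
        by (elim exE conjE)
      have "?P (U \<inter> V) \<phi> (max N1 N2) (min e1 e2)"
      proof (intro ballI impI IntI)
        fix \<psi> assume "\<psi> \<in> C_paths"
          and "\<forall>t\<in>{0..max N1 N2}. \<bar>\<psi> t - \<phi> t\<bar> < min e1 e2"
        then show "\<psi> \<in> U" "\<psi> \<in> V"
          by (auto intro!: P[rule_format])
      qed
      moreover have "min e1 e2 > 0" using e by simp
      ultimately show "\<exists>N. \<exists>\<epsilon>>0. ?P (U \<inter> V) \<phi> N \<epsilon>" by (intro exI conjI)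
    qed
  next
    fix \<K> :: "(real \<Rightarrow> real) set set"
    assume H: "\<forall>U\<in>\<K>. U \<subseteq> C_paths \<and> (\<forall>\<phi>\<in>U. \<exists>N. \<exists>\<epsilon>>0. ?P U \<phi> N \<epsilon>)"
    show "\<Union>\<K> \<subseteq> C_paths" using H by blast
    show "\<forall>\<phi>\<in>\<Union>\<K>. \<exists>N. \<exists>\<epsilon>>0. ?P (\<Union>\<K>) \<phi> N \<epsilon>"
    proof
      fix \<phi> assume "\<phi> \<in> \<Union>\<K>"
      then obtain U where U: "U \<in> \<K>" "\<phi> \<in> U" by (elim UnionE)
      then have "\<exists>N. \<exists>\<epsilon>>0. ?P U \<phi> N \<epsilon>" using H by simp
      then obtain N \<epsilon> where e: "\<epsilon> > 0" and P: "?P U \<phi> N \<epsilon>" by (elim exE conjE)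
      have "?P (\<Union>\<K>) \<phi> N \<epsilon>"
        by (intro ballI impI UnionI[OF U(1)] P[rule_format]) simp_all
      with e show "\<exists>N. \<exists>\<epsilon>>0. ?P (\<Union>\<K>) \<phi> N \<epsilon>" by (intro exI conjI)
    qed
  qed
  then show ?thesis by (simp add: C_topology_def topology_inverse')
qed

lemma topspace_C_topology [simp]: "topspace C_topology = C_paths"
proof -
  have "openin C_topology C_paths"
    unfolding openin_C_topology
    by (intro conjI subset_refl ballI exI[of _ "0::real"] exI[of _ "1::real"] impI) simp_all
  moreover have "topspace C_topology \<subseteq> C_paths"
    using openin_topspace[of C_topology] unfolding openin_C_topology by (rule conjunct1)
  ultimately show ?thesis
    by (intro equalityI openin_subset)
qed

lemma openin_M1_topology_init:
  "openin (M1_topology_init T init) U \<longleftrightarrow> U \<subseteq> D_up_paths T \<and>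
     (\<forall>\<tau>\<in>U. \<exists>\<epsilon>>0. \<forall>\<sigma>\<in>D_up_paths T. M1_dist T init \<tau> \<sigma> < \<epsilon> \<longrightarrow> \<sigma> \<in> U)"
proof -
  let ?P = "\<lambda>U \<tau> \<epsilon>. \<forall>\<sigma>\<in>D_up_paths T. M1_dist T init \<tau> \<sigma> < \<epsilon> \<longrightarrow> \<sigma> \<in> U"
  have "istopology (\<lambda>U. U \<subseteq> D_up_paths T \<and> (\<forall>\<tau>\<in>U. \<exists>\<epsilon>>0. ?P U \<tau> \<epsilon>))"
    unfolding istopology_def
  proof (intro conjI allI impI)
    fix U V
    assume U: "U \<subseteq> D_up_paths T \<and> (\<forall>\<tau>\<in>U. \<exists>\<epsilon>>0. ?P U \<tau> \<epsilon>)"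
      and V: "V \<subseteq> D_up_paths T \<and> (\<forall>\<tau>\<in>V. \<exists>\<epsilon>>0. ?P V \<tau> \<epsilon>)"
    show "U \<inter> V \<subseteq> D_up_paths T" using U by blast
    show "\<forall>\<tau>\<in>U \<inter> V. \<exists>\<epsilon>>0. ?P (U \<inter> V) \<tau> \<epsilon>"
    proof
      fix \<tau> assume "\<tau> \<in> U \<inter> V"
      then have "\<exists>\<epsilon>>0. ?P U \<tau> \<epsilon>" "\<exists>\<epsilon>>0. ?P V \<tau> \<epsilon>"
        using U V by simp_all
      then obtain e1 e2 where e: "e1 > 0" "e2 > 0" and P: "?P U \<tau> e1" "?P V \<tau> e2"
        by (elim exE conjE)
      have "?P (U \<inter> V) \<tau> (min e1 e2)"
        using P by simp
      moreover have "min e1 e2 > 0" using e by simp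
      ultimately show "\<exists>\<epsilon>>0. ?P (U \<inter> V) \<tau> \<epsilon>" by (intro exI conjI)
    qed
  next
    fix \<K> :: "(real \<Rightarrow> real) set set"
    assume H: "\<forall>U\<in>\<K>. U \<subseteq> D_up_paths T \<and> (\<forall>\<tau>\<in>U. \<exists>\<epsilon>>0. ?P U \<tau> \<epsilon>)"
    show "\<Union>\<K> \<subseteq> D_up_paths T" using H by blast
    show "\<forall>\<tau>\<in>\<Union>\<K>. \<exists>\<epsilon>>0. ?P (\<Union>\<K>) \<tau> \<epsilon>"
    proof
      fix \<tau> assume "\<tau> \<in> \<Union>\<K>"
      then obtain U where U: "U \<in> \<K>" "\<tau> \<in> U" by (elim UnionE)
      then have "\<exists>\<epsilon>>0. ?P U \<tau> \<epsilon>" using H by simp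
      then obtain \<epsilon> where e: "\<epsilon> > 0" and P: "?P U \<tau> \<epsilon>" by (elim exE conjE)
      have "?P (\<Union>\<K>) \<tau> \<epsilon>"
        by (intro ballI impI UnionI[OF U(1)] P[rule_format]) simp_all
      with e show "\<exists>\<epsilon>>0. ?P (\<Union>\<K>) \<tau> \<epsilon>" by (intro exI conjI)
    qed
  qed
  then show ?thesis by (simp add: M1_topology_init_def topology_inverse')
qed

lemma topspace_M1_topology_init [simp]: "topspace (M1_topology_init T init) = D_up_paths T"
proof -
  have "openin (M1_topology_init T init) (D_up_paths T)"
    unfolding openin_M1_topology_init
    by (intro conjI subset_refl ballI exI[of _ "1::real"] impI) simp_all
  moreover have "topspace (M1_topology_init T init) \<subseteq> D_up_paths T"
    using openin_topspace[of "M1_topology_init T init"] unfolding openin_M1_topology_init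
    by (rule conjunct1)
  ultimately show ?thesis
    by (intro equalityI openin_subset)
qed

lemma topspace_D_circ [simp]:
  "topspace (D_circ T) = C_paths \<times> D_up_paths T"
  "topspace (D_circ_0 T) = C_paths \<times> D_up_paths T"
  by (simp_all add: D_circ_def D_circ_0_def M1_topology_def M1_topology_0_def)

section \<open>Weak convergence\<close>

definition borel_of_topology :: "'e topology \<Rightarrow> 'e measure" where
  "borel_of_topology \<T> = sigma (topspace \<T>) {U. openin \<T> U}"

definition converges_weakly ::
  "'e topology \<Rightarrow> (nat \<Rightarrow> 'a measure) \<Rightarrow> (nat \<Rightarrow> 'a \<Rightarrow> 'e) \<Rightarrow> 'b measure \<Rightarrow> ('b \<Rightarrow> 'e) \<Rightarrow> bool" where
  "converges_weakly \<T> M Y N Z \<longleftrightarrow>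
     (\<forall>n\<ge>1. Y n \<in> measurable (M n) (borel_of_topology \<T>)) \<and>
     Z \<in> measurable N (borel_of_topology \<T>) \<and>
     (\<forall>\<Phi>. continuous_map \<T> euclideanreal \<Phi> \<and> (\<exists>b. \<forall>x\<in>topspace \<T>. \<bar>\<Phi> x\<bar> \<le> b) \<longrightarrow>
        (\<lambda>n. \<integral>\<omega>. \<Phi> (Y n \<omega>) \<partial>M n) \<longlonglongrightarrow> (\<integral>\<omega>. \<Phi> (Z \<omega>) \<partial>N))"

text \<open>
  A limit that is only almost surely an element of the path space is replaced by an almost surely
  equal random element.
\<close>

definition converges_weakly_as ::
  "'e topology \<Rightarrow> (nat \<Rightarrow> 'a measure) \<Rightarrow> (nat \<Rightarrow> 'a \<Rightarrow> 'e) \<Rightarrow> 'b measure \<Rightarrow> ('b \<Rightarrow> 'e) \<Rightarrow> bool" where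
  "converges_weakly_as \<T> M Y N Z \<longleftrightarrow>
     (\<exists>Z'. (AE \<omega> in N. Z' \<omega> = Z \<omega>) \<and> converges_weakly \<T> M Y N Z')"

definition path_pair ::
  "real \<Rightarrow> (real \<Rightarrow> 'a \<Rightarrow> real) \<Rightarrow> (real \<Rightarrow> 'a \<Rightarrow> real) \<Rightarrow> 'a \<Rightarrow> (real \<Rightarrow> real) \<times> (real \<Rightarrow> real)" where
  "path_pair T V Y \<omega> = (restrict (\<lambda>t. V t \<omega>) {0..}, restrict (\<lambda>t. Y t \<omega>) {0..T})"

section \<open>Limit objects\<close>

text \<open>
  The set is almost surely non-empty for the processes considered here; the real infimum of the
  empty set is an unspecified number.
\<close>

definition first_passage ::
  "real \<Rightarrow> real \<Rightarrow> (real \<Rightarrow> real) \<Rightarrow> (real \<Rightarrow> 'a \<Rightarrow> real) \<Rightarrow> real \<Rightarrow> 'a \<Rightarrow> real" where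
  "first_passage lam \<nu> f B g \<omega> = Inf {s. 0 \<le> s \<and> (1 + lam) * s - \<nu> * B (f s) \<omega> > g}"

definition locally_uniformly_converges :: "(nat \<Rightarrow> real \<Rightarrow> real) \<Rightarrow> (real \<Rightarrow> real) \<Rightarrow> bool" where
  "locally_uniformly_converges fs f \<longleftrightarrow> (\<forall>x\<ge>0.
     ((\<lambda>\<delta>. limsup (\<lambda>n. SUP (s, r) \<in> ({x - \<delta>..x + \<delta>} \<inter> {0..}) \<times> ({x - \<delta>..x + \<delta>} \<inter> {0..}).
              ereal \<bar>fs n s - f r\<bar>)) \<longlongrightarrow> 0) (at_right 0))"

end

theory Submission
  imports Defs
begin

text \<open>
  The rescaled solution is compared, on its own probability space, with a functional of its own Brownian
  motion. Brownian scaling turns \<open>W\<close> into a Brownian motion \<open>w\<^sub>n\<close> that has the law of \<open>B\<close> for every \<open>n\<close>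
  (\<open>bm_law_unique\<close>). Let \<open>\<tau>\<^sub>n(g)\<close> be the first time at which \<open>(1 + \<lambda>) s - \<nu> w\<^sub>n(f\<^sup>*(s))\<close> exceeds the
  level \<open>g\<close>. Then \<open>w\<^sub>n\<close> together with \<open>t \<mapsto> \<tau>\<^sub>n(G\<^sup>*(t))\<close> has exactly the law of the limit, and what
  remains is that the rescaled solution \<open>y\<^sub>n\<close> satisfies \<open>y\<^sub>n(t) - \<tau>\<^sub>n(G\<^sup>*(t)) \<rightarrow> 0\<close> in probability at
  sufficiently many times \<open>t\<close> (\<open>y_hit_L1\<close>). Two opposite bounds give this.

  \<^item> Pathwise, from below (\<open>delayed_growth\<close>, \<open>hit_le_y_likely\<close>). The rescaled kernel concentrates at lag
    \<open>0\<close>, so if \<open>(1 + \<lambda>) y - \<nu> w(f\<^sup>*(y))\<close> stayed below \<open>G\<^sup>*\<close> by a fixed margin on an interval of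
    times, \<open>y\<close> would grow beyond every bound there. Hence, for \<open>h < G\<^sup>*(t)\<close>, the non-decreasing
    solution has visited a point above the level \<open>h\<close> before time \<open>t\<close>, and \<open>y\<^sub>n(t) \<ge> \<tau>\<^sub>n(h)\<close> with high probability.
  \<^item> In mean, from above (\<open>mean_bound\<close>, \<open>mean_upper\<close>). The martingale \<open>W(f(X))\<close> is centred, so the equation
    bounds the mean of \<open>y\<^sub>n(t)\<close> asymptotically by \<open>G\<^sup>*(t) / (1 + \<lambda>)\<close>.

  The two bounds meet because the mean of \<open>\<tau>\<^sub>n(g)\<close> is exactly \<open>g / (1 + \<lambda>)\<close> for \<open>g \<ge> 0\<close>
  (\<open>first_passage_mean\<close>): a variable that dominates another one and has no larger mean is equal to it. This
  identity is optional stopping for the time-changed Brownian motion. It holds for times capped at \<open>R\<close>, and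
  the contribution of the paths that have not passed by time \<open>R\<close> must vanish as \<open>R\<close> grows. Here the
  growth condition on the derivative enters. It makes \<open>f\<^sup>*\<close> at most quadratic, and then a Brownian motion at
  a great height \<open>v\<close> needs a time of order \<open>v\<close> before a passage becomes likely, so that the
  contribution is controlled by the integrable passage time (\<open>high_value_bound\<close>).

  On path space, both components are governed by countably many real functionals. A non-decreasing path is
  determined up to a small \<open>M\<^sub>1\<close> distance by its values on a finite grid, because completed graphs of
  monotone paths are parametrized canonically by the sum of their coordinates (\<open>M1_dist_le_grid\<close>). With
  limit laws that do not depend on \<open>n\<close>, closeness in probability of every such functional yields weak
  convergence (\<open>converges_weakly_coupling\<close>). The time \<open>0\<close> is one of the grid times only under the convention
  \<open>\<tau>(0-) = \<tau>(0)\<close>; under the other one the limit may be positive at time \<open>0\<close> although all solutions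
  start from \<open>0\<close>.
\<close>

section \<open>Completed graphs parametrized by arc length\<close>

text \<open>
  On a non-decreasing graph the sum \<open>t + z\<close> of the two coordinates strictly increases along the
  curve, vertical segments included. It is the \<open>\<ell>\<^sub>1\<close> arc length, and \<open>arc_time T \<tau> u\<close> is the time
  coordinate of the point of the completed graph at which the sum equals \<open>u\<close>.
\<close>

definition arc_time :: "real \<Rightarrow> (real \<Rightarrow> real) \<Rightarrow> real \<Rightarrow> real" where
  "arc_time T \<tau> u = Inf {t \<in> {0..T}. u \<le> t + \<tau> t}"

context
  fixes T a :: real and \<tau> :: "real \<Rightarrow> real"
  assumes T: "0 < T" and \<tau>: "\<tau> \<in> D_up_paths T" and a: "a \<le> \<tau> 0"
begin

lemma path_mono: "0 \<le> s \<Longrightarrow> s \<le> t \<Longrightarrow> t \<le> T \<Longrightarrow> \<tau> s \<le> \<tau> t"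
  using \<tau> by (auto simp: D_up_paths_def mono_on_def)

lemma tendsto_left_value:
  assumes "0 < t" "t \<le> T"
  shows "(\<tau> \<longlongrightarrow> left_value a \<tau> t) (at_left t)"
proof -
  obtain l where "(\<tau> \<longlongrightarrow> l) (at_left t)"
    using \<tau> assms unfolding D_up_paths_def cadlag_on_def by fastforce
  moreover from this have "Lim (at_left t) \<tau> = l"
    by (intro tendsto_Lim) auto
  ultimately show ?thesis
    using assms by (simp add: left_value_def)
qed

lemma le_left_value:
  assumes "0 \<le> s" "s < t" "t \<le> T"
  shows "\<tau> s \<le> left_value a \<tau> t"
proof (rule tendsto_lowerbound[OF tendsto_left_value])
  show "\<forall>\<^sub>F r in at_left t. \<tau> s \<le> \<tau> r"
    unfolding eventually_at_left[OF assms(2)]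
    using assms by (intro exI[of _ s]) (auto intro!: path_mono)
qed (use assms in auto)

lemma left_value_le:
  assumes "0 \<le> t" "t \<le> T"
  shows "left_value a \<tau> t \<le> \<tau> t"
proof (cases "t = 0")
  case True
  then show ?thesis using a by (simp add: left_value_def)
next
  case False
  show ?thesis
  proof (rule tendsto_upperbound[OF tendsto_left_value])
    show "\<forall>\<^sub>F r in at_left t. \<tau> r \<le> \<tau> t"
      using False assms by (subst eventually_at_left[of 0]) (auto intro!: path_mono exI[of _ 0])
  qed (use False assms in auto)
qed

lemma completed_graph_iff:
  "(t, z) \<in> completed_graph T a \<tau> \<longleftrightarrow> 0 \<le> t \<and> t \<le> T \<and> left_value a \<tau> t \<le> z \<and> z \<le> \<tau> t"
  using left_value_le by (auto simp: completed_graph_def closed_segment_eq_real_ivl)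

lemma graph_mono:
  assumes "(t, z) \<in> completed_graph T a \<tau>" "(t', z') \<in> completed_graph T a \<tau>" "t < t'"
  shows "z \<le> z'"
  using assms le_left_value[of t t'] by (auto simp: completed_graph_iff)

lemma graph_mono_arc:
  assumes "(t, z) \<in> completed_graph T a \<tau>" "(t', z') \<in> completed_graph T a \<tau>" "t + z \<le> t' + z'"
  shows "t \<le> t'" "z \<le> z'"
  using graph_mono[OF assms(1,2)] graph_mono[OF assms(2,1)] assms(3)
  by (cases t t' rule: linorder_cases; linarith)+

text \<open>
  At the infimum \<open>t\<close>, right-continuity gives \<open>u \<le> t + \<tau>(t)\<close>, and minimality gives
  \<open>t + \<tau>(t-) \<le> u\<close>; hence the height \<open>u - t\<close> lies on the vertical segment over \<open>t\<close>.
\<close>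

lemma arc_time_on_graph:
  assumes "a \<le> u" "u \<le> T + \<tau> T"
  shows "(arc_time T \<tau> u, u - arc_time T \<tau> u) \<in> completed_graph T a \<tau>"
proof -
  define S where "S = {t \<in> {0..T}. u \<le> t + \<tau> t}"
  define t where "t = Inf S"
  have S: "T \<in> S" "bdd_below S" using T assms by (auto simp: S_def intro!: bdd_belowI[of _ 0])
  have "0 \<le> t" unfolding t_def by (rule cInf_greatest) (use S in \<open>auto simp: S_def\<close>)
  have "t \<le> T" unfolding t_def by (rule cInf_lower) (use S in auto)
  have below: "s + \<tau> s < u" if "0 \<le> s" "s < t" for s
  proof (rule ccontr)
    assume "\<not> s + \<tau> s < u"
    then have "s \<in> S" using that \<open>t \<le> T\<close> by (auto simp: S_def)
    then have "t \<le> s" unfolding t_def by (rule cInf_lower) (use S in auto)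
    then show False using that by simp
  qed
  have above: "u \<le> t + \<tau> t"
  proof (cases "t = T")
    case True then show ?thesis using assms by simp
  next
    case False
    then have "t < T" using \<open>t \<le> T\<close> by simp
    have "((\<lambda>s. s + \<tau> s) \<longlongrightarrow> t + \<tau> t) (at_right t)"
      using \<tau> \<open>t < T\<close> \<open>0 \<le> t\<close> by (intro tendsto_intros) (auto simp: D_up_paths_def cadlag_on_def)
    then show ?thesis
    proof (rule tendsto_lowerbound)
      show "\<forall>\<^sub>F s in at_right t. u \<le> s + \<tau> s"
        unfolding eventually_at_right[OF \<open>t < T\<close>]
      proof (intro exI[of _ T] conjI allI impI \<open>t < T\<close>)
        fix s assume "t < s" "s < T"
        then obtain r where "r \<in> S" "r < s"
          unfolding t_def using cInf_lessD[of S s] S by blast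
        then show "u \<le> s + \<tau> s"
          using path_mono[of r s] \<open>s < T\<close> by (auto simp: S_def)
      qed
    qed simp
  qed
  have lv: "t + left_value a \<tau> t \<le> u"
  proof (cases "t = 0")
    case True then show ?thesis using assms by (simp add: left_value_def)
  next
    case False
    then have "((\<lambda>s. s + \<tau> s) \<longlongrightarrow> t + left_value a \<tau> t) (at_left t)"
      using \<open>0 \<le> t\<close> \<open>t \<le> T\<close> by (intro tendsto_intros tendsto_left_value) auto
    then show ?thesis
    proof (rule tendsto_upperbound)
      show "\<forall>\<^sub>F s in at_left t. s + \<tau> s \<le> u"
        using False \<open>0 \<le> t\<close> below
        by (subst eventually_at_left[of 0]) (auto intro!: exI[of _ 0] less_imp_le)
    qed simp
  qed
  have "arc_time T \<tau> u = t" by (simp add: arc_time_def t_def S_def)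
  then show ?thesis
    using \<open>0 \<le> t\<close> \<open>t \<le> T\<close> above lv by (simp add: completed_graph_iff)
qed

lemma arc_range:
  assumes "(t, z) \<in> completed_graph T a \<tau>"
  shows "a \<le> t + z" "t + z \<le> T + \<tau> T"
proof -
  have "(0, a) \<in> completed_graph T a \<tau>" "(T, \<tau> T) \<in> completed_graph T a \<tau>"
    using T a left_value_le[of T] by (auto simp: completed_graph_iff left_value_def)
  note ends = this
  have t: "0 \<le> t" "t \<le> T" using assms by (auto simp: completed_graph_iff)
  show "a \<le> t + z"
  proof (cases "t = 0")
    case True then show ?thesis using assms by (auto simp: completed_graph_iff left_value_def)
  next
    case False
    then show ?thesis using graph_mono[OF ends(1) assms] t by simp
  qed
  show "t + z \<le> T + \<tau> T"
    using assms path_mono[of t T] t by (auto simp: completed_graph_iff)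
qed

lemma arc_time_graph:
  assumes "(t, z) \<in> completed_graph T a \<tau>"
  shows "arc_time T \<tau> (t + z) = t"
  using graph_mono_arc[OF assms arc_time_on_graph[OF arc_range[OF assms]]]
    graph_mono_arc[OF arc_time_on_graph[OF arc_range[OF assms]] assms] by simp

definition arc_rep :: "real \<Rightarrow> real \<times> real" where
  "arc_rep s = (let u = a + s * (T + \<tau> T - a) in (arc_time T \<tau> u, u - arc_time T \<tau> u))"

lemma arc_length_nonneg: "a \<le> T + \<tau> T"
  using path_mono[of 0 T] T a by simp

lemma arc_param_bounds:
  assumes "0 \<le> s" "s \<le> 1"
  shows "a \<le> a + s * (T + \<tau> T - a)" "a + s * (T + \<tau> T - a) \<le> T + \<tau> T"
proof -
  show "a \<le> a + s * (T + \<tau> T - a)" using assms arc_length_nonneg by simp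
  have "s * (T + \<tau> T - a) \<le> 1 * (T + \<tau> T - a)"
    using assms arc_length_nonneg by (intro mult_right_mono) auto
  then show "a + s * (T + \<tau> T - a) \<le> T + \<tau> T" by simp
qed

lemma arc_rep_on_graph:
  assumes "0 \<le> s" "s \<le> 1"
  shows "arc_rep s \<in> completed_graph T a \<tau>"
  unfolding arc_rep_def Let_def by (rule arc_time_on_graph[OF arc_param_bounds[OF assms]])

lemma arc_rep_sum: "fst (arc_rep s) + snd (arc_rep s) = a + s * (T + \<tau> T - a)"
  by (simp add: arc_rep_def Let_def)

lemma arc_rep_mono:
  assumes "0 \<le> s" "s \<le> s'" "s' \<le> 1"
  shows "fst (arc_rep s) \<le> fst (arc_rep s')" "snd (arc_rep s) \<le> snd (arc_rep s')"
proof -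
  have "s * (T + \<tau> T - a) \<le> s' * (T + \<tau> T - a)"
    using assms arc_length_nonneg by (intro mult_right_mono) auto
  then have le: "fst (arc_rep s) + snd (arc_rep s) \<le> fst (arc_rep s') + snd (arc_rep s')"
    by (simp add: arc_rep_sum)
  have G: "(fst (arc_rep r), snd (arc_rep r)) \<in> completed_graph T a \<tau>" if "0 \<le> r" "r \<le> 1" for r
    using arc_rep_on_graph[OF that] by simp
  show "fst (arc_rep s) \<le> fst (arc_rep s')" "snd (arc_rep s) \<le> snd (arc_rep s')"
    using graph_mono_arc[OF G G le] assms by auto
qed

text \<open>
  Both coordinates are non-decreasing and their sum moves at constant speed.
\<close>

lemma arc_rep_lipschitz:
  assumes "0 \<le> s" "s \<le> s'" "s' \<le> 1"
  shows "\<bar>fst (arc_rep s') - fst (arc_rep s)\<bar> \<le> (s' - s) * (T + \<tau> T - a)"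
    "\<bar>snd (arc_rep s') - snd (arc_rep s)\<bar> \<le> (s' - s) * (T + \<tau> T - a)"
proof -
  have "(fst (arc_rep s') - fst (arc_rep s)) + (snd (arc_rep s') - snd (arc_rep s))
    = (s' - s) * (T + \<tau> T - a)"
    using arc_rep_sum[of s] arc_rep_sum[of s'] by (simp add: algebra_simps)
  then show "\<bar>fst (arc_rep s') - fst (arc_rep s)\<bar> \<le> (s' - s) * (T + \<tau> T - a)"
    "\<bar>snd (arc_rep s') - snd (arc_rep s)\<bar> \<le> (s' - s) * (T + \<tau> T - a)"
    using arc_rep_mono[OF assms] by auto
qed

lemma continuous_arc_rep: "continuous_on {0..1} arc_rep"
proof -
  define l where "l = T + \<tau> T - a"
  have l: "0 \<le> l" using arc_length_nonneg by (simp add: l_def)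
  have *: "\<bar>g x - g y\<bar> \<le> l * \<bar>x - y\<bar>"
    if "x \<in> {0..1}" "y \<in> {0..1}" and g: "g = (\<lambda>s. fst (arc_rep s)) \<or> g = (\<lambda>s. snd (arc_rep s))"
    for g :: "real \<Rightarrow> real" and x y
  proof (cases "x \<le> y")
    case True
    then show ?thesis using arc_rep_lipschitz[of x y] that
      by (auto simp: abs_minus_commute l_def mult.commute)
  next
    case False
    then show ?thesis using arc_rep_lipschitz[of y x] that
      by (auto simp: abs_minus_commute l_def mult.commute)
  qed
  have "l-lipschitz_on {0..1} g"
    if "g = (\<lambda>s. fst (arc_rep s)) \<or> g = (\<lambda>s. snd (arc_rep s))" for g
    using *[OF _ _ that] l by (auto simp: lipschitz_on_def dist_real_def)
  then have "continuous_on {0..1} (\<lambda>s. fst (arc_rep s))" "continuous_on {0..1} (\<lambda>s. snd (arc_rep s))"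
    by (auto intro!: lipschitz_on_continuous_on)
  then have "continuous_on {0..1} (\<lambda>s. (fst (arc_rep s), snd (arc_rep s)))"
    by (rule continuous_on_Pair)
  then show ?thesis by simp
qed

lemma parametric_rep_arc_rep: "parametric_rep T a \<tau> arc_rep"
  unfolding parametric_rep_def
proof (intro conjI ballI impI continuous_arc_rep)
  show "arc_rep ` {0..1} = completed_graph T a \<tau>"
  proof (intro equalityI subsetI)
    fix p assume "p \<in> arc_rep ` {0..1}"
    then show "p \<in> completed_graph T a \<tau>" using arc_rep_on_graph by auto
  next
    fix p assume "p \<in> completed_graph T a \<tau>"
    then obtain t z where p: "p = (t, z)" and G: "(t, z) \<in> completed_graph T a \<tau>" by (cases p) auto
    define l where "l = T + \<tau> T - a"
    have l: "0 < l" using path_mono[of 0 T] T a by (simp add: l_def)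
    define s where "s = (t + z - a) / l"
    have s: "0 \<le> s" "s \<le> 1" "a + s * l = t + z"
      using arc_range[OF G] l by (auto simp: s_def l_def field_simps)
    have "arc_rep s = p"
      using s(3) arc_time_graph[OF G] by (simp add: arc_rep_def Let_def l_def[symmetric] p)
    then show "p \<in> arc_rep ` {0..1}" using s by force
  qed
next
  fix s s' :: real assume s: "s \<in> {0..1}" "s' \<in> {0..1}" "s \<le> s'"
  have G: "left_value a \<tau> (fst (arc_rep r)) \<le> snd (arc_rep r)" if "r \<in> {0..1}" for r
    using arc_rep_on_graph[of r] that by (cases "arc_rep r") (auto simp: completed_graph_iff)
  show "graph_le a \<tau> (arc_rep s) (arc_rep s')"
    using arc_rep_mono[of s s'] s G[of s] G[of s'] unfolding graph_le_def
    by (cases "fst (arc_rep s) < fst (arc_rep s')") auto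
qed

end

lemma grid_point_between:
  fixes T t t' :: real
  assumes "0 < m" "0 < T" "0 \<le> t" "t' \<le> T" "T / real m < t' - t"
  obtains i where "i \<in> {1..m}" "t < real i * T / real m" "real i * T / real m < t'"
proof -
  define i where "i = nat \<lfloor>t * real m / T\<rfloor> + 1"
  have nn: "0 \<le> t * real m / T" using assms by simp
  have i: "real i = of_int \<lfloor>t * real m / T\<rfloor> + 1" using nn by (simp add: i_def)
  have 1: "t * real m / T < real i" and 2: "real i \<le> t * real m / T + 1"
    unfolding i by linarith+
  have a: "t < real i * T / real m" using 1 assms by (simp add: field_simps)
  have "real i * T / real m \<le> (t * real m / T + 1) * T / real m"
    using 2 assms by (intro divide_right_mono mult_right_mono) auto
  also have "\<dots> = t + T / real m" using assms by (simp add: field_simps)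
  finally have b: "real i * T / real m < t'" using assms by simp
  have "real i * T < t' * real m" using b assms by (simp add: field_simps)
  also have "\<dots> \<le> T * real m" using assms by (intro mult_right_mono) auto
  finally have "real i * T < real m * T" by (simp add: mult.commute)
  then have "i \<le> m" using assms by simp
  then have "i \<in> {1..m}" by (simp add: i_def)
  then show ?thesis using a b that by blast
qed

text \<open>
  Suppose that two points, one on each completed graph, have nearly the same coordinate sum but
  time coordinates more than two mesh widths apart. Some grid time lies strictly between them. At this
  time the path whose point comes earlier is already above that point, and the other path is still
  below its own point, which is the lower one of the two; so the paths differ by a mesh width at a
  grid time. Thus the arc-length representations are uniformly close as soon as the paths are close on
  a finite grid. The grid starts at \<open>1\<close>: the time \<open>0\<close> enters only through the initial values.
\<close>

lemma M1_dist_le_grid: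
  assumes T: "0 < T" and \<tau>: "\<tau> \<in> D_up_paths T" and \<sigma>: "\<sigma> \<in> D_up_paths T"
    and m: "0 < m" and grid: "\<And>i. i \<in> {1..m} \<Longrightarrow> \<bar>\<sigma> (real i * T / real m) - \<tau> (real i * T / real m)\<bar> < T / real m"
    and init: "init \<tau> \<le> \<tau> 0" "init \<sigma> \<le> \<sigma> 0" "\<bar>init \<sigma> - init \<tau>\<bar> < T / real m"
  shows "M1_dist T init \<tau> \<sigma> \<le> 3 * (T / real m)"
proof -
  define e where "e = T / real m"
  have e: "0 < e" using T m by (simp add: e_def)
  have close1: "t' - t \<le> 2 * e"
    if G: "(t, z) \<in> completed_graph T b \<rho>" "(t', z') \<in> completed_graph T b' \<rho>'"
      and \<rho>: "\<rho> \<in> D_up_paths T" "\<rho>' \<in> D_up_paths T" "b \<le> \<rho> 0" "b' \<le> \<rho>' 0"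
      and u: "\<bar>(t + z) - (t' + z')\<bar> \<le> e"
      and g: "\<And>i. i \<in> {1..m} \<Longrightarrow> \<bar>\<rho>' (real i * T / real m) - \<rho> (real i * T / real m)\<bar> < e"
    for t z t' z' b b' \<rho> \<rho>'
  proof (rule ccontr)
    assume "\<not> t' - t \<le> 2 * e"
    then have d: "t' - t > 2 * e" by simp
    have t: "0 \<le> t" "t' \<le> T"
      using G by (auto simp: completed_graph_iff[OF T \<rho>(1,3)] completed_graph_iff[OF T \<rho>(2,4)])
    obtain i where i: "i \<in> {1..m}" and s: "t < real i * T / real m" "real i * T / real m < t'"
      using grid_point_between[of m T t t'] m T t d e unfolding e_def by auto
    define s where "s = real i * T / real m"
    have "z \<le> \<rho> t" using G(1) by (simp add: completed_graph_iff[OF T \<rho>(1,3)])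
    also have "\<rho> t \<le> \<rho> s" using path_mono[OF T \<rho>(1) \<rho>(3), of t s] t s by (simp add: s_def)
    finally have 1: "z \<le> \<rho> s" .
    have "\<rho>' s \<le> left_value b' \<rho>' t'"
      using le_left_value[OF T \<rho>(2) \<rho>(4), of s t'] t s by (simp add: s_def)
    also have "\<dots> \<le> z'" using G(2) by (simp add: completed_graph_iff[OF T \<rho>(2,4)])
    finally have 2: "\<rho>' s \<le> z'" .
    show False using 1 2 d u g[OF i] by (simp add: s_def)
  qed
  define \<gamma> where "\<gamma> = arc_rep T (init \<tau>) \<tau>"
  define \<eta> where "\<eta> = arc_rep T (init \<sigma>) \<sigma>"
  have \<gamma>: "parametric_rep T (init \<tau>) \<tau> \<gamma>" "parametric_rep T (init \<sigma>) \<sigma> \<eta>"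
    unfolding \<gamma>_def \<eta>_def using parametric_rep_arc_rep T \<tau> \<sigma> init by auto
  have endT: "\<bar>\<sigma> T - \<tau> T\<bar> < e" using grid[of m] m by (simp add: e_def)
  have pt: "max \<bar>fst (\<gamma> s) - fst (\<eta> s)\<bar> \<bar>snd (\<gamma> s) - snd (\<eta> s)\<bar> \<le> 3 * e" if s: "s \<in> {0..1}" for s
  proof -
    define u where "u = init \<tau> + s * (T + \<tau> T - init \<tau>)"
    define v where "v = init \<sigma> + s * (T + \<sigma> T - init \<sigma>)"
    have "u - v = (1 - s) * (init \<tau> - init \<sigma>) + s * (\<tau> T - \<sigma> T)"
      by (simp add: u_def v_def algebra_simps)
    also have "\<bar>\<dots>\<bar> \<le> (1 - s) * \<bar>init \<tau> - init \<sigma>\<bar> + s * \<bar>\<tau> T - \<sigma> T\<bar>"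
      using s by (intro order_trans[OF abs_triangle_ineq]) (simp add: abs_mult)
    also have "\<dots> \<le> (1 - s) * e + s * e"
      using s init(3) endT by (intro add_mono mult_left_mono) (auto simp: e_def abs_minus_commute)
    finally have uv: "\<bar>u - v\<bar> \<le> e" by (simp add: algebra_simps)
    have sum: "fst (\<gamma> s) + snd (\<gamma> s) = u" "fst (\<eta> s) + snd (\<eta> s) = v"
      unfolding \<gamma>_def \<eta>_def u_def v_def
      by (rule arc_rep_sum[OF T \<tau> init(1)] arc_rep_sum[OF T \<sigma> init(2)])+
    have G: "(fst (\<gamma> s), snd (\<gamma> s)) \<in> completed_graph T (init \<tau>) \<tau>"
        "(fst (\<eta> s), snd (\<eta> s)) \<in> completed_graph T (init \<sigma>) \<sigma>"
      unfolding \<gamma>_def \<eta>_def using arc_rep_on_graph[OF T \<tau> init(1)] arc_rep_on_graph[OF T \<sigma> init(2)] s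
      by auto
    have "fst (\<eta> s) - fst (\<gamma> s) \<le> 2 * e"
      by (rule close1[OF G \<tau> \<sigma> init(1,2)]) (use uv sum grid in \<open>auto simp: e_def\<close>)
    moreover have "fst (\<gamma> s) - fst (\<eta> s) \<le> 2 * e"
      by (rule close1[OF G(2,1) \<sigma> \<tau> init(2,1)])
        (use uv sum grid in \<open>auto simp: e_def abs_minus_commute\<close>)
    ultimately show ?thesis using sum uv e by (simp add: max_def) linarith
  qed
  let ?D = "{SUP s\<in>{0..1}. max \<bar>fst (\<gamma> s) - fst (\<eta> s)\<bar> \<bar>snd (\<gamma> s) - snd (\<eta> s)\<bar> | \<gamma> \<eta>.
       parametric_rep T (init \<tau>) \<tau> \<gamma> \<and> parametric_rep T (init \<sigma>) \<sigma> \<eta>}"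
  have "M1_dist T init \<tau> \<sigma> \<le> (SUP s\<in>{0..1}. max \<bar>fst (\<gamma> s) - fst (\<eta> s)\<bar> \<bar>snd (\<gamma> s) - snd (\<eta> s)\<bar>)"
    unfolding M1_dist_def
  proof (rule cInf_lower)
    show "bdd_below ?D"
    proof (rule bdd_belowI[of _ 0])
      fix x assume "x \<in> ?D"
      then obtain \<gamma> \<eta> where x: "x = (SUP s\<in>{0..1}. max \<bar>fst (\<gamma> s) - fst (\<eta> s)\<bar> \<bar>snd (\<gamma> s) - snd (\<eta> s)\<bar>)"
        and p: "parametric_rep T (init \<tau>) \<tau> \<gamma>" "parametric_rep T (init \<sigma>) \<sigma> \<eta>" by blast
      have "continuous_on {0..1} (\<lambda>s. max \<bar>fst (\<gamma> s) - fst (\<eta> s)\<bar> \<bar>snd (\<gamma> s) - snd (\<eta> s)\<bar>)"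
        using p by (intro continuous_intros) (auto simp: parametric_rep_def)
      then have "compact ((\<lambda>s. max \<bar>fst (\<gamma> s) - fst (\<eta> s)\<bar> \<bar>snd (\<gamma> s) - snd (\<eta> s)\<bar>) ` {0..1})"
        by (rule compact_continuous_image) simp
      then have "bdd_above ((\<lambda>s. max \<bar>fst (\<gamma> s) - fst (\<eta> s)\<bar> \<bar>snd (\<gamma> s) - snd (\<eta> s)\<bar>) ` {0..1})"
        by (intro bounded_imp_bdd_above compact_imp_bounded)
      then show "0 \<le> x" unfolding x by (intro cSUP_upper2[of _ _ 0]) auto
    qed
  qed (use \<gamma> in blast)
  also have "\<dots> \<le> 3 * e" by (rule cSUP_least) (use pt in auto)
  finally show ?thesis by (simp add: e_def)
qed

section \<open>Weak convergence by coupling\<close>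

text \<open>
  Convergence of the functionals in \<open>H\<close> implies convergence in the topology. As \<open>H\<close> is
  countable, this plays the role of separability: measurability of random elements and closeness in
  probability can be checked on one real functional at a time.
\<close>

definition tested_by :: "'e topology \<Rightarrow> ('e \<Rightarrow> real) set \<Rightarrow> bool" where
  "tested_by \<T> H \<longleftrightarrow> countable H \<and> H \<noteq> {} \<and>
     (\<forall>U x. openin \<T> U \<longrightarrow> x \<in> U \<longrightarrow> (\<exists>E e. finite E \<and> E \<subseteq> H \<and> 0 < e \<and>
        (\<forall>y\<in>topspace \<T>. (\<forall>h\<in>E. \<bar>h y - h x\<bar> < e) \<longrightarrow> y \<in> U)))"

text \<open>
  The values of all tests form a map into a countable product of real lines. Its topology is
  second countable, so coordinatewise measurability suffices there, and \<open>A\<close> is the preimage of an open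
  set of this product.
\<close>

lemma sets_vimage_tested:
  fixes H :: "('e \<Rightarrow> real) set"
  assumes H: "countable H" "H \<noteq> {}"
    and A: "A \<subseteq> P" "\<And>x. x \<in> A \<Longrightarrow> \<exists>E e. finite E \<and> E \<subseteq> H \<and> 0 < e \<and>
        (\<forall>y\<in>P. (\<forall>h\<in>E. \<bar>h y - h x\<bar> < e) \<longrightarrow> y \<in> A)"
    and Y: "\<And>\<omega>. \<omega> \<in> space M \<Longrightarrow> Y \<omega> \<in> P"
    and meas: "\<And>h. h \<in> H \<Longrightarrow> (\<lambda>\<omega>. h (Y \<omega>)) \<in> borel_measurable M"
  shows "Y -` A \<inter> space M \<in> sets M"
proof -
  define \<iota> where "\<iota> y = (\<lambda>n. from_nat_into H n y)" for y
  define cyl where "cyl x J e = {z :: nat \<Rightarrow> real. \<forall>j\<in>J. \<bar>z j - \<iota> x j\<bar> < e}" for x J and e :: real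
  have open_cyl: "open (cyl x J e)" if "finite J" for x J e
  proof -
    have "cyl x J e = (\<Inter>j\<in>J. {z. \<bar>z j - \<iota> x j\<bar> < e})" by (auto simp: cyl_def)
    moreover have "open {z :: nat \<Rightarrow> real. \<bar>z j - \<iota> x j\<bar> < e}" for j
      by (intro open_Collect_less continuous_intros continuous_on_product_coordinates)
    ultimately show ?thesis using that by (auto intro!: open_INT)
  qed
  define V where "V = \<Union>{cyl x J e | x J e. x \<in> A \<and> finite J \<and> (\<forall>y\<in>P. \<iota> y \<in> cyl x J e \<longrightarrow> y \<in> A)}"
  have "open V" unfolding V_def by (rule open_Union) (auto intro: open_cyl)
  have in_V: "\<iota> y \<in> V \<longleftrightarrow> y \<in> A" if y: "y \<in> P" for y
  proof
    assume "\<iota> y \<in> V" then show "y \<in> A" using y by (auto simp: V_def)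
  next
    assume yA: "y \<in> A"
    then obtain E e where E: "finite E" "E \<subseteq> H" "0 < e"
      and imp: "\<And>z. z \<in> P \<Longrightarrow> (\<And>h. h \<in> E \<Longrightarrow> \<bar>h z - h y\<bar> < e) \<Longrightarrow> z \<in> A"
      using A(2) by meson
    define J where "J = to_nat_on H ` E"
    have "z \<in> A" if "z \<in> P" "\<iota> z \<in> cyl y J e" for z
    proof (rule imp[OF that(1)])
      fix h assume h: "h \<in> E"
      then have "from_nat_into H (to_nat_on H h) = h" using E H by (intro from_nat_into_to_nat_on) auto
      then show "\<bar>h z - h y\<bar> < e" using that(2) h by (auto simp: cyl_def J_def \<iota>_def)
    qed
    moreover have "finite J" using E by (simp add: J_def)
    moreover have "\<iota> y \<in> cyl y J e" using E by (simp add: cyl_def)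
    ultimately show "\<iota> y \<in> V" unfolding V_def using yA by blast
  qed
  have "(\<lambda>\<omega>. \<iota> (Y \<omega>)) \<in> borel_measurable M"
    by (rule measurable_coordinatewise_then_product)
      (auto simp: \<iota>_def intro!: meas from_nat_into H)
  then have "(\<lambda>\<omega>. \<iota> (Y \<omega>)) -` V \<inter> space M \<in> sets M"
    using \<open>open V\<close> by (intro measurable_sets) auto
  also have "(\<lambda>\<omega>. \<iota> (Y \<omega>)) -` V \<inter> space M = Y -` A \<inter> space M"
    using in_V Y by auto
  finally show ?thesis .
qed

lemma sets_vimage_openin:
  assumes "tested_by \<T> H" "openin \<T> U"
    and "\<And>\<omega>. \<omega> \<in> space M \<Longrightarrow> Y \<omega> \<in> topspace \<T>"
    and "\<And>h. h \<in> H \<Longrightarrow> (\<lambda>\<omega>. h (Y \<omega>)) \<in> borel_measurable M"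
  shows "Y -` U \<inter> space M \<in> sets M"
proof (rule sets_vimage_tested[where P = "topspace \<T>" and H = H])
  show "U \<subseteq> topspace \<T>" using assms(2) by (rule openin_subset)
  show "\<exists>E e. finite E \<and> E \<subseteq> H \<and> 0 < e \<and> (\<forall>y\<in>topspace \<T>. (\<forall>h\<in>E. \<bar>h y - h x\<bar> < e) \<longrightarrow> y \<in> U)"
    if "x \<in> U" for x
    using assms(1,2) that unfolding tested_by_def by blast
qed (use assms in \<open>auto simp: tested_by_def\<close>)

lemma measurable_borel_of_topology_tested:
  assumes "tested_by \<T> H"
    and "\<And>\<omega>. \<omega> \<in> space M \<Longrightarrow> Y \<omega> \<in> topspace \<T>"
    and "\<And>h. h \<in> H \<Longrightarrow> (\<lambda>\<omega>. h (Y \<omega>)) \<in> borel_measurable M"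
  shows "Y \<in> measurable M (borel_of_topology \<T>)"
  unfolding borel_of_topology_def
proof (rule measurable_measure_of)
  show "{U. openin \<T> U} \<subseteq> Pow (topspace \<T>)" by (auto dest: openin_subset)
qed (use assms sets_vimage_openin[OF assms(1), where M = M and Y = Y] in auto)

lemma borel_measurable_continuous_tested:
  assumes "tested_by \<T> H"
    and "\<And>\<omega>. \<omega> \<in> space M \<Longrightarrow> Y \<omega> \<in> topspace \<T>"
    and "\<And>h. h \<in> H \<Longrightarrow> (\<lambda>\<omega>. h (Y \<omega>)) \<in> borel_measurable M"
    and "continuous_map \<T> euclideanreal \<Phi>"
  shows "(\<lambda>\<omega>. \<Phi> (Y \<omega>)) \<in> borel_measurable M"
proof (rule borel_measurableI)
  fix S :: "real set" assume "open S"
  then have "openin \<T> {x \<in> topspace \<T>. \<Phi> x \<in> S}"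
    using assms(4) by (auto simp: continuous_map_def)
  then have "Y -` {x \<in> topspace \<T>. \<Phi> x \<in> S} \<inter> space M \<in> sets M"
    using sets_vimage_openin[OF assms(1), where M = M and Y = Y] assms(2,3) by blast
  also have "Y -` {x \<in> topspace \<T>. \<Phi> x \<in> S} \<inter> space M = (\<lambda>\<omega>. \<Phi> (Y \<omega>)) -` S \<inter> space M"
    using assms(2) by auto
  finally show "(\<lambda>\<omega>. \<Phi> (Y \<omega>)) -` S \<inter> space M \<in> sets M" .
qed

lemma tested_by_continuous:
  assumes H: "tested_by \<T> H" and \<Phi>: "continuous_map \<T> euclideanreal \<Phi>"
    and x: "x \<in> topspace \<T>" and "0 < \<eta>"
  obtains m where "\<And>y. y \<in> topspace \<T> \<Longrightarrow>
      (\<forall>j\<le>m. \<bar>from_nat_into H j y - from_nat_into H j x\<bar> < 1 / Suc m) \<Longrightarrow> \<bar>\<Phi> y - \<Phi> x\<bar> < \<eta>"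
proof -
  define U where "U = {y \<in> topspace \<T>. \<Phi> y \<in> ball (\<Phi> x) \<eta>}"
  have "openin \<T> U" using \<Phi> by (auto simp: U_def continuous_map_def)
  moreover have "x \<in> U" using x \<open>0 < \<eta>\<close> by (simp add: U_def)
  ultimately obtain E e where E: "finite E" "E \<subseteq> H" "0 < e"
    and imp: "\<And>y. y \<in> topspace \<T> \<Longrightarrow> (\<And>h. h \<in> E \<Longrightarrow> \<bar>h y - h x\<bar> < e) \<Longrightarrow> y \<in> U"
    using H unfolding tested_by_def by meson
  obtain k :: nat where k: "1 / Suc k < e" using nat_approx_posE[OF E(3)] by auto
  obtain l where l: "\<forall>j\<in>to_nat_on H ` E. j \<le> l"
    using E(1) finite_nat_set_iff_bounded_le by (metis finite_imageI)
  show ?thesis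
  proof (rule that[of "max k l"])
    fix y assume y: "y \<in> topspace \<T>"
      and cl: "\<forall>j\<le>max k l. \<bar>from_nat_into H j y - from_nat_into H j x\<bar> < 1 / Suc (max k l)"
    have "y \<in> U"
    proof (rule imp[OF y])
      fix h assume h: "h \<in> E"
      then have "from_nat_into H (to_nat_on H h) = h"
        using E H by (intro from_nat_into_to_nat_on) (auto simp: tested_by_def)
      then have "\<bar>h y - h x\<bar> < 1 / Suc (max k l)" using cl l h by (metis image_eqI max.coboundedI2)
      also have "\<dots> \<le> 1 / Suc k" by (simp add: field_simps)
      finally show "\<bar>h y - h x\<bar> < e" using k by simp
    qed
    then show "\<bar>\<Phi> y - \<Phi> x\<bar> < \<eta>" by (simp add: U_def dist_real_def abs_minus_commute)
  qed
qed

lemma abs_diff_expectation_le: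
  fixes u v :: "'a \<Rightarrow> real"
  assumes "prob_space M" and [measurable]: "u \<in> borel_measurable M" "v \<in> borel_measurable M" "A \<in> sets M"
    and b: "\<And>\<omega>. \<omega> \<in> space M \<Longrightarrow> \<bar>u \<omega>\<bar> \<le> b" "\<And>\<omega>. \<omega> \<in> space M \<Longrightarrow> \<bar>v \<omega>\<bar> \<le> b"
    and A: "\<And>\<omega>. \<omega> \<in> space M \<Longrightarrow> \<omega> \<notin> A \<Longrightarrow> \<bar>u \<omega> - v \<omega>\<bar> \<le> \<eta>"
  shows "\<bar>(\<integral>\<omega>. u \<omega> \<partial>M) - (\<integral>\<omega>. v \<omega> \<partial>M)\<bar> \<le> \<bar>\<eta>\<bar> + 2 * b * measure M A"
proof -
  interpret prob_space M by fact
  have i: "integrable M u" "integrable M v"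
    by (rule integrable_const_bound[of _ b]; use b in auto)+
  have iA: "integrable M (indicat_real A)" by (rule integrable_const_bound[of _ 1]) auto
  have "\<bar>(\<integral>\<omega>. u \<omega> \<partial>M) - (\<integral>\<omega>. v \<omega> \<partial>M)\<bar> = \<bar>\<integral>\<omega>. u \<omega> - v \<omega> \<partial>M\<bar>" using i by simp
  also have "\<dots> \<le> (\<integral>\<omega>. \<bar>u \<omega> - v \<omega>\<bar> \<partial>M)" by (rule integral_abs_bound)
  also have "\<dots> \<le> (\<integral>\<omega>. \<bar>\<eta>\<bar> + 2 * b * indicator A \<omega> \<partial>M)"
  proof (rule integral_mono)
    fix \<omega> assume w: "\<omega> \<in> space M"
    show "\<bar>u \<omega> - v \<omega>\<bar> \<le> \<bar>\<eta>\<bar> + 2 * b * indicator A \<omega>"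
      using A[OF w] b[OF w] by (cases "\<omega> \<in> A") auto
  qed (use i iA in auto)
  also have "\<dots> = \<bar>\<eta>\<bar> + 2 * b * measure M A" by (simp add: prob_space iA)
  finally show ?thesis .
qed

text \<open>
  The elements \<open>J (w n)\<close> all have the law of \<open>J b\<close>. For one fixed law a continuous \<open>\<Phi>\<close> is
  uniformly continuous up to a small event: the points at which \<open>\<Phi>\<close> oscillates by more than \<open>\<eta>\<close>
  among the points that agree with it up to \<open>1 / (m + 1)\<close> in the tests \<open>0, \<dots>, m\<close> form events that
  decrease to the empty set as \<open>m\<close> grows. Off such an event, closeness in these tests bounds
  \<open>\<Phi> (Y n) - \<Phi> (J (w n))\<close>.
\<close>

lemma converges_weakly_coupling:
  fixes M :: "nat \<Rightarrow> 'a measure" and Y :: "nat \<Rightarrow> 'a \<Rightarrow> 'e" and N :: "'b measure"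
    and S :: "'s measure" and J :: "'s \<Rightarrow> 'e"
  assumes H: "tested_by \<T> H"
    and M: "\<And>n. 1 \<le> n \<Longrightarrow> prob_space (M n)" and N: "prob_space N"
    and Y: "\<And>n \<omega>. 1 \<le> n \<Longrightarrow> \<omega> \<in> space (M n) \<Longrightarrow> Y n \<omega> \<in> topspace \<T>"
    and hY: "\<And>n h. 1 \<le> n \<Longrightarrow> h \<in> H \<Longrightarrow> (\<lambda>\<omega>. h (Y n \<omega>)) \<in> borel_measurable (M n)"
    and J: "\<And>s. s \<in> space S \<Longrightarrow> J s \<in> topspace \<T>"
    and hJ: "\<And>h. h \<in> H \<Longrightarrow> (\<lambda>s. h (J s)) \<in> borel_measurable S"
    and w: "\<And>n. 1 \<le> n \<Longrightarrow> w n \<in> measurable (M n) S" and b: "b \<in> measurable N S"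
    and law: "\<And>n. 1 \<le> n \<Longrightarrow> distr (M n) S (w n) = distr N S b"
    and close: "\<And>h e. h \<in> H \<Longrightarrow> 0 < e \<Longrightarrow>
      (\<lambda>n. measure (M n) {\<omega> \<in> space (M n). e \<le> \<bar>h (Y n \<omega>) - h (J (w n \<omega>))\<bar>}) \<longlonglongrightarrow> 0"
  shows "converges_weakly \<T> M Y N (\<lambda>\<omega>. J (b \<omega>))"
  unfolding converges_weakly_def
proof (intro conjI allI impI; (elim conjE exE)?)
  show "Y n \<in> measurable (M n) (borel_of_topology \<T>)" if "1 \<le> n" for n
    by (rule measurable_borel_of_topology_tested[OF H]) (use Y hY that in auto)
  have bS: "b \<omega> \<in> space S" if "\<omega> \<in> space N" for \<omega> using measurable_space[OF b that] .
  show "(\<lambda>\<omega>. J (b \<omega>)) \<in> measurable N (borel_of_topology \<T>)"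
    by (rule measurable_borel_of_topology_tested[OF H])
      (use J bS measurable_compose[OF b hJ] in auto)
next
  fix \<Phi> :: "'e \<Rightarrow> real" and c
  assume \<Phi>: "continuous_map \<T> euclideanreal \<Phi>" and c: "\<forall>x\<in>topspace \<T>. \<bar>\<Phi> x\<bar> \<le> c"
  interpret N: prob_space N by fact
  define \<mu> where "\<mu> = distr N S b"
  interpret \<mu>: prob_space \<mu> unfolding \<mu>_def using b by (rule N.prob_space_distr)
  have space\<mu>[simp]: "space \<mu> = space S" "sets \<mu> = sets S" by (simp_all add: \<mu>_def)
  let ?h = "from_nat_into H"
  have hH: "?h j \<in> H" for j using H by (intro from_nat_into) (simp add: tested_by_def)
  have \<Phi>J: "(\<lambda>s. \<Phi> (J s)) \<in> borel_measurable S"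
    by (rule borel_measurable_continuous_tested[OF H _ _ \<Phi>]) (use J hJ in auto)
  have c0: "0 \<le> c"
  proof -
    obtain \<omega> where "\<omega> \<in> space N" using N.not_empty by blast
    then have "J (b \<omega>) \<in> topspace \<T>" using J[OF measurable_space[OF b]] by blast
    then show ?thesis using c by force
  qed
  show "(\<lambda>n. \<integral>\<omega>. \<Phi> (Y n \<omega>) \<partial>M n) \<longlonglongrightarrow> (\<integral>\<omega>. \<Phi> (J (b \<omega>)) \<partial>N)"
  proof (rule LIMSEQ_I)
    fix r :: real assume r: "0 < r"
    define \<eta> where "\<eta> = r / 2"
    define cl where "cl m x y \<longleftrightarrow> (\<forall>j\<le>m. \<bar>?h j y - ?h j x\<bar> < 1 / Suc m)" for m x y
    define A where "A m = {x \<in> topspace \<T>. \<exists>y\<in>topspace \<T>. cl m x y \<and> \<eta> < \<bar>\<Phi> x - \<Phi> y\<bar>}" for m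
    define B where "B m = J -` A m \<inter> space S" for m
    \<comment> \<open>strict inequalities in finitely many tests make \<open>A m\<close> open for the tests\<close>
    have A_sets: "B m \<in> sets S" for m
      unfolding B_def
    proof (rule sets_vimage_tested[where P = "topspace \<T>" and H = H])
      fix x assume "x \<in> A m"
      then obtain y where x: "x \<in> topspace \<T>" and y: "y \<in> topspace \<T>" "cl m x y" "\<eta> < \<bar>\<Phi> x - \<Phi> y\<bar>"
        by (auto simp: A_def)
      obtain k where k: "\<And>z. z \<in> topspace \<T> \<Longrightarrow> (\<forall>j\<le>k. \<bar>?h j z - ?h j x\<bar> < 1 / Suc k) \<Longrightarrow>
          \<bar>\<Phi> z - \<Phi> x\<bar> < \<bar>\<Phi> x - \<Phi> y\<bar> - \<eta>"
        using tested_by_continuous[OF H \<Phi> x, of "\<bar>\<Phi> x - \<Phi> y\<bar> - \<eta>"] y(3) by auto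
      define g where "g = Min ((\<lambda>j. 1 / Suc m - \<bar>?h j y - ?h j x\<bar>) ` {..m})"
      have g: "0 < g" using y(2) by (auto simp: g_def cl_def)
      have gle: "g \<le> 1 / Suc m - \<bar>?h j y - ?h j x\<bar>" if "j \<le> m" for j
        unfolding g_def using that by (intro Min_le) auto
      have "z \<in> A m" if z: "z \<in> topspace \<T>"
        and zx: "\<forall>h\<in>?h ` {..max m k}. \<bar>h z - h x\<bar> < min g (1 / Suc k)" for z
      proof -
        have z': "\<bar>?h j z - ?h j x\<bar> < g" "\<bar>?h j z - ?h j x\<bar> < 1 / Suc k" if "j \<le> max m k" for j
          using zx that by auto
        have "\<bar>\<Phi> z - \<Phi> x\<bar> < \<bar>\<Phi> x - \<Phi> y\<bar> - \<eta>"
          using z'(2) by (intro k[OF z]) auto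
        moreover have "cl m z y" unfolding cl_def
        proof (intro allI impI)
          fix j assume "j \<le> m"
          then show "\<bar>?h j y - ?h j z\<bar> < 1 / Suc m"
            using z'(1)[of j] gle[of j] by linarith
        qed
        ultimately show ?thesis unfolding A_def using z y by (auto intro!: bexI[of _ y])
      qed
      moreover have "finite (?h ` {..max m k})" "?h ` {..max m k} \<subseteq> H" "0 < min g (1 / Suc k)"
        using hH g by auto
      ultimately show "\<exists>E e. finite E \<and> E \<subseteq> H \<and> 0 < e \<and>
          (\<forall>y\<in>topspace \<T>. (\<forall>h\<in>E. \<bar>h y - h x\<bar> < e) \<longrightarrow> y \<in> A m)"
        by blast
    qed (use H J hJ in \<open>auto simp: tested_by_def A_def\<close>)
    have "decseq B"
    proof (rule decseq_SucI)
      fix m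
      have "cl m x y" if "cl (Suc m) x y" for x y
        unfolding cl_def
      proof (intro allI impI)
        fix j assume "j \<le> m"
        then have "\<bar>?h j y - ?h j x\<bar> < 1 / Suc (Suc m)" using that by (auto simp: cl_def)
        also have "\<dots> \<le> 1 / Suc m" by (simp add: field_simps)
        finally show "\<bar>?h j y - ?h j x\<bar> < 1 / Suc m" .
      qed
      then show "B (Suc m) \<subseteq> B m" by (auto simp: B_def A_def)
    qed
    moreover have "(\<Inter>m. B m) = {}"
    proof (rule ccontr)
      assume "(\<Inter>m. B m) \<noteq> {}"
      then obtain s where s: "\<And>m. J s \<in> A m" by (auto simp: B_def)
      then have x: "J s \<in> topspace \<T>" by (auto simp: A_def)
      obtain m where m: "\<And>y. y \<in> topspace \<T> \<Longrightarrow> cl m (J s) y \<Longrightarrow> \<bar>\<Phi> y - \<Phi> (J s)\<bar> < \<eta>"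
        using tested_by_continuous[OF H \<Phi> x, of \<eta>] r unfolding cl_def \<eta>_def by auto
      obtain y where "y \<in> topspace \<T>" "cl m (J s) y" "\<eta> < \<bar>\<Phi> (J s) - \<Phi> y\<bar>"
        using s[of m] by (auto simp: A_def)
      then show False using m[of y] by auto
    qed
    ultimately have "(\<lambda>m. measure \<mu> (B m)) \<longlonglongrightarrow> 0"
      using \<mu>.finite_Lim_measure_decseq[of B] A_sets by auto
    moreover define q where "q = r / (8 * (c + 1))"
    have q: "0 < q" using r c0 by (simp add: q_def)
    ultimately have "\<forall>\<^sub>F m in sequentially. measure \<mu> (B m) < q"
      by (intro order_tendstoD)
    then obtain m where m: "measure \<mu> (B m) < q" by (auto simp: eventually_sequentially)
    define C where "C n = {\<omega> \<in> space (M n). \<exists>j\<le>m. 1 / Suc m \<le> \<bar>?h j (Y n \<omega>) - ?h j (J (w n \<omega>))\<bar>}" for n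
    have hJw: "(\<lambda>\<omega>. ?h j (J (w n \<omega>))) \<in> borel_measurable (M n)" if "1 \<le> n" for n j
      using measurable_compose[OF w[OF that] hJ[OF hH]] .
    have Cj: "{\<omega> \<in> space (M n). 1 / Suc m \<le> \<bar>?h j (Y n \<omega>) - ?h j (J (w n \<omega>))\<bar>} \<in> sets (M n)"
      if "1 \<le> n" for n j
      using hY[OF that hH, of j] hJw[OF that, of j] by measurable
    have C_eq: "C n = (\<Union>j\<in>{..m}. {\<omega> \<in> space (M n). 1 / Suc m \<le> \<bar>?h j (Y n \<omega>) - ?h j (J (w n \<omega>))\<bar>})" for n
      by (auto simp: C_def)
    have "(\<lambda>n. \<Sum>j\<le>m. measure (M n) {\<omega> \<in> space (M n). 1 / Suc m \<le> \<bar>?h j (Y n \<omega>) - ?h j (J (w n \<omega>))\<bar>}) \<longlonglongrightarrow> (\<Sum>j\<le>m. 0)"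
      by (intro tendsto_sum close hH) simp
    then have "\<forall>\<^sub>F n in sequentially. (\<Sum>j\<le>m. measure (M n) {\<omega> \<in> space (M n). 1 / Suc m \<le> \<bar>?h j (Y n \<omega>) - ?h j (J (w n \<omega>))\<bar>}) < q"
      using q by (intro order_tendstoD) auto
    then obtain n0 where n0: "\<And>n. n0 \<le> n \<Longrightarrow>
        (\<Sum>j\<le>m. measure (M n) {\<omega> \<in> space (M n). 1 / Suc m \<le> \<bar>?h j (Y n \<omega>) - ?h j (J (w n \<omega>))\<bar>}) < q"
      by (auto simp: eventually_sequentially)
    have "\<bar>(\<integral>\<omega>. \<Phi> (Y n \<omega>) \<partial>M n) - (\<integral>\<omega>. \<Phi> (J (b \<omega>)) \<partial>N)\<bar> < r" if n: "max 1 n0 \<le> n" for n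
    proof -
      have n1: "1 \<le> n" using n by simp
      interpret Mn: prob_space "M n" using M[OF n1] .
      have wS: "w n \<omega> \<in> space S" if "\<omega> \<in> space (M n)" for \<omega> using measurable_space[OF w[OF n1] that] .
      have D: "w n -` B m \<inter> space (M n) \<in> sets (M n)" using A_sets w[OF n1] by (rule measurable_sets[rotated])
      have "measure (M n) (w n -` B m \<inter> space (M n)) = measure (distr (M n) S (w n)) (B m)"
        using A_sets w[OF n1] by (simp add: measure_distr)
      also have "\<dots> = measure \<mu> (B m)" using law[OF n1] by (simp add: \<mu>_def)
      finally have Dm: "measure (M n) (w n -` B m \<inter> space (M n)) < q" using m by simp
      have Cs: "C n \<in> sets (M n)" unfolding C_eq using Cj[OF n1] by auto
      have "measure (M n) (C n) \<le> (\<Sum>j\<le>m. measure (M n) {\<omega> \<in> space (M n). 1 / Suc m \<le> \<bar>?h j (Y n \<omega>) - ?h j (J (w n \<omega>))\<bar>})"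
        unfolding C_eq using Cj[OF n1] by (intro Mn.finite_measure_subadditive_finite) auto
      then have Cm: "measure (M n) (C n) < q" using n0[of n] n by simp
      have "\<bar>(\<integral>\<omega>. \<Phi> (Y n \<omega>) \<partial>M n) - (\<integral>\<omega>. \<Phi> (J (w n \<omega>)) \<partial>M n)\<bar>
        \<le> \<bar>\<eta>\<bar> + 2 * c * measure (M n) (C n \<union> (w n -` B m \<inter> space (M n)))"
      proof (rule abs_diff_expectation_le)
        show "(\<lambda>\<omega>. \<Phi> (Y n \<omega>)) \<in> borel_measurable (M n)"
          by (rule borel_measurable_continuous_tested[OF H _ _ \<Phi>]) (use Y hY n1 in auto)
        show "(\<lambda>\<omega>. \<Phi> (J (w n \<omega>))) \<in> borel_measurable (M n)"
          using measurable_compose[OF w[OF n1] \<Phi>J] .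
        show "\<bar>\<Phi> (Y n \<omega>) - \<Phi> (J (w n \<omega>))\<bar> \<le> \<eta>"
          if "\<omega> \<in> space (M n)" and out: "\<omega> \<notin> C n \<union> (w n -` B m \<inter> space (M n))" for \<omega>
        proof (rule ccontr)
          assume "\<not> \<bar>\<Phi> (Y n \<omega>) - \<Phi> (J (w n \<omega>))\<bar> \<le> \<eta>"
          moreover have "cl m (J (w n \<omega>)) (Y n \<omega>)"
            using that unfolding C_def cl_def by (fastforce simp: not_le)
          ultimately have "J (w n \<omega>) \<in> A m"
            using Y[OF n1 that(1)] J[OF wS[OF that(1)]] by (auto simp: A_def abs_minus_commute)
          then show False using out that(1) wS[OF that(1)] by (auto simp: B_def)
        qed
      qed (use c Y[OF n1] J wS Cs D Mn.prob_space_axioms in auto)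
      also have "measure (M n) (C n \<union> (w n -` B m \<inter> space (M n))) \<le> 2 * q"
        using measure_Un_le[OF Cs D] Cm Dm by simp
      then have "\<bar>\<eta>\<bar> + 2 * c * measure (M n) (C n \<union> (w n -` B m \<inter> space (M n))) \<le> \<bar>\<eta>\<bar> + 2 * c * (2 * q)"
        using c0 by (intro add_left_mono mult_left_mono) auto
      also have "\<dots> < r"
      proof -
        have "c * (4 * q) < r / 2" using c0 r by (simp add: q_def field_simps)
        then show ?thesis using r by (simp add: \<eta>_def)
      qed
      also have "(\<integral>\<omega>. \<Phi> (J (w n \<omega>)) \<partial>M n) = (\<integral>s. \<Phi> (J s) \<partial>distr (M n) S (w n))"
        by (rule integral_distr[symmetric, OF w[OF n1] \<Phi>J])
      also have "\<dots> = (\<integral>\<omega>. \<Phi> (J (b \<omega>)) \<partial>N)"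
        unfolding law[OF n1] by (rule integral_distr[OF b \<Phi>J])
      finally show ?thesis .
    qed
    then show "\<exists>no. \<forall>n\<ge>no. norm ((\<integral>\<omega>. \<Phi> (Y n \<omega>) \<partial>M n) - (\<integral>\<omega>. \<Phi> (J (b \<omega>)) \<partial>N)) < r"
      by (metis real_norm_def)
  qed
qed

section \<open>Countable tests for the path spaces\<close>

lemma le_on_rationals_imp_le:
  fixes g :: "real \<Rightarrow> real"
  assumes "a < b" "continuous_on {a..b} g" "\<And>q. q \<in> \<rat> \<Longrightarrow> q \<in> {a..b} \<Longrightarrow> g q \<le> c" "t \<in> {a..b}"
  shows "g t \<le> c"
proof (rule ccontr)
  assume "\<not> g t \<le> c"
  then obtain d where d: "0 < d" "\<And>s. s \<in> {a..b} \<Longrightarrow> dist s t < d \<Longrightarrow> dist (g s) (g t) < g t - c"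
    using assms(2,4) unfolding continuous_on_iff by (metis diff_gt_0_iff_gt not_le)
  have "max a (t - d) < min b (t + d)" using assms(1,4) d(1) by auto
  then obtain q where q: "q \<in> \<rat>" "max a (t - d) < q" "q < min b (t + d)"
    using Rats_dense_in_real by blast
  then have "dist (g q) (g t) < g t - c" by (intro d(2)) (auto simp: dist_real_def)
  moreover have "g q \<le> c" using q by (intro assms(3)) auto
  ultimately show False by (auto simp: dist_real_def)
qed

text \<open>
  A modulus of continuity relative to the grid of mesh \<open>1 / (k + 1)\<close>. With one running time, which is
  rational, it is a countable supremum of evaluations, and hence a measurable functional of the path.
\<close>

definition grid_osc :: "nat \<Rightarrow> nat \<Rightarrow> (real \<Rightarrow> real) \<Rightarrow> real" where
  "grid_osc N k \<phi> = (SUP t\<in>{0..real N} \<inter> \<rat>. \<bar>\<phi> t - \<phi> (of_int \<lfloor>t * Suc k\<rfloor> / Suc k)\<bar>)"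

lemma floor_grid:
  fixes t :: real
  assumes "0 \<le> t" "t \<le> real N"
  obtains i where "i \<le> N * Suc k" "of_int \<lfloor>t * Suc k\<rfloor> / Suc k = real i / Suc k"
    "real i / Suc k \<le> t" "t < real i / Suc k + 1 / Suc k"
proof -
  define i where "i = nat \<lfloor>t * Suc k\<rfloor>"
  have "0 \<le> t * Suc k" using assms by simp
  then have i: "real i = of_int \<lfloor>t * Suc k\<rfloor>" by (simp add: i_def)
  have 1: "real i \<le> t * Suc k" "t * Suc k < real i + 1" unfolding i by linarith+
  have "t * Suc k \<le> real N * Suc k" using assms by (intro mult_right_mono) auto
  then have "real i \<le> real (N * Suc k)" using 1 by (metis of_nat_mult order_trans)
  then have "i \<le> N * Suc k" by (simp only: of_nat_le_iff)
  then show ?thesis using 1 by (intro that[of i]) (auto simp: i field_simps)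
qed

lemma C_paths_bounded:
  assumes "\<phi> \<in> C_paths"
  obtains B where "\<And>t. t \<in> {0..N} \<Longrightarrow> \<bar>\<phi> t\<bar> \<le> B"
proof -
  have "continuous_on {0..N} \<phi>"
    using assms by (auto simp: C_paths_def elim: continuous_on_subset)
  then have "compact (\<phi> ` {0..N})" by (intro compact_continuous_image) auto
  then obtain B where "\<forall>x\<in>\<phi> ` {0..N}. norm x \<le> B"
    using compact_imp_bounded bounded_iff by metis
  then show ?thesis by (intro that[of B]) auto
qed

lemma grid_osc_bdd:
  assumes "\<phi> \<in> C_paths"
  shows "bdd_above ((\<lambda>t. \<bar>\<phi> t - \<phi> (of_int \<lfloor>t * Suc k\<rfloor> / Suc k)\<bar>) ` ({0..real N} \<inter> \<rat>))"
proof -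
  obtain B where B: "\<And>t. t \<in> {0..real N} \<Longrightarrow> \<bar>\<phi> t\<bar> \<le> B" using C_paths_bounded[OF assms] by metis
  show ?thesis
  proof (rule bdd_aboveI2[of _ _ "2 * B"])
    fix t assume t: "t \<in> {0..real N} \<inter> \<rat>"
    then obtain i where i: "of_int \<lfloor>t * Suc k\<rfloor> / Suc k = real i / Suc k" "real i / Suc k \<le> t"
      using floor_grid[of t N k] by auto
    then show "\<bar>\<phi> t - \<phi> (of_int \<lfloor>t * Suc k\<rfloor> / Suc k)\<bar> \<le> 2 * B"
      using B[of t] B[of "real i / Suc k"] t by auto
  qed
qed

text \<open>
  Closeness at grid points does not bound the uniform distance. Together with closeness of the grid
  oscillations it does, because a path near \<open>\<phi>\<close> in these tests oscillates little more than \<open>\<phi>\<close>.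
\<close>

definition C_tests :: "((real \<Rightarrow> real) \<Rightarrow> real) set" where
  "C_tests = range (\<lambda>(i, k) \<phi>. \<phi> (real i / real (Suc k))) \<union> range (\<lambda>(N, k). grid_osc N k)"

lemma tested_by_C: "tested_by C_topology C_tests"
  unfolding tested_by_def topspace_C_topology
proof (intro conjI allI impI)
  show "countable C_tests" "C_tests \<noteq> {}" by (auto simp: C_tests_def)
  fix U \<phi> assume "openin C_topology U" and \<phi>U: "\<phi> \<in> U"
  then obtain N0 \<epsilon> where \<epsilon>: "0 < \<epsilon>" and \<phi>: "\<phi> \<in> C_paths"
    and imp: "\<And>\<psi>. \<psi> \<in> C_paths \<Longrightarrow> (\<And>t. t \<in> {0..N0} \<Longrightarrow> \<bar>\<psi> t - \<phi> t\<bar> < \<epsilon>) \<Longrightarrow> \<psi> \<in> U"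
    unfolding openin_C_topology by (meson subsetD)
  define N where "N = nat \<lceil>N0\<rceil> + 1"
  have N: "N0 \<le> real N" "0 < real N" unfolding N_def by linarith+
  have "continuous_on {0..real N} \<phi>"
    using \<phi> by (auto simp: C_paths_def elim: continuous_on_subset)
  then have "uniformly_continuous_on {0..real N} \<phi>" by (intro compact_uniformly_continuous) auto
  from this[unfolded uniformly_continuous_on_def dist_real_def, rule_format, of "\<epsilon> / 4"] \<epsilon>
  obtain \<delta> where \<delta>: "0 < \<delta>"
    "\<And>t s. t \<in> {0..real N} \<Longrightarrow> s \<in> {0..real N} \<Longrightarrow> \<bar>s - t\<bar> < \<delta> \<Longrightarrow> \<bar>\<phi> s - \<phi> t\<bar> < \<epsilon> / 4"
    by auto
  obtain k :: nat where k: "1 / Suc k < \<delta>" using nat_approx_posE[OF \<delta>(1)] by auto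
  have osc: "\<bar>\<phi> t - \<phi> (of_int \<lfloor>t * Suc k\<rfloor> / Suc k)\<bar> \<le> \<epsilon> / 4" if t: "t \<in> {0..real N}" for t :: real
  proof -
    have t': "0 \<le> t" "t \<le> real N" using t by simp_all
    obtain i where i: "of_int \<lfloor>t * Suc k\<rfloor> / Suc k = real i / Suc k" "real i / Suc k \<le> t"
        "t < real i / Suc k + 1 / Suc k"
      using floor_grid[OF t', of k] by blast
    have "\<bar>real i / Suc k - t\<bar> < \<delta>" using i k by linarith
    moreover have "real i / Suc k \<in> {0..real N}" using i(2) t'(2) by (simp del: of_nat_Suc)
    ultimately have "\<bar>\<phi> (real i / Suc k) - \<phi> t\<bar> < \<epsilon> / 4"
      using \<delta>(2)[OF t] by blast
    then show ?thesis unfolding i(1) by linarith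
  qed
  have "grid_osc N k \<phi> \<le> \<epsilon> / 4"
    unfolding grid_osc_def
  proof (rule cSUP_least)
    show "{0..real N} \<inter> \<rat> \<noteq> {}" using Rats_0 N(2) by (metis IntI atLeastAtMost_iff empty_iff less_imp_le order_refl)
  qed (use osc in blast)
  define E where "E = insert (grid_osc N k) ((\<lambda>i \<psi>. \<psi> (real i / real (Suc k))) ` {..N * Suc k})"
  have "finite E" "E \<subseteq> C_tests" by (auto simp: E_def C_tests_def)
  moreover have "\<psi> \<in> U" if \<psi>: "\<psi> \<in> C_paths" and h: "\<forall>h\<in>E. \<bar>h \<psi> - h \<phi>\<bar> < \<epsilon> / 8" for \<psi>
  proof (rule imp[OF \<psi>])
    have "\<bar>grid_osc N k \<psi> - grid_osc N k \<phi>\<bar> < \<epsilon> / 8" using h unfolding E_def by blast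
    then have "grid_osc N k \<psi> \<le> 3 * \<epsilon> / 8" using \<open>grid_osc N k \<phi> \<le> \<epsilon> / 4\<close> by linarith
    have pt: "\<bar>\<psi> t - \<phi> t\<bar> \<le> 3 * \<epsilon> / 4" if "t \<in> \<rat>" "t \<in> {0..real N}" for t :: real
    proof -
      have t': "0 \<le> t" "t \<le> real N" using that(2) by simp_all
      obtain i where i: "i \<le> N * Suc k" "of_int \<lfloor>t * Suc k\<rfloor> / Suc k = real i / Suc k"
        using floor_grid[OF t', of k] by blast
      have "\<bar>\<psi> t - \<psi> (real i / Suc k)\<bar> \<le> grid_osc N k \<psi>"
        unfolding grid_osc_def i(2)[symmetric] using that
        by (intro cSUP_upper grid_osc_bdd[OF \<psi>]) auto
      moreover have "\<bar>\<phi> t - \<phi> (real i / Suc k)\<bar> \<le> \<epsilon> / 4" using osc[OF that(2)] unfolding i(2) .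
      moreover have "\<bar>\<psi> (real i / Suc k) - \<phi> (real i / Suc k)\<bar> < \<epsilon> / 8"
      proof -
        have "(\<lambda>\<psi>. \<psi> (real i / real (Suc k))) \<in> E" unfolding E_def using i(1) by blast
        from bspec[OF h this] show ?thesis .
      qed
      ultimately show ?thesis using \<open>grid_osc N k \<psi> \<le> 3 * \<epsilon> / 8\<close> by linarith
    qed
    fix t assume t: "t \<in> {0..N0}"
    have "\<bar>\<psi> t - \<phi> t\<bar> \<le> 3 * \<epsilon> / 4"
    proof (rule le_on_rationals_imp_le[OF N(2) _ pt])
      show "continuous_on {0..real N} (\<lambda>t. \<bar>\<psi> t - \<phi> t\<bar>)"
        using \<phi> \<psi> by (intro continuous_intros) (auto simp: C_paths_def elim: continuous_on_subset)
    qed (use t N in auto)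
    then show "\<bar>\<psi> t - \<phi> t\<bar> < \<epsilon>" using \<epsilon> by simp
  qed
  ultimately show "\<exists>E e. finite E \<and> E \<subseteq> C_tests \<and> 0 < e \<and>
      (\<forall>y\<in>C_paths. (\<forall>h\<in>E. \<bar>h y - h \<phi>\<bar> < e) \<longrightarrow> y \<in> U)"
    using \<epsilon> by (intro exI[of _ E] exI[of _ "\<epsilon> / 8"]) auto
qed

text \<open>
  The dichotomy on \<open>init\<close> covers the two conventions for \<open>\<tau>(0-)\<close>. With \<open>\<tau>(0-) = 0\<close> the time \<open>0\<close>
  is not tested, which permits limits with a jump at time \<open>0\<close>.
\<close>

lemma tested_by_M1:
  assumes T: "0 < T" and Q: "countable Q" "\<And>i m. i \<in> {1..m} \<Longrightarrow> real i * T / real m \<in> Q"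
    and init: "init = (\<lambda>_. 0) \<or> init = (\<lambda>\<tau>. \<tau> 0) \<and> 0 \<in> Q"
  shows "tested_by (M1_topology_init T init) ((\<lambda>q \<tau>. \<tau> q) ` Q)"
  unfolding tested_by_def topspace_M1_topology_init
proof (intro conjI allI impI)
  show "countable ((\<lambda>q \<tau>. \<tau> q) ` Q :: ((real \<Rightarrow> real) \<Rightarrow> real) set)" using Q by simp
  show "(\<lambda>q \<tau>. \<tau> q) ` Q \<noteq> ({} :: ((real \<Rightarrow> real) \<Rightarrow> real) set)" using Q(2)[of 1 1] by auto
  fix U \<tau> assume "openin (M1_topology_init T init) U" and "\<tau> \<in> U"
  then obtain \<epsilon> where \<epsilon>: "0 < \<epsilon>" and \<tau>: "\<tau> \<in> D_up_paths T"
    and imp: "\<And>\<sigma>. \<sigma> \<in> D_up_paths T \<Longrightarrow> M1_dist T init \<tau> \<sigma> < \<epsilon> \<Longrightarrow> \<sigma> \<in> U"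
    unfolding openin_M1_topology_init by (meson subsetD)
  obtain m :: nat where m: "0 < m" "3 * T / \<epsilon> < real m" using reals_Archimedean2[of "max 0 (3 * T / \<epsilon>)"]
    by (metis max_less_iff_conj of_nat_0_less_iff)
  have lt: "3 * (T / real m) < \<epsilon>" using m \<epsilon> by (simp add: field_simps)
  define E :: "((real \<Rightarrow> real) \<Rightarrow> real) set"
    where "E = (\<lambda>q \<tau>. \<tau> q) ` ((\<lambda>i. real i * T / real m) ` {1..m} \<union> ({0} \<inter> Q))"
  have "finite E" "E \<subseteq> (\<lambda>q \<tau>. \<tau> q) ` Q" using Q(2) by (auto simp: E_def)
  moreover have "\<sigma> \<in> U" if \<sigma>: "\<sigma> \<in> D_up_paths T" and h: "\<forall>h\<in>E. \<bar>h \<sigma> - h \<tau>\<bar> < T / real m" for \<sigma>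
  proof (rule imp[OF \<sigma>])
    have "M1_dist T init \<tau> \<sigma> \<le> 3 * (T / real m)"
    proof (rule M1_dist_le_grid[OF T \<tau> \<sigma> m(1)])
      show "\<bar>\<sigma> (real i * T / real m) - \<tau> (real i * T / real m)\<bar> < T / real m" if "i \<in> {1..m}" for i
      proof -
        have "(\<lambda>\<tau>. \<tau> (real i * T / real m)) \<in> E" unfolding E_def using that by (intro imageI UnI1)
        then show ?thesis using h by auto
      qed
      show "init \<tau> \<le> \<tau> 0" "init \<sigma> \<le> \<sigma> 0" using init \<tau> \<sigma> T by (auto simp: D_up_paths_def)
      show "\<bar>init \<sigma> - init \<tau>\<bar> < T / real m" using init h T m by (auto simp: E_def)
    qed
    then show "M1_dist T init \<tau> \<sigma> < \<epsilon>" using lt by simp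
  qed
  moreover have "0 < T / real m" using T m by simp
  ultimately show "\<exists>E e. finite E \<and> E \<subseteq> (\<lambda>q \<tau>. \<tau> q) ` Q \<and> 0 < e \<and>
      (\<forall>y\<in>D_up_paths T. (\<forall>h\<in>E. \<bar>h y - h \<tau>\<bar> < e) \<longrightarrow> y \<in> U)"
    by blast
qed

lemma tested_by_prod:
  assumes "tested_by \<T>1 H1" "tested_by \<T>2 H2"
  shows "tested_by (prod_topology \<T>1 \<T>2) ((\<lambda>h. h \<circ> fst) ` H1 \<union> (\<lambda>h. h \<circ> snd) ` H2)"
  unfolding tested_by_def
proof (intro conjI allI impI)
  show "countable ((\<lambda>h. h \<circ> fst) ` H1 \<union> (\<lambda>h. h \<circ> snd) ` H2)"
    "(\<lambda>h. h \<circ> fst) ` H1 \<union> (\<lambda>h. h \<circ> snd) ` H2 \<noteq> {}"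
    using assms by (auto simp: tested_by_def)
  fix U x assume "openin (prod_topology \<T>1 \<T>2) U" "x \<in> U"
  then obtain U1 U2 where U: "openin \<T>1 U1" "openin \<T>2 U2" "fst x \<in> U1" "snd x \<in> U2" "U1 \<times> U2 \<subseteq> U"
    unfolding openin_prod_topology_alt by (metis prod.collapse)
  obtain E1 e1 where 1: "finite E1" "E1 \<subseteq> H1" "0 < e1"
    "\<And>y. y \<in> topspace \<T>1 \<Longrightarrow> (\<And>h. h \<in> E1 \<Longrightarrow> \<bar>h y - h (fst x)\<bar> < e1) \<Longrightarrow> y \<in> U1"
    using assms(1) U(1,3) unfolding tested_by_def by meson
  obtain E2 e2 where 2: "finite E2" "E2 \<subseteq> H2" "0 < e2"
    "\<And>y. y \<in> topspace \<T>2 \<Longrightarrow> (\<And>h. h \<in> E2 \<Longrightarrow> \<bar>h y - h (snd x)\<bar> < e2) \<Longrightarrow> y \<in> U2"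
    using assms(2) U(2,4) unfolding tested_by_def by meson
  let ?E = "(\<lambda>h. h \<circ> fst) ` E1 \<union> (\<lambda>h. h \<circ> snd) ` E2"
  have "y \<in> U" if y: "y \<in> topspace (prod_topology \<T>1 \<T>2)" and h: "\<forall>h\<in>?E. \<bar>h y - h x\<bar> < min e1 e2" for y
  proof -
    have "fst y \<in> U1" 
  proof (rule 1(4))
    fix g assume "g \<in> E1"
    then have "g \<circ> fst \<in> ?E" by blast
    from bspec[OF h this] show "\<bar>g (fst y) - g (fst x)\<bar> < e1" by simp
  qed (use y in auto)
    moreover have "snd y \<in> U2" 
  proof (rule 2(4))
    fix g assume "g \<in> E2"
    then have "g \<circ> snd \<in> ?E" by blast
    from bspec[OF h this] show "\<bar>g (snd y) - g (snd x)\<bar> < e2" by simp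
  qed (use y in auto)
    ultimately show ?thesis using U(5) by (cases y) auto
  qed
  moreover have "finite ?E" "?E \<subseteq> (\<lambda>h. h \<circ> fst) ` H1 \<union> (\<lambda>h. h \<circ> snd) ` H2" "0 < min e1 e2"
    using 1 2 by auto
  ultimately show "\<exists>E e. finite E \<and> E \<subseteq> (\<lambda>h. h \<circ> fst) ` H1 \<union> (\<lambda>h. h \<circ> snd) ` H2 \<and> 0 < e \<and>
      (\<forall>y\<in>topspace (prod_topology \<T>1 \<T>2). (\<forall>h\<in>E. \<bar>h y - h x\<bar> < e) \<longrightarrow> y \<in> U)"
    by (intro exI[of _ ?E] exI[of _ "min e1 e2"] conjI ballI impI)
qed

lemma indep_set_measurable_imp_indep_var:
  assumes "prob_space M" "subalgebra M F"
    and ind: "prob_space.indep_set M (sets F) (sets (vimage_algebra (space M) Z borel))"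
    and X: "X \<in> measurable F S" and Z: "Z \<in> borel_measurable M"
  shows "prob_space.indep_var M S X borel Z"
proof -
  interpret prob_space M by fact
  have F: "space F = space M" "sets F \<subseteq> sets M" using assms(2) by (auto simp: subalgebra_def)
  have "sigma_sets (space M) {X -` A \<inter> space M | A. A \<in> sets S} \<subseteq> sets F"
    unfolding F(1)[symmetric]
    by (rule sets.sigma_sets_subset) (use X measurable_sets in blast)
  moreover have "sigma_sets (space M) {Z -` A \<inter> space M | A. A \<in> sets borel} =
      sets (vimage_algebra (space M) Z borel)"
    by (simp add: sets_vimage_algebra)
  ultimately have "indep_set (sigma_sets (space M) {X -` A \<inter> space M | A. A \<in> sets S})
      (sigma_sets (space M) {Z -` A \<inter> space M | A. A \<in> sets borel})"
    using ind unfolding indep_sets2_eq by (metis (no_types, lifting) subset_iff subset_trans)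
  then show ?thesis
    unfolding indep_var_eq using measurable_from_subalg[OF assms(2) X] Z by simp
qed

section \<open>Laws of Brownian motions\<close>

text \<open>
  Independence is expressed through the law of the pair, so that \<open>X\<close> may take values in a space of
  paths while \<open>Z\<close> is real.
\<close>

lemma indep_set_measurable_imp_pair_law:
  fixes X :: "'a \<Rightarrow> 'b" and Z :: "'a \<Rightarrow> real"
  assumes "prob_space M" "subalgebra M F"
    and ind: "prob_space.indep_set M (sets F) (sets (vimage_algebra (space M) Z borel))"
    and X: "X \<in> measurable F S" and Z: "Z \<in> borel_measurable M"
  shows "distr M (S \<Otimes>\<^sub>M borel) (\<lambda>\<omega>. (X \<omega>, Z \<omega>)) = distr M S X \<Otimes>\<^sub>M distr M borel Z"
proof -
  interpret prob_space M by fact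
  have XM[measurable]: "X \<in> measurable M S" by (rule measurable_from_subalg[OF assms(2) X])
  have F: "space F = space M" using assms(2) by (simp add: subalgebra_def)
  note Z[measurable]
  interpret X: prob_space "distr M S X" by (rule prob_space_distr[OF XM])
  interpret Z: prob_space "distr M borel Z" by (rule prob_space_distr[OF Z])
  interpret XZ: pair_sigma_finite "distr M S X" "distr M borel Z" ..
  show ?thesis
  proof (rule pair_measure_eqI[symmetric])
    fix A D assume "A \<in> sets (distr M S X)" "D \<in> sets (distr M borel Z)"
    then have A[measurable]: "A \<in> sets S" and D[measurable]: "D \<in> sets borel" by auto
    have "prob ((X -` A \<inter> space M) \<inter> (Z -` D \<inter> space M)) = prob (X -` A \<inter> space M) * prob (Z -` D \<inter> space M)"
    proof (rule indep_setD[OF ind])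
      show "X -` A \<inter> space M \<in> sets F" using measurable_sets[OF X A] by (simp add: F)
      show "Z -` D \<inter> space M \<in> sets (vimage_algebra (space M) Z borel)"
        unfolding sets_vimage_algebra using D by (intro sigma_sets.Basic) auto
    qed
    moreover have "(\<lambda>\<omega>. (X \<omega>, Z \<omega>)) -` (A \<times> D) \<inter> space M = (X -` A \<inter> space M) \<inter> (Z -` D \<inter> space M)" by auto
    ultimately show "emeasure (distr M S X) A * emeasure (distr M borel Z) D
        = emeasure (distr M (S \<Otimes>\<^sub>M borel) (\<lambda>\<omega>. (X \<omega>, Z \<omega>))) (A \<times> D)"
      by (simp add: emeasure_distr emeasure_eq_measure ennreal_mult'')
  qed (use X.sigma_finite_measure_axioms Z.sigma_finite_measure_axioms in \<open>auto cong: sets_pair_measure_cong\<close>)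
qed

locale bm =
  fixes M :: "'a measure" and F :: "real \<Rightarrow> 'a measure" and B :: "real \<Rightarrow> 'a \<Rightarrow> real"
  assumes bm: "brownian_motion M F B"
begin

sublocale prob_space M using bm by (simp add: brownian_motion_def filtered_prob_space_def)

lemma subalg: "subalgebra M (F t)"
  using bm by (simp add: brownian_motion_def filtered_prob_space_def)

lemma F_mono: "s \<le> t \<Longrightarrow> subalgebra (F t) (F s)"
  using bm by (auto simp: brownian_motion_def filtered_prob_space_def filtration_def subalgebra_def)

lemma measurable_F_mono: "s \<le> t \<Longrightarrow> X \<in> measurable (F s) S \<Longrightarrow> X \<in> measurable (F t) S"
  by (rule measurable_from_subalg[OF F_mono])

lemma measurable_F: "X \<in> measurable (F s) S \<Longrightarrow> X \<in> measurable M S"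
  by (rule measurable_from_subalg[OF subalg])

lemma adapted: "0 \<le> t \<Longrightarrow> t \<le> u \<Longrightarrow> B t \<in> borel_measurable (F u)"
  by (rule measurable_F_mono[of t]) (use bm in \<open>auto simp: brownian_motion_def\<close>)

lemma B_measurable: "0 \<le> t \<Longrightarrow> B t \<in> borel_measurable M"
  using adapted[of t t] measurable_F by auto

lemma continuous_B: "\<omega> \<in> space M \<Longrightarrow> continuous_on {0..} (\<lambda>t. B t \<omega>)"
  using bm by (simp add: brownian_motion_def)

lemma B_0: "AE \<omega> in M. B 0 \<omega> = 0"
  using bm by (simp add: brownian_motion_def)

lemma increment_distributed: "0 \<le> s \<Longrightarrow> s < t \<Longrightarrow>
    distributed M lborel (\<lambda>\<omega>. B t \<omega> - B s \<omega>) (normal_density 0 (sqrt (t - s)))"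
  using bm by (simp add: brownian_motion_def)

lemma increment_pair_law:
  assumes "0 \<le> s" "s < t" "X \<in> measurable (F s) S"
  shows "distr M (S \<Otimes>\<^sub>M borel) (\<lambda>\<omega>. (X \<omega>, B t \<omega> - B s \<omega>))
    = distr M S X \<Otimes>\<^sub>M distr M borel (\<lambda>\<omega>. B t \<omega> - B s \<omega>)"
  by (rule indep_set_measurable_imp_pair_law[OF prob_space_axioms subalg])
    (use bm assms B_measurable in \<open>auto simp: brownian_motion_def\<close>)

lemma increment_indep:
  assumes "0 \<le> s" "s < t" "X \<in> measurable (F s) S"
  shows "indep_var S X borel (\<lambda>\<omega>. B t \<omega> - B s \<omega>)"
  by (rule indep_set_measurable_imp_indep_var[OF prob_space_axioms subalg])
    (use bm assms B_measurable in \<open>auto simp: brownian_motion_def intro!: borel_measurable_diff\<close>)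

lemma increment_integrable:
  assumes "0 \<le> s" "s \<le> t"
  shows "integrable M (\<lambda>\<omega>. B t \<omega> - B s \<omega>)" "integrable M (\<lambda>\<omega>. (B t \<omega> - B s \<omega>)\<^sup>2)"
    "expectation (\<lambda>\<omega>. B t \<omega> - B s \<omega>) = 0" "expectation (\<lambda>\<omega>. (B t \<omega> - B s \<omega>)\<^sup>2) = t - s"
proof -
  have "integrable M (\<lambda>\<omega>. B t \<omega> - B s \<omega>) \<and> integrable M (\<lambda>\<omega>. (B t \<omega> - B s \<omega>)\<^sup>2) \<and>
    expectation (\<lambda>\<omega>. B t \<omega> - B s \<omega>) = 0 \<and> expectation (\<lambda>\<omega>. (B t \<omega> - B s \<omega>)\<^sup>2) = t - s"
  proof (cases "s = t")
    case False
    then have lt: "s < t" using assms by simp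
    note D = increment_distributed[OF assms(1) lt]
    have pos: "0 < sqrt (t - s)" using lt by simp
    have e: "expectation (\<lambda>\<omega>. B t \<omega> - B s \<omega>) = 0" by (rule normal_distributed_expectation[OF pos D])
    moreover have "integrable M (\<lambda>\<omega>. B t \<omega> - B s \<omega>)"
      using distributed_integrable[OF D, of "\<lambda>x. x"] integrable_normal_moment_nz_1[OF pos, of 0] by simp
    moreover have "integrable M (\<lambda>\<omega>. (B t \<omega> - B s \<omega>)\<^sup>2)"
      using distributed_integrable[OF D, of "\<lambda>x. x\<^sup>2"] integrable_normal_moment[OF pos, of 0 2] by simp
    moreover have "expectation (\<lambda>\<omega>. (B t \<omega> - B s \<omega>)\<^sup>2) = t - s"
      using normal_distributed_variance[OF pos D] lt by (simp add: e)
    ultimately show ?thesis by simp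
  qed simp
  then show "integrable M (\<lambda>\<omega>. B t \<omega> - B s \<omega>)" "integrable M (\<lambda>\<omega>. (B t \<omega> - B s \<omega>)\<^sup>2)"
    "expectation (\<lambda>\<omega>. B t \<omega> - B s \<omega>) = 0" "expectation (\<lambda>\<omega>. (B t \<omega> - B s \<omega>)\<^sup>2) = t - s" by auto
qed

lemma increment_times:
  assumes "0 \<le> s" "s \<le> t" and a: "a \<in> borel_measurable (F s)" "integrable M a"
  shows "integrable M (\<lambda>\<omega>. a \<omega> * (B t \<omega> - B s \<omega>))"
    "expectation (\<lambda>\<omega>. a \<omega> * (B t \<omega> - B s \<omega>)) = 0"
    "integrable M (\<lambda>\<omega>. a \<omega> * (B t \<omega> - B s \<omega>)\<^sup>2)"
    "expectation (\<lambda>\<omega>. a \<omega> * (B t \<omega> - B s \<omega>)\<^sup>2) = expectation a * (t - s)"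
proof -
  have "integrable M (\<lambda>\<omega>. a \<omega> * (B t \<omega> - B s \<omega>)) \<and> expectation (\<lambda>\<omega>. a \<omega> * (B t \<omega> - B s \<omega>)) = 0
    \<and> integrable M (\<lambda>\<omega>. a \<omega> * (B t \<omega> - B s \<omega>)\<^sup>2)
    \<and> expectation (\<lambda>\<omega>. a \<omega> * (B t \<omega> - B s \<omega>)\<^sup>2) = expectation a * (t - s)"
  proof (cases "s = t")
    case False
    then have lt: "s < t" using assms by simp
    note i = increment_integrable[OF assms(1,2)]
    have 1: "indep_var borel a borel (\<lambda>\<omega>. B t \<omega> - B s \<omega>)"
      by (rule increment_indep[OF assms(1) lt a(1)])
    have 2: "indep_var borel a borel (\<lambda>\<omega>. (B t \<omega> - B s \<omega>)\<^sup>2)"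
      using indep_var_compose[OF 1, of "\<lambda>x. x" borel "\<lambda>x. x\<^sup>2" borel] by (simp add: comp_def)
    show ?thesis
      using indep_var_integrable[OF 1 a(2) i(1)] indep_var_lebesgue_integral[OF 1 a(2) i(1)]
        indep_var_integrable[OF 2 a(2) i(2)] indep_var_lebesgue_integral[OF 2 a(2) i(2)] i(3,4)
      by simp
  qed simp
  then show "integrable M (\<lambda>\<omega>. a \<omega> * (B t \<omega> - B s \<omega>))"
    "expectation (\<lambda>\<omega>. a \<omega> * (B t \<omega> - B s \<omega>)) = 0"
    "integrable M (\<lambda>\<omega>. a \<omega> * (B t \<omega> - B s \<omega>)\<^sup>2)"
    "expectation (\<lambda>\<omega>. a \<omega> * (B t \<omega> - B s \<omega>)\<^sup>2) = expectation a * (t - s)" by auto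
qed

end

text \<open>
  Times are added in increasing order. The value at a new last time is the previous value plus an
  increment that is Gaussian and independent of all earlier values, so the law at the earlier times
  determines the law at the larger set of times.
\<close>

lemma bm_fdd_unique:
  assumes "bm M F B" "bm M' F' B'" and J: "finite J" "J \<subseteq> {0..}"
  shows "distr M (PiM J (\<lambda>_. borel)) (\<lambda>\<omega>. \<lambda>t\<in>J. B t \<omega>) = distr M' (PiM J (\<lambda>_. borel)) (\<lambda>\<omega>. \<lambda>t\<in>J. B' t \<omega>)"
proof -
  interpret A: bm M F B by fact
  interpret A': bm M' F' B' by fact
  have step: "distr P (PiM (insert b K) (\<lambda>_. borel)) (\<lambda>\<omega>. \<lambda>t\<in>insert b K. C t \<omega>) =
      distr (distr P (PiM K (\<lambda>_. borel)) (\<lambda>\<omega>. \<lambda>t\<in>K. C t \<omega>) \<Otimes>\<^sub>M density lborel (normal_density 0 (sqrt (b - s))))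
        (PiM (insert b K) (\<lambda>_. borel)) (\<lambda>p. (fst p)(b := fst p s + snd p))"
    if "bm P G C" and K: "K \<subseteq> {0..s}" "s \<in> K" "s < b"
    for P :: "'c measure" and G C b s and K :: "real set"
  proof -
    interpret bm P G C by fact
    have s: "0 \<le> s" using K by auto
    let ?X = "\<lambda>\<omega>. \<lambda>t\<in>K. C t \<omega>" and ?Z = "\<lambda>\<omega>. C b \<omega> - C s \<omega>"
    have X: "?X \<in> measurable (G s) (PiM K (\<lambda>_. borel))"
      by (intro measurable_restrict adapted) (use K in auto)
    have Xm[measurable]: "?X \<in> measurable P (PiM K (\<lambda>_. borel))" by (rule measurable_F[OF X])
    have Zm[measurable]: "?Z \<in> borel_measurable P" using B_measurable s K(3) by auto
    have Z: "distr P borel ?Z = density lborel (normal_density 0 (sqrt (b - s)))"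
      using distributed_distr_eq_density[OF increment_distributed[OF s K(3)]]
      by (simp cong: distr_cong)
    have pairm: "(\<lambda>\<omega>. (?X \<omega>, ?Z \<omega>)) \<in> measurable P (PiM K (\<lambda>_. borel) \<Otimes>\<^sub>M borel)" by measurable
    have upd: "(\<lambda>p. (fst p)(b := fst p s + snd p)) \<in>
        measurable (PiM K (\<lambda>_. borel) \<Otimes>\<^sub>M borel) (PiM (insert b K) (\<lambda>_. borel :: real measure))"
    proof -
      have "(\<lambda>p. (fst p, fst p s + snd p)) \<in> measurable (PiM K (\<lambda>_. borel) \<Otimes>\<^sub>M borel)
          (PiM K (\<lambda>_. borel) \<Otimes>\<^sub>M (borel :: real measure))"
        using K(2) by measurable
      from measurable_compose[OF this measurable_add_dim[of b K "\<lambda>_. borel"]]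
      show ?thesis by simp
    qed
    have eq: "(\<lambda>t\<in>insert b K. C t \<omega>) = (?X \<omega>)(b := ?X \<omega> s + ?Z \<omega>)" for \<omega>
      using K by (auto simp: fun_eq_iff)
    have "distr P (PiM (insert b K) (\<lambda>_. borel)) (\<lambda>\<omega>. \<lambda>t\<in>insert b K. C t \<omega>)
      = distr (distr P (PiM K (\<lambda>_. borel) \<Otimes>\<^sub>M borel) (\<lambda>\<omega>. (?X \<omega>, ?Z \<omega>))) (PiM (insert b K) (\<lambda>_. borel))
          (\<lambda>p. (fst p)(b := fst p s + snd p))"
      unfolding eq by (subst distr_distr[OF upd pairm]) (simp add: comp_def)
    also have "distr P (PiM K (\<lambda>_. borel) \<Otimes>\<^sub>M borel) (\<lambda>\<omega>. (?X \<omega>, ?Z \<omega>))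
      = distr P (PiM K (\<lambda>_. borel)) ?X \<Otimes>\<^sub>M distr P borel ?Z"
      by (rule increment_pair_law[OF s K(3) X])
    finally show ?thesis unfolding Z .
  qed
  have base: "distr P (PiM {0} (\<lambda>_. borel)) (\<lambda>\<omega>. \<lambda>t\<in>{0}. C t \<omega>) = return (PiM {0} (\<lambda>_. borel)) (\<lambda>t\<in>{0}. 0)"
    if "bm P G C" for P :: "'c measure" and G and C :: "real \<Rightarrow> 'c \<Rightarrow> real"
  proof -
    interpret bm P G C by fact
    have "distr P (PiM {0} (\<lambda>_. borel)) (\<lambda>\<omega>. \<lambda>t\<in>{0}. C t \<omega>) = distr P (PiM {0} (\<lambda>_. borel)) (\<lambda>\<omega>. \<lambda>t\<in>{0}. 0::real)"
    proof (rule distr_cong_AE)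
      show "AE \<omega> in P. (\<lambda>t\<in>{0}. C t \<omega>) = (\<lambda>t\<in>{0}. 0)"
        using B_0 by eventually_elim (auto simp: fun_eq_iff)
    qed (auto intro!: measurable_restrict B_measurable)
    then show ?thesis by (simp add: space_PiM)
  qed
  have *: "distr M (PiM (insert 0 J) (\<lambda>_. borel)) (\<lambda>\<omega>. \<lambda>t\<in>insert 0 J. B t \<omega>)
      = distr M' (PiM (insert 0 J) (\<lambda>_. borel)) (\<lambda>\<omega>. \<lambda>t\<in>insert 0 J. B' t \<omega>)"
    using J
  proof (induction J rule: finite_linorder_max_induct)
    case empty
    show ?case unfolding base[OF assms(1)] base[OF assms(2)] ..
  next
    case (insert b K)
    show ?case
    proof (cases "b \<in> insert 0 K")
      case True
      then have "insert 0 (insert b K) = insert 0 K" by auto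
      then show ?thesis using insert by (metis insert_subset)
    next
      case False
      define s where "s = Max (insert 0 K)"
      have s: "s \<in> insert 0 K" unfolding s_def using insert by (intro Max_in) auto
      have le: "insert 0 K \<subseteq> {0..s}" using insert unfolding s_def by auto
      have lt: "s < b" using s insert False by auto
      have ins: "insert 0 (insert b K) = insert b (insert 0 K)" by auto
      have IH: "distr M (PiM (insert 0 K) (\<lambda>_. borel)) (\<lambda>\<omega>. \<lambda>t\<in>insert 0 K. B t \<omega>)
          = distr M' (PiM (insert 0 K) (\<lambda>_. borel)) (\<lambda>\<omega>. \<lambda>t\<in>insert 0 K. B' t \<omega>)"
        using insert by blast
      show ?thesis
        unfolding ins step[OF assms(1) le s lt] step[OF assms(2) le s lt] IH ..
    qed
  qed
  have proj: "distr P (PiM J (\<lambda>_. borel)) (\<lambda>\<omega>. \<lambda>t\<in>J. C t \<omega>)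
      = distr (distr P (PiM (insert 0 J) (\<lambda>_. borel)) (\<lambda>\<omega>. \<lambda>t\<in>insert 0 J. C t \<omega>)) (PiM J (\<lambda>_. borel)) (\<lambda>x. restrict x J)"
    if "bm P G C" for P :: "'c measure" and G and C :: "real \<Rightarrow> 'c \<Rightarrow> real"
  proof -
    interpret bm P G C by fact
    have "(\<lambda>\<omega>. \<lambda>t\<in>insert 0 J. C t \<omega>) \<in> measurable P (PiM (insert 0 J) (\<lambda>_. borel))"
      using J by (intro measurable_restrict B_measurable) auto
    then show ?thesis
      by (subst distr_distr) (auto intro!: measurable_restrict_subset distr_cong simp: comp_def fun_eq_iff)
  qed
  show ?thesis unfolding proj[OF assms(1)] proj[OF assms(2)] * ..
qed

text \<open>
  The continuous paths do not form a measurable subset of the product space over an uncountable set of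
  times; therefore the sigma-algebra is the trace of the product sigma-algebra.
\<close>

definition path_space :: "(real \<Rightarrow> real) measure" where
  "path_space = restrict_space (PiM {0..} (\<lambda>_. borel)) C_paths"

lemma C_paths_subset: "C_paths \<subseteq> space (PiM {0..} (\<lambda>_. borel))"
  by (auto simp: C_paths_def space_PiM extensional_def)

lemma space_path_space [simp]: "space path_space = C_paths"
  using C_paths_subset by (auto simp: path_space_def space_restrict_space)

lemma eval_measurable: "0 \<le> t \<Longrightarrow> (\<lambda>\<phi>. \<phi> t) \<in> borel_measurable path_space"
  unfolding path_space_def by (rule measurable_restrict_space1) simp

context bm
begin

definition path :: "'a \<Rightarrow> real \<Rightarrow> real" where
  "path \<omega> = (\<lambda>t\<in>{0..}. B t \<omega>)"

lemma path_in_C_paths: "\<omega> \<in> space M \<Longrightarrow> path \<omega> \<in> C_paths"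
  using continuous_B[of \<omega>] continuous_on_cong[of "{0..}" "{0..}" "path \<omega>" "\<lambda>t. B t \<omega>"]
  by (auto simp: path_def C_paths_def)

lemma path_eq: "0 \<le> t \<Longrightarrow> path \<omega> t = B t \<omega>"
  by (simp add: path_def)

lemma path_measurable_PiM: "path \<in> measurable M (PiM {0..} (\<lambda>_. borel))"
  unfolding path_def by (intro measurable_restrict B_measurable) simp

lemma path_measurable: "path \<in> measurable M path_space"
  unfolding path_space_def
  by (rule measurable_restrict_space2) (use path_in_C_paths path_measurable_PiM in auto)

end

lemma bm_law_unique_PiM:
  assumes "bm M F B" "bm M' F' B'"
  shows "distr M (PiM {0..} (\<lambda>_. borel)) (bm.path B) = distr M' (PiM {0..} (\<lambda>_. borel)) (bm.path B')"
proof -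
  interpret A: bm M F B by fact
  interpret A': bm M' F' B' by fact
  have emb: "distr P (PiM {0..} (\<lambda>_. borel)) (bm.path C) (prod_emb {0..} (\<lambda>_. borel) J (Pi\<^sub>E J E))
      = distr P (PiM J (\<lambda>_. borel)) (\<lambda>\<omega>. \<lambda>t\<in>J. C t \<omega>) (Pi\<^sub>E J E)"
    if "bm P G C" and J: "finite J" "J \<subseteq> {0..}" "\<And>i. i \<in> J \<Longrightarrow> E i \<in> sets borel"
    for P :: "'c measure" and G J E and C :: "real \<Rightarrow> 'c \<Rightarrow> real"
  proof -
    interpret bm P G C by fact
    have 1: "(\<lambda>\<omega>. \<lambda>t\<in>J. C t \<omega>) \<in> measurable P (PiM J (\<lambda>_. borel))"
      using J by (intro measurable_restrict B_measurable) auto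
    have E: "Pi\<^sub>E J E \<in> sets (PiM J (\<lambda>_. borel))" using J by (intro sets_PiM_I_finite) auto
    have "path -` prod_emb {0..} (\<lambda>_. borel) J (Pi\<^sub>E J E) \<inter> space P
        = (\<lambda>\<omega>. \<lambda>t\<in>J. C t \<omega>) -` Pi\<^sub>E J E \<inter> space P"
      using J(2) measurable_space[OF path_measurable_PiM] 
      by (auto simp: prod_emb_def PiE_iff path_def subset_iff space_PiM)
    then show ?thesis
      using E 1 path_measurable_PiM J by (simp add: emeasure_distr sets_PiM_I)
  qed
  show ?thesis
  proof (rule measure_eqI_PiM_infinite)
    show "finite_measure (distr M (PiM {0..} (\<lambda>_. borel)) A.path)"
      using A.prob_space_distr[OF A.path_measurable_PiM] by (rule prob_space.finite_measure)
    fix E J assume "finite J" "J \<subseteq> {0::real..}" "\<And>i. i \<in> J \<Longrightarrow> E i \<in> sets (borel :: real measure)"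
    then show "distr M (PiM {0..} (\<lambda>_. borel)) A.path (prod_emb {0..} (\<lambda>_. borel) J (Pi\<^sub>E J E))
        = distr M' (PiM {0..} (\<lambda>_. borel)) A'.path (prod_emb {0..} (\<lambda>_. borel) J (Pi\<^sub>E J E))"
      using emb[OF assms(1)] emb[OF assms(2)] bm_fdd_unique[OF assms] by simp
  qed simp_all
qed

lemma bm_law_unique:
  assumes "bm M F B" "bm M' F' B'"
  shows "distr M path_space (bm.path B) = distr M' path_space (bm.path B')"
proof (rule measure_eqI)
  interpret A: bm M F B by fact
  interpret A': bm M' F' B' by fact
  fix E assume "E \<in> sets (distr M path_space A.path)"
  then have Es: "E \<in> sets path_space" by simp
  then obtain D where D: "D \<in> sets (PiM {0..} (\<lambda>_. borel))" "E = C_paths \<inter> D"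
    unfolding path_space_def sets_restrict_space by auto
  have 1: "A.path -` E \<inter> space M = A.path -` D \<inter> space M"
    and 2: "A'.path -` E \<inter> space M' = A'.path -` D \<inter> space M'"
    using A.path_in_C_paths A'.path_in_C_paths by (auto simp: D(2))
  show "emeasure (distr M path_space A.path) E = emeasure (distr M' path_space A'.path) E"
    using bm_law_unique_PiM[OF assms, THEN arg_cong, of "\<lambda>m. emeasure m D"] Es D(1)
    by (simp add: emeasure_distr 1 2 A.path_measurable_PiM A'.path_measurable_PiM A.path_measurable A'.path_measurable)
qed simp

lemma bm_scale:
  assumes "bm M F B" and c: "0 < c"
  shows "bm M (\<lambda>t. F (t / c\<^sup>2)) (\<lambda>t \<omega>. c * B (t / c\<^sup>2) \<omega>)"
proof -
  interpret bm M F B by fact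
  have c2: "0 < c\<^sup>2" using c by simp
  show ?thesis
    unfolding bm_def brownian_motion_def
  proof (intro conjI allI impI ballI; (elim conjE)?)
    have "sets (F (i / c\<^sup>2)) \<subseteq> sets (F (j / c\<^sup>2))" if "i \<le> j" for i j
      using F_mono[of "i / c\<^sup>2" "j / c\<^sup>2"] that c2 by (simp add: subalgebra_def divide_right_mono)
    then show "filtered_prob_space M (\<lambda>t. F (t / c\<^sup>2))"
      using prob_space_axioms subalg by (auto simp: filtered_prob_space_def filtration_def subalgebra_def)
    show "(\<lambda>\<omega>. c * B (t / c\<^sup>2) \<omega>) \<in> borel_measurable (F (t / c\<^sup>2))" if "0 \<le> t" for t
      using adapted[of "t / c\<^sup>2" "t / c\<^sup>2"] that c2 by (intro borel_measurable_times) auto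
    show "continuous_on {0..} (\<lambda>t. c * B (t / c\<^sup>2) \<omega>)" if "\<omega> \<in> space M" for \<omega>
      by (intro continuous_intros continuous_on_compose2[OF continuous_B[OF that]]) (use c2 in auto)
    show "AE \<omega> in M. c * B (0 / c\<^sup>2) \<omega> = 0" using B_0 by eventually_elim simp
    fix s t :: real assume st: "0 \<le> s" "s < t"
    let ?Z = "\<lambda>\<omega>. B (t / c\<^sup>2) \<omega> - B (s / c\<^sup>2) \<omega>"
    have st': "0 \<le> s / c\<^sup>2" "s / c\<^sup>2 < t / c\<^sup>2" using st c2 by (auto simp: divide_strict_right_mono)
    have Z: "c * B (t / c\<^sup>2) \<omega> - c * B (s / c\<^sup>2) \<omega> = 0 + c * ?Z \<omega>" for \<omega> by (simp add: algebra_simps)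
    have "sqrt (t / c\<^sup>2 - s / c\<^sup>2) = sqrt (t - s) / c"
      using c by (simp add: diff_divide_distrib[symmetric] real_sqrt_divide)
    then have sd: "\<bar>c\<bar> * sqrt (t / c\<^sup>2 - s / c\<^sup>2) = sqrt (t - s)" using c by simp
    show "distributed M lborel (\<lambda>\<omega>. c * B (t / c\<^sup>2) \<omega> - c * B (s / c\<^sup>2) \<omega>) (normal_density 0 (sqrt (t - s)))"
      using normal_density_affine[OF increment_distributed[OF st'], of c 0] c st' sd
      unfolding Z by simp
    have ind: "indep_set (sets (F (s / c\<^sup>2))) (sets (vimage_algebra (space M) ?Z borel))"
      using bm st' by (simp add: brownian_motion_def)
    have "sets (vimage_algebra (space M) (\<lambda>\<omega>. c * B (t / c\<^sup>2) \<omega> - c * B (s / c\<^sup>2) \<omega>) borel)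
        \<subseteq> sets (vimage_algebra (space M) ?Z borel)"
    proof -
      have "(\<lambda>\<omega>. c * ?Z \<omega>) \<in> borel_measurable (vimage_algebra (space M) ?Z borel)"
        by (intro borel_measurable_times borel_measurable_const measurable_vimage_algebra1) auto
      then have "(\<lambda>\<omega>. c * B (t / c\<^sup>2) \<omega> - c * B (s / c\<^sup>2) \<omega>) \<in> borel_measurable (vimage_algebra (space M) ?Z borel)"
        unfolding Z by simp
      from measurable_sets[OF this] show ?thesis
        unfolding sets_vimage_algebra[of "space M" "\<lambda>\<omega>. c * B (t / c\<^sup>2) \<omega> - c * B (s / c\<^sup>2) \<omega>"]
        by (intro sets.sigma_sets_subset[of _ "vimage_algebra (space M) ?Z borel", simplified]) auto
    qed
    then show "indep_set (sets (F (s / c\<^sup>2)))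
        (sets (vimage_algebra (space M) (\<lambda>\<omega>. c * B (t / c\<^sup>2) \<omega> - c * B (s / c\<^sup>2) \<omega>) borel))"
      using ind unfolding indep_sets2_eq by (meson subset_iff subset_trans)
  qed
qed

section \<open>Passage times of continuous paths on grids\<close>

text \<open>
  The cap \<open>R\<close> belongs to the set, which makes the passage time finite for every path.
\<close>

definition capped_passage :: "(real \<Rightarrow> real) \<Rightarrow> real \<Rightarrow> real \<Rightarrow> real" where
  "capped_passage y g R = Inf (insert R {s. 0 \<le> s \<and> s \<le> R \<and> g < y s})"

context
  fixes y :: "real \<Rightarrow> real" and g :: real
  assumes y: "continuous_on {0..} y"
begin

lemma capped_passage_bounds:
  assumes "0 \<le> R"
  shows "0 \<le> capped_passage y g R" "capped_passage y g R \<le> R"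
  unfolding capped_passage_def using assms
  by (auto intro!: cInf_greatest cInf_lower bdd_belowI[of _ 0])

lemma capped_passage_le: "0 \<le> s \<Longrightarrow> s \<le> R \<Longrightarrow> g < y s \<Longrightarrow> capped_passage y g R \<le> s"
  unfolding capped_passage_def by (intro cInf_lower) (auto intro!: bdd_belowI[of _ 0])

lemma before_capped_passage:
  assumes "0 \<le> s" "s < capped_passage y g R" "0 \<le> R"
  shows "y s \<le> g"
  using capped_passage_le[of s R] capped_passage_bounds(2)[of R] assms by fastforce

lemma level_exceeded_nearby:
  assumes "0 \<le> s" "g < y s"
  obtains d where "0 < d" "\<And>t. 0 \<le> t \<Longrightarrow> \<bar>t - s\<bar> < d \<Longrightarrow> g < y t"
proof -
  obtain d where d: "0 < d" "\<And>t. 0 \<le> t \<Longrightarrow> dist t s < d \<Longrightarrow> dist (y t) (y s) < y s - g"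
    using y assms unfolding continuous_on_iff by (metis atLeast_iff diff_gt_0_iff_gt)
  show ?thesis
  proof (rule that[OF d(1)])
    fix t assume "0 \<le> t" "\<bar>t - s\<bar> < d"
    then have "dist (y t) (y s) < y s - g" by (intro d(2)) (auto simp: dist_real_def)
    then show "g < y t" by (auto simp: dist_real_def)
  qed
qed

lemma at_capped_passage_le:
  assumes "0 \<le> R" "y 0 \<le> g"
  shows "y (capped_passage y g R) \<le> g"
proof (rule ccontr)
  define t where "t = capped_passage y g R"
  assume "\<not> y (capped_passage y g R) \<le> g"
  then have gt: "g < y t" by (simp add: t_def)
  then have t: "0 < t" using capped_passage_bounds(1)[OF assms(1)] assms(2) by (cases "t = 0") (auto simp: t_def)
  obtain d where d: "0 < d" "\<And>s. 0 \<le> s \<Longrightarrow> \<bar>s - t\<bar> < d \<Longrightarrow> g < y s"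
    using level_exceeded_nearby[of t] gt t by (metis less_imp_le)
  have "g < y (max 0 (t - d / 2))" using d(1) t by (intro d(2)) auto
  moreover have "y (max 0 (t - d / 2)) \<le> g"
    using d(1) t assms by (intro before_capped_passage[of _ R]) (auto simp: t_def)
  ultimately show False by simp
qed

lemma near_capped_passage:
  assumes "0 \<le> R" "capped_passage y g R < r" "r \<le> R"
  obtains s where "0 \<le> s" "capped_passage y g R \<le> s" "s < r" "g < y s"
proof -
  obtain s where s: "s \<in> insert R {s. 0 \<le> s \<and> s \<le> R \<and> g < y s}" "s < r"
    using cInf_lessD[OF _ assms(2)[unfolded capped_passage_def]] by auto
  then have "0 \<le> s" "g < y s" "s \<le> R" using assms by auto
  then show ?thesis using s capped_passage_le[of s R] that by auto
qed

lemma at_capped_passage_ge: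
  assumes "0 \<le> R" "capped_passage y g R < R"
  shows "g \<le> y (capped_passage y g R)"
proof (rule ccontr)
  define t where "t = capped_passage y g R"
  assume "\<not> g \<le> y (capped_passage y g R)"
  then have lt: "y t < g" by (simp add: t_def)
  have t: "0 \<le> t" using capped_passage_bounds(1)[OF assms(1)] by (simp add: t_def)
  obtain d where d: "0 < d" "\<And>s. 0 \<le> s \<Longrightarrow> dist s t < d \<Longrightarrow> dist (y s) (y t) < g - y t"
    using y t lt unfolding continuous_on_iff by (metis atLeast_iff diff_gt_0_iff_gt)
  have "t < min R (t + d)" "min R (t + d) \<le> R" using assms d(1) by (auto simp: t_def)
  then obtain s where s: "0 \<le> s" "t \<le> s" "s < min R (t + d)" "g < y s"
    using near_capped_passage[of R "min R (t + d)"] assms(1) unfolding t_def by blast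
  have "dist (y s) (y t) < g - y t" using s by (intro d(2)) (auto simp: dist_real_def)
  then show False using s(4) by (auto simp: dist_real_def)
qed

lemma capped_passage_eq_iff:
  assumes "0 < R" "y 0 \<le> g"
  shows "capped_passage y g R = R \<longleftrightarrow> (\<forall>s\<in>{0..R}. y s \<le> g)"
proof
  assume eq: "capped_passage y g R = R"
  show "\<forall>s\<in>{0..R}. y s \<le> g"
  proof
    fix s assume "s \<in> {0..R}"
    then show "y s \<le> g"
      using before_capped_passage[of s R] at_capped_passage_le[of R] eq assms by (cases "s = R") auto
  qed
next
  assume "\<forall>s\<in>{0..R}. y s \<le> g"
  then have "{s. 0 \<le> s \<and> s \<le> R \<and> g < y s} = {}" by force
  then show "capped_passage y g R = R" unfolding capped_passage_def by (simp only: cInf_singleton)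
qed

lemma capped_passage_eq_min:
  assumes "\<exists>s\<ge>0. g < y s" "0 \<le> R"
  shows "capped_passage y g R = min R (Inf {s. 0 \<le> s \<and> g < y s})"
proof -
  let ?A = "{s. 0 \<le> s \<and> g < y s}"
  have A: "?A \<noteq> {}" "bdd_below ?A" using assms by (auto intro!: bdd_belowI[of _ 0])
  show ?thesis
  proof (rule antisym)
    show "capped_passage y g R \<le> min R (Inf ?A)"
    proof (rule min.boundedI)
      show "capped_passage y g R \<le> Inf ?A"
      proof (rule cInf_greatest[OF A(1)])
        fix s assume "s \<in> ?A"
        then show "capped_passage y g R \<le> s"
          using capped_passage_le[of s R] capped_passage_bounds(2)[OF assms(2)] by (cases "s \<le> R") auto
      qed
    qed (use capped_passage_bounds assms in auto)
    show "min R (Inf ?A) \<le> capped_passage y g R"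
      unfolding capped_passage_def
    proof (rule cInf_greatest)
      fix s assume "s \<in> insert R {s. 0 \<le> s \<and> s \<le> R \<and> g < y s}"
      then show "min R (Inf ?A) \<le> s"
        using cInf_lower[OF _ A(2), of s] by (auto simp: min_le_iff_disj)
    qed simp
  qed
qed

definition grid_index :: "real \<Rightarrow> nat \<Rightarrow> nat" where
  "grid_index R m = (LEAST i. i = m \<or> g < y (real i * R / real m))"

lemma grid_index_le: "grid_index R m \<le> m"
  unfolding grid_index_def by (rule Least_le) simp

lemma less_grid_index_iff:
  "i < m \<Longrightarrow> i < grid_index R m \<longleftrightarrow> (\<forall>j\<le>i. y (real j * R / real m) \<le> g)"
proof
  assume "i < grid_index R m"
  then show "\<forall>j\<le>i. y (real j * R / real m) \<le> g"
    unfolding grid_index_def by (metis (mono_tags, lifting) le_less_trans not_less_Least not_le)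
next
  assume i: "i < m" and le: "\<forall>j\<le>i. y (real j * R / real m) \<le> g"
  have "grid_index R m = m \<or> g < y (real (grid_index R m) * R / real m)"
    unfolding grid_index_def by (rule LeastI[of _ m]) simp
  then show "i < grid_index R m" using i le by (metis not_le)
qed

lemma y_grid_index: "grid_index R m < m \<Longrightarrow> g < y (real (grid_index R m) * R / real m)"
proof -
  have "grid_index R m = m \<or> g < y (real (grid_index R m) * R / real m)"
    unfolding grid_index_def by (rule LeastI[of _ m]) simp
  then show "grid_index R m < m \<Longrightarrow> g < y (real (grid_index R m) * R / real m)" by auto
qed

lemma capped_passage_le_grid:
  assumes "0 < R" "0 < m"
  shows "capped_passage y g R \<le> real (grid_index R m) * R / real m"
proof (cases "grid_index R m = m")
  case True
  then show ?thesis using capped_passage_bounds(2)[of R] assms by simp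
next
  case False
  then have lt: "grid_index R m < m" using grid_index_le[of R m] by simp
  then have "real (grid_index R m) * R \<le> real m * R" using assms by (intro mult_right_mono) auto
  then show ?thesis
    using assms by (intro capped_passage_le y_grid_index[OF lt]) (auto simp: field_simps)
qed

text \<open>
  A continuous path that exceeds the level just after its passage time does so on an interval, and a fine
  grid meets this interval.
\<close>

lemma grid_passage_tendsto:
  assumes R: "0 < R"
  shows "(\<lambda>m. real (grid_index R m) * R / real m) \<longlonglongrightarrow> capped_passage y g R"
proof (rule LIMSEQ_I)
  fix r :: real assume r: "0 < r"
  define \<theta> where "\<theta> = capped_passage y g R"
  have up: "\<forall>\<^sub>F m in sequentially. real (grid_index R m) * R / real m < \<theta> + r"
  proof (cases "\<theta> < R")
    case False
    have "real (grid_index R m) * R / real m < \<theta> + r" if "0 < m" for m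
    proof -
      have "real (grid_index R m) * R \<le> real m * R" using R grid_index_le by (intro mult_right_mono) auto
      then have "real (grid_index R m) * R / real m \<le> R" using that by (simp add: field_simps)
      then show ?thesis using False r by simp
    qed
    then show ?thesis by (intro eventually_mono[OF eventually_gt_at_top[of 0]])
  next
    case True
    have "0 \<le> R" "\<theta> < min R (\<theta> + r)" "min R (\<theta> + r) \<le> R" using True r R by auto
    then obtain s where s: "0 \<le> s" "\<theta> \<le> s" "s < min R (\<theta> + r)" "g < y s"
      using near_capped_passage[of R "min R (\<theta> + r)"] unfolding \<theta>_def by blast
    obtain d where d: "0 < d" "\<And>t. 0 \<le> t \<Longrightarrow> \<bar>t - s\<bar> < d \<Longrightarrow> g < y t"
      using level_exceeded_nearby[OF s(1,4)] by metis
    have "\<forall>\<^sub>F m in sequentially. R / d < real m"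
      by (rule eventually_compose_filterlim[OF eventually_gt_at_top filterlim_real_sequentially])
    then show ?thesis using eventually_gt_at_top[of 0]
    proof eventually_elim
      case (elim m)
      define i where "i = nat \<lfloor>s * real m / R\<rfloor>"
      have nn: "0 \<le> s * real m / R" using s R by simp
      have "real i = of_int \<lfloor>s * real m / R\<rfloor>" using nn by (simp add: i_def)
      then have i: "real i \<le> s * real m / R" "s * real m / R < real i + 1" by linarith+
      have le: "real i * R / real m \<le> s" using i(1) R elim by (simp add: field_simps)
      have "s < real i * R / real m + R / real m" using i(2) R elim by (simp add: field_simps)
      moreover have "R / real m < d" using elim d(1) by (simp add: field_simps)
      ultimately have "g < y (real i * R / real m)" using le R by (intro d(2)) auto
      moreover have "i < m"
      proof -
        have "real i * R \<le> s * real m" using le elim by (simp add: field_simps)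
        also have "\<dots> < R * real m" using s elim by (intro mult_strict_right_mono) auto
        finally show ?thesis using R by simp
      qed
      ultimately have "grid_index R m \<le> i" unfolding grid_index_def by (intro Least_le) simp
      then have "real (grid_index R m) * R \<le> real i * R" using R by (intro mult_right_mono) auto
      then have "real (grid_index R m) * R / real m \<le> real i * R / real m" using elim by (intro divide_right_mono) auto
      then show ?case using le s by simp
    qed
  qed
  then have "\<forall>\<^sub>F m in sequentially. norm (real (grid_index R m) * R / real m - \<theta>) < r"
    using eventually_gt_at_top[of 0]
  proof eventually_elim
    case (elim m)
    then show ?case using capped_passage_le_grid[OF R, of m] r by (auto simp: \<theta>_def)
  qed
  then show "\<exists>no. \<forall>m\<ge>no. norm (real (grid_index R m) * R / real m - capped_passage y g R) < r"
    by (simp add: eventually_sequentially \<theta>_def)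
qed

end

section \<open>Stopped sums of Brownian increments\<close>

text \<open>
  Truncation at height \<open>A\<close> changes every mean by at most \<open>C / A\<close>, and bounded convergence applies to the
  truncated variables.
\<close>

lemma expectation_tendsto_of_L2_bounded:
  fixes X :: "nat \<Rightarrow> 'a \<Rightarrow> real"
  assumes "prob_space M" and X[measurable]: "\<And>n. X n \<in> borel_measurable M" "Z \<in> borel_measurable M"
    and lim: "AE \<omega> in M. (\<lambda>n. X n \<omega>) \<longlonglongrightarrow> Z \<omega>"
    and i2: "\<And>n. integrable M (\<lambda>\<omega>. (X n \<omega>)\<^sup>2)" "\<And>n. (\<integral>\<omega>. (X n \<omega>)\<^sup>2 \<partial>M) \<le> C"
  shows "integrable M Z" "(\<lambda>n. \<integral>\<omega>. X n \<omega> \<partial>M) \<longlonglongrightarrow> (\<integral>\<omega>. Z \<omega> \<partial>M)"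
proof -
  interpret prob_space M by fact
  have C: "0 \<le> C" using i2(2)[of 0] by (rule order_trans[rotated]) simp
  have "(\<integral>\<^sup>+\<omega>. ennreal ((Z \<omega>)\<^sup>2) \<partial>M) = (\<integral>\<^sup>+\<omega>. liminf (\<lambda>n. ennreal ((X n \<omega>)\<^sup>2)) \<partial>M)"
  proof (rule nn_integral_cong_AE, use lim in eventually_elim)
    fix \<omega> assume "(\<lambda>n. X n \<omega>) \<longlonglongrightarrow> Z \<omega>"
    then have "(\<lambda>n. ennreal ((X n \<omega>)\<^sup>2)) \<longlonglongrightarrow> ennreal ((Z \<omega>)\<^sup>2)" by (intro tendsto_intros) auto
    then show "ennreal ((Z \<omega>)\<^sup>2) = liminf (\<lambda>n. ennreal ((X n \<omega>)\<^sup>2))"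
      by (intro lim_imp_Liminf[symmetric]) auto
  qed
  also have "\<dots> \<le> liminf (\<lambda>n. \<integral>\<^sup>+\<omega>. ennreal ((X n \<omega>)\<^sup>2) \<partial>M)"
    by (rule nn_integral_liminf) measurable
  also have "\<dots> \<le> liminf (\<lambda>n::nat. ennreal C)"
    by (intro Liminf_mono always_eventually allI)
      (use i2 in \<open>auto simp: nn_integral_eq_integral intro!: ennreal_leI\<close>)
  finally have F: "(\<integral>\<^sup>+\<omega>. ennreal ((Z \<omega>)\<^sup>2) \<partial>M) \<le> ennreal C" by (simp add: Liminf_const)
  then have iZ2: "integrable M (\<lambda>\<omega>. (Z \<omega>)\<^sup>2)"
    by (intro integrableI_nonneg) (auto intro: le_less_trans)
  have EZ2: "(\<integral>\<omega>. (Z \<omega>)\<^sup>2 \<partial>M) \<le> C"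
    using F C iZ2 by (simp add: nn_integral_eq_integral)
  show iZ: "integrable M Z" by (rule square_integrable_imp_integrable[OF _ iZ2]) simp
  have iX: "integrable M (X n)" for n by (rule square_integrable_imp_integrable[OF _ i2(1)]) simp
  \<comment> \<open>\<open>cl A\<close> truncates at \<open>- A\<close> and \<open>A\<close>.\<close>
  define cl where "cl A x = max (- A) (min A x)" for A x :: real
  have cl_meas[measurable]: "cl A \<in> borel_measurable borel" for A unfolding cl_def by measurable
  have clb: "\<bar>cl A x\<bar> \<le> A" if "0 < A" for A x using that by (auto simp: cl_def)
  have cld: "\<bar>x - cl A x\<bar> \<le> x\<^sup>2 / A" if "0 < A" for A x :: real
  proof (cases "\<bar>x\<bar> \<le> A")
    case True
    then have "cl A x = x" by (auto simp: cl_def)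
    then show ?thesis using that by simp
  next
    case False
    then have "\<bar>x - cl A x\<bar> \<le> \<bar>x\<bar>" using that by (auto simp: cl_def)
    also have "\<dots> \<le> \<bar>x\<bar> * \<bar>x\<bar> / A"
      using False that mult_left_mono[of A "\<bar>x\<bar>" "\<bar>x\<bar>"] by (simp add: field_simps)
    finally show ?thesis by (simp add: power2_eq_square)
  qed
  have tail: "\<bar>(\<integral>\<omega>. V \<omega> \<partial>M) - (\<integral>\<omega>. cl A (V \<omega>) \<partial>M)\<bar> \<le> C / A"
    if "0 < A" and V[measurable]: "V \<in> borel_measurable M" and iV: "integrable M V"
      and V2: "integrable M (\<lambda>\<omega>. (V \<omega>)\<^sup>2)" "(\<integral>\<omega>. (V \<omega>)\<^sup>2 \<partial>M) \<le> C" for V and A :: real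
  proof -
    have icl: "integrable M (\<lambda>\<omega>. cl A (V \<omega>))"
      by (rule integrable_const_bound[of _ A]) (use clb that in auto)
    have "\<bar>(\<integral>\<omega>. V \<omega> \<partial>M) - (\<integral>\<omega>. cl A (V \<omega>) \<partial>M)\<bar> = \<bar>\<integral>\<omega>. V \<omega> - cl A (V \<omega>) \<partial>M\<bar>"
      using iV icl by simp
    also have "\<dots> \<le> (\<integral>\<omega>. \<bar>V \<omega> - cl A (V \<omega>)\<bar> \<partial>M)" by (rule integral_abs_bound)
    also have "\<dots> \<le> (\<integral>\<omega>. (V \<omega>)\<^sup>2 / A \<partial>M)"
      by (rule integral_mono) (use iV icl V2 cld that in auto)
    also have "\<dots> \<le> C / A" using V2 that by (simp add: divide_right_mono)
    finally show ?thesis .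
  qed
  show "(\<lambda>n. \<integral>\<omega>. X n \<omega> \<partial>M) \<longlonglongrightarrow> (\<integral>\<omega>. Z \<omega> \<partial>M)"
  proof (rule LIMSEQ_I)
    fix r :: real assume r: "0 < r"
    define A where "A = 3 * (C + 1) / r"
    have A: "0 < A" using r C by (simp add: A_def)
    have CA: "C / A < r / 3" using r C by (simp add: A_def field_simps)
    have "(\<lambda>n. \<integral>\<omega>. cl A (X n \<omega>) \<partial>M) \<longlonglongrightarrow> (\<integral>\<omega>. cl A (Z \<omega>) \<partial>M)"
    proof (rule integral_dominated_convergence[where w = "\<lambda>_. A"])
      show "AE \<omega> in M. (\<lambda>n. cl A (X n \<omega>)) \<longlonglongrightarrow> cl A (Z \<omega>)"
        using lim by eventually_elim (auto simp: cl_def intro!: tendsto_intros)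
    qed (use clb A in auto)
    then obtain n0 where n0: "\<And>n. n0 \<le> n \<Longrightarrow> norm ((\<integral>\<omega>. cl A (X n \<omega>) \<partial>M) - (\<integral>\<omega>. cl A (Z \<omega>) \<partial>M)) < r / 3"
      using r LIMSEQ_D[of _ _ "r / 3"] by (metis zero_less_divide_iff zero_less_numeral)
    have "norm ((\<integral>\<omega>. X n \<omega> \<partial>M) - (\<integral>\<omega>. Z \<omega> \<partial>M)) < r" if "n0 \<le> n" for n
      using n0[OF that] tail[OF A X(1) iX i2, of n] tail[OF A X(2) iZ iZ2 EZ2] CA
      unfolding real_norm_def by linarith
    then show "\<exists>n0. \<forall>n\<ge>n0. norm ((\<integral>\<omega>. X n \<omega> \<partial>M) - (\<integral>\<omega>. Z \<omega> \<partial>M)) < r" by blast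
  qed
qed

context bm
begin

text \<open>
  The cross terms in the square vanish because the next increment is centred and independent of the past.
  With indicator coefficients these sums are Brownian motion stopped on a grid, and with weighted
  indicators they are the quantities whose second moment controls the tail below.
\<close>

lemma martingale_transform:
  fixes u :: "nat \<Rightarrow> real" and a :: "nat \<Rightarrow> 'a \<Rightarrow> real"
  assumes u: "0 \<le> u 0" "\<And>i. u i \<le> u (Suc i)"
    and a: "\<And>i. a i \<in> borel_measurable (F (u i))" "\<And>i \<omega>. \<omega> \<in> space M \<Longrightarrow> \<bar>a i \<omega>\<bar> \<le> c"
  defines "S \<equiv> \<lambda>k \<omega>. \<Sum>i<k. a i \<omega> * (B (u (Suc i)) \<omega> - B (u i) \<omega>)"
  shows "S k \<in> borel_measurable (F (u k))" "integrable M (S k)" "integrable M (\<lambda>\<omega>. (S k \<omega>)\<^sup>2)"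
    "expectation (S k) = 0"
    "expectation (\<lambda>\<omega>. (S k \<omega>)\<^sup>2) = expectation (\<lambda>\<omega>. \<Sum>i<k. (a i \<omega>)\<^sup>2 * (u (Suc i) - u i))"
proof -
  have u0: "0 \<le> u i" for i
    using u by (induction i) (auto intro: order_trans)
  have am: "a i \<in> borel_measurable M" for i using measurable_F[OF a(1)] .
  have ia: "integrable M (a i)" for i
    by (rule integrable_const_bound[of _ c]) (use a(2) am in auto)
  have ia2: "integrable M (\<lambda>\<omega>. (a i \<omega>)\<^sup>2)" for i
  proof (rule integrable_const_bound[of _ "c\<^sup>2"])
    show "AE \<omega> in M. norm ((a i \<omega>)\<^sup>2) \<le> c\<^sup>2"
    proof (rule AE_I2)
      fix \<omega> assume "\<omega> \<in> space M"
      then show "norm ((a i \<omega>)\<^sup>2) \<le> c\<^sup>2" using a(2)[of \<omega> i] power_mono[of "\<bar>a i \<omega>\<bar>" c 2] by simp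
    qed
  qed (use am in auto)
  have "S k \<in> borel_measurable (F (u k)) \<and> integrable M (S k) \<and> integrable M (\<lambda>\<omega>. (S k \<omega>)\<^sup>2) \<and>
    expectation (S k) = 0 \<and>
    expectation (\<lambda>\<omega>. (S k \<omega>)\<^sup>2) = expectation (\<lambda>\<omega>. \<Sum>i<k. (a i \<omega>)\<^sup>2 * (u (Suc i) - u i))"
  proof (induction k)
    case 0
    then show ?case by (simp add: S_def)
  next
    case (Suc k)
    define \<xi> where "\<xi> \<omega> = B (u (Suc k)) \<omega> - B (u k) \<omega>" for \<omega>
    have SSuc: "S (Suc k) = (\<lambda>\<omega>. S k \<omega> + a k \<omega> * \<xi> \<omega>)" by (simp add: S_def \<xi>_def)
    have aF: "a k \<in> borel_measurable (F (u k))" using a(1) .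
    have SF: "S k \<in> borel_measurable (F (u k))" using Suc by simp
    have iSa: "integrable M (\<lambda>\<omega>. S k \<omega> * a k \<omega>)"
    proof (rule Bochner_Integration.integrable_bound)
      show "integrable M (\<lambda>\<omega>. \<bar>c\<bar> * S k \<omega>)" using Suc by simp
      show "(\<lambda>\<omega>. S k \<omega> * a k \<omega>) \<in> borel_measurable M" using measurable_F[OF SF] am by simp
      show "AE \<omega> in M. norm (S k \<omega> * a k \<omega>) \<le> norm (\<bar>c\<bar> * S k \<omega>)"
      proof (rule AE_I2)
        fix \<omega> assume "\<omega> \<in> space M"
        then have "\<bar>a k \<omega>\<bar> \<le> \<bar>c\<bar>" using a(2)[of \<omega> k] by simp
        then show "norm (S k \<omega> * a k \<omega>) \<le> norm (\<bar>c\<bar> * S k \<omega>)"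
          using mult_right_mono[of "\<bar>a k \<omega>\<bar>" "\<bar>c\<bar>" "\<bar>S k \<omega>\<bar>"] by (simp add: abs_mult mult.commute)
      qed
    qed
    have 1: "integrable M (\<lambda>\<omega>. a k \<omega> * \<xi> \<omega>)" "expectation (\<lambda>\<omega>. a k \<omega> * \<xi> \<omega>) = 0"
      unfolding \<xi>_def using increment_times[OF u0 u(2) aF ia] by auto
    have 2: "integrable M (\<lambda>\<omega>. (S k \<omega> * a k \<omega>) * \<xi> \<omega>)" "expectation (\<lambda>\<omega>. (S k \<omega> * a k \<omega>) * \<xi> \<omega>) = 0"
      unfolding \<xi>_def using increment_times[OF u0 u(2) borel_measurable_times[OF SF aF] iSa] by auto
    have 3: "integrable M (\<lambda>\<omega>. (a k \<omega>)\<^sup>2 * (\<xi> \<omega>)\<^sup>2)"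
      "expectation (\<lambda>\<omega>. (a k \<omega>)\<^sup>2 * (\<xi> \<omega>)\<^sup>2) = expectation (\<lambda>\<omega>. (a k \<omega>)\<^sup>2) * (u (Suc k) - u k)"
      unfolding \<xi>_def using increment_times[OF u0 u(2) borel_measurable_power[OF aF] ia2] by auto
    have sq: "(S (Suc k) \<omega>)\<^sup>2 = (S k \<omega>)\<^sup>2 + 2 * ((S k \<omega> * a k \<omega>) * \<xi> \<omega>) + (a k \<omega>)\<^sup>2 * (\<xi> \<omega>)\<^sup>2" for \<omega>
      by (simp add: SSuc power2_eq_square algebra_simps)
    have isum: "integrable M (\<lambda>\<omega>. \<Sum>i<k. (a i \<omega>)\<^sup>2 * (u (Suc i) - u i))"
      by (intro Bochner_Integration.integrable_sum integrable_mult_left ia2)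
    have "S (Suc k) \<in> borel_measurable (F (u (Suc k)))"
      unfolding SSuc \<xi>_def
      using measurable_F_mono[OF u(2) SF] measurable_F_mono[OF u(2) aF]
        adapted[OF u0 order_refl] adapted[OF u0 u(2)] by auto
    moreover have "integrable M (S (Suc k))" "expectation (S (Suc k)) = 0"
      unfolding SSuc using Suc 1 by auto
    moreover have "integrable M (\<lambda>\<omega>. (S (Suc k) \<omega>)\<^sup>2)"
      unfolding sq using Suc 2 3 by auto
    moreover have "expectation (\<lambda>\<omega>. (S (Suc k) \<omega>)\<^sup>2)
        = expectation (\<lambda>\<omega>. \<Sum>i<Suc k. (a i \<omega>)\<^sup>2 * (u (Suc i) - u i))"
      unfolding sq using Suc 2 3 isum ia2 by simp
    ultimately show ?case by blast
  qed
  then show "S k \<in> borel_measurable (F (u k))" "integrable M (S k)" "integrable M (\<lambda>\<omega>. (S k \<omega>)\<^sup>2)"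
    "expectation (S k) = 0"
    "expectation (\<lambda>\<omega>. (S k \<omega>)\<^sup>2) = expectation (\<lambda>\<omega>. \<Sum>i<k. (a i \<omega>)\<^sup>2 * (u (Suc i) - u i))" by auto
qed

end

section \<open>The mean first-passage time\<close>

text \<open>
  The data of the limit problem: the first passage of \<open>(1 + lam) s - \<nu> \<phi> (f s)\<close> above a level.
\<close>

locale time_change =
  fixes lam \<nu> :: real and f :: "real \<Rightarrow> real"
  assumes lam: "0 \<le> lam" and \<nu>: "0 \<le> \<nu>"
    and f_cont: "continuous_on {0..} f" and f_mono: "mono_on {0..} f" and f_0: "f 0 = 0"
begin

lemma f_le: "0 \<le> s \<Longrightarrow> s \<le> t \<Longrightarrow> f s \<le> f t"
  using f_mono by (auto simp: mono_on_def)

lemma f_nonneg: "0 \<le> s \<Longrightarrow> 0 \<le> f s"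
  using f_le[of 0 s] f_0 by simp

definition drifted :: "(real \<Rightarrow> real) \<Rightarrow> real \<Rightarrow> real" where
  "drifted \<phi> s = (1 + lam) * s - \<nu> * \<phi> (f s)"

lemma continuous_drifted:
  assumes "continuous_on {0..} \<phi>"
  shows "continuous_on {0..} (drifted \<phi>)"
  unfolding drifted_def
  by (intro continuous_intros continuous_on_compose2[OF assms] f_cont) (use f_nonneg in auto)

lemma first_passage_eq: "first_passage lam \<nu> f B g \<omega> = Inf {s. 0 \<le> s \<and> g < drifted (\<lambda>t. B t \<omega>) s}"
  by (simp add: first_passage_def drifted_def)

lemma ex_rational_passage:
  assumes "continuous_on {0..} \<phi>" "0 \<le> s" "g < drifted \<phi> s" "s < x"
  obtains q where "q \<in> \<rat>" "0 \<le> q" "q < x" "g < drifted \<phi> q"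
proof -
  obtain d where d: "0 < d" "\<And>t. 0 \<le> t \<Longrightarrow> \<bar>t - s\<bar> < d \<Longrightarrow> g < drifted \<phi> t"
    using level_exceeded_nearby[OF continuous_drifted[OF assms(1)] assms(2,3)] by metis
  obtain q where q: "q \<in> \<rat>" "s < q" "q < min x (s + d)"
    using Rats_dense_in_real[of s "min x (s + d)"] assms d(1) by auto
  then show ?thesis using d(2)[of q] assms(2) by (intro that[of q]) auto
qed

lemma drifted_measurable:
  assumes "\<And>t. 0 \<le> t \<Longrightarrow> B t \<in> borel_measurable M" "0 \<le> s"
  shows "(\<lambda>\<omega>. drifted (\<lambda>t. B t \<omega>) s) \<in> borel_measurable M"
  unfolding drifted_def using assms f_nonneg by measurable

lemma passage_sets:
  assumes B: "\<And>t. 0 \<le> t \<Longrightarrow> B t \<in> borel_measurable M"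
    and cont: "\<And>\<omega>. \<omega> \<in> space M \<Longrightarrow> continuous_on {0..} (\<lambda>t. B t \<omega>)"
  shows "{\<omega> \<in> space M. \<exists>s\<ge>0. s < x \<and> g < drifted (\<lambda>t. B t \<omega>) s} \<in> sets M" (is ?A)
    and "{\<omega> \<in> space M. \<exists>s\<ge>0. g < drifted (\<lambda>t. B t \<omega>) s} \<in> sets M" (is ?B)
proof -
  have m: "{\<omega> \<in> space M. g < drifted (\<lambda>t. B t \<omega>) q} \<in> sets M" if "0 \<le> q" for q
    using drifted_measurable[OF B that] by measurable
  have sub: "(\<Union>q\<in>{q\<in>\<rat>. 0 \<le> q \<and> P q}. {\<omega> \<in> space M. g < drifted (\<lambda>t. B t \<omega>) q}) \<in> sets M" for P
    by (rule sets.countable_UN') (use m in \<open>auto intro: countable_subset[OF _ countable_rat]\<close>)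
  have 1: "{\<omega> \<in> space M. \<exists>s\<ge>0. s < x \<and> g < drifted (\<lambda>t. B t \<omega>) s}
    = (\<Union>q\<in>{q\<in>\<rat>. 0 \<le> q \<and> q < x}. {\<omega> \<in> space M. g < drifted (\<lambda>t. B t \<omega>) q})" for x
  proof (intro equalityI subsetI)
    fix \<omega> assume "\<omega> \<in> {\<omega> \<in> space M. \<exists>s\<ge>0. s < x \<and> g < drifted (\<lambda>t. B t \<omega>) s}"
    then obtain s where s: "\<omega> \<in> space M" "0 \<le> s" "s < x" "g < drifted (\<lambda>t. B t \<omega>) s" by auto
    obtain q where "q \<in> \<rat>" "0 \<le> q" "q < x" "g < drifted (\<lambda>t. B t \<omega>) q"
      using ex_rational_passage[OF cont[OF s(1)] s(2,4,3)] .
    then show "\<omega> \<in> (\<Union>q\<in>{q\<in>\<rat>. 0 \<le> q \<and> q < x}. {\<omega> \<in> space M. g < drifted (\<lambda>t. B t \<omega>) q})"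
      using s(1) by auto
  qed auto
  show ?A unfolding 1 by (rule sub)
  have "{\<omega> \<in> space M. \<exists>s\<ge>0. g < drifted (\<lambda>t. B t \<omega>) s}
    = (\<Union>n::nat. {\<omega> \<in> space M. \<exists>s\<ge>0. s < real n \<and> g < drifted (\<lambda>t. B t \<omega>) s})"
  proof (intro equalityI subsetI)
    fix \<omega> assume "\<omega> \<in> {\<omega> \<in> space M. \<exists>s\<ge>0. g < drifted (\<lambda>t. B t \<omega>) s}"
    then obtain s where s: "\<omega> \<in> space M" "0 \<le> s" "g < drifted (\<lambda>t. B t \<omega>) s" by auto
    obtain n :: nat where "s < real n" using reals_Archimedean2 by blast
    then show "\<omega> \<in> (\<Union>n::nat. {\<omega> \<in> space M. \<exists>s\<ge>0. s < real n \<and> g < drifted (\<lambda>t. B t \<omega>) s})"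
      using s by auto
  qed auto
  moreover have "\<dots> \<in> sets M" unfolding 1 by (intro sets.countable_UN) (use sub in auto)
  ultimately show ?B by simp
qed

lemma first_passage_less_iff:
  assumes "\<exists>s\<ge>0. g < drifted (\<lambda>t. B t \<omega>) s"
  shows "first_passage lam \<nu> f B g \<omega> < x \<longleftrightarrow> (\<exists>s\<ge>0. s < x \<and> g < drifted (\<lambda>t. B t \<omega>) s)"
  unfolding first_passage_eq using assms
  by (subst cInf_less_iff) (auto intro!: bdd_belowI[of _ 0])

lemma first_passage_nonneg:
  assumes "\<exists>s\<ge>0. g < drifted (\<lambda>t. B t \<omega>) s"
  shows "0 \<le> first_passage lam \<nu> f B g \<omega>"
  unfolding first_passage_eq using assms by (intro cInf_greatest) auto

lemma first_passage_le:
  "0 \<le> s \<Longrightarrow> g < drifted (\<lambda>t. B t \<omega>) s \<Longrightarrow> first_passage lam \<nu> f B g \<omega> \<le> s"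
  unfolding first_passage_eq by (intro cInf_lower) (auto intro!: bdd_belowI[of _ 0])

text \<open>
  By continuity a passage before \<open>x\<close> is witnessed by a rational time. On the event that the path never
  passes, the infimum of the empty set is a constant.
\<close>

lemma first_passage_measurable:
  assumes B: "\<And>t. 0 \<le> t \<Longrightarrow> B t \<in> borel_measurable M"
    and cont: "\<And>\<omega>. \<omega> \<in> space M \<Longrightarrow> continuous_on {0..} (\<lambda>t. B t \<omega>)"
  shows "(\<lambda>\<omega>. first_passage lam \<nu> f B g \<omega>) \<in> borel_measurable M"
proof (rule borel_measurableI_less)
  fix x
  let ?E = "{\<omega> \<in> space M. \<exists>s\<ge>0. g < drifted (\<lambda>t. B t \<omega>) s}"
  let ?L = "{\<omega> \<in> space M. \<exists>s\<ge>0. s < x \<and> g < drifted (\<lambda>t. B t \<omega>) s}"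
  have none: "first_passage lam \<nu> f B g \<omega> = Inf {}" if "\<omega> \<in> space M" "\<omega> \<notin> ?E" for \<omega>
  proof -
    have "{s. 0 \<le> s \<and> g < drifted (\<lambda>t. B t \<omega>) s} = {}" using that by auto
    then show ?thesis unfolding first_passage_eq by (simp only:)
  qed
  have "{\<omega> \<in> space M. first_passage lam \<nu> f B g \<omega> < x} = ?L \<union> (if Inf {} < x then space M - ?E else {})"
  proof (intro equalityI subsetI)
    fix \<omega> assume w: "\<omega> \<in> {\<omega> \<in> space M. first_passage lam \<nu> f B g \<omega> < x}"
    show "\<omega> \<in> ?L \<union> (if Inf {} < x then space M - ?E else {})"
    proof (cases "\<omega> \<in> ?E")
      case True
      then show ?thesis using w first_passage_less_iff[of g B \<omega> x] by auto
    next
      case False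
      then show ?thesis using w none[of \<omega>] by auto
    qed
  next
    fix \<omega> assume w: "\<omega> \<in> ?L \<union> (if Inf {} < x then space M - ?E else {})"
    show "\<omega> \<in> {\<omega> \<in> space M. first_passage lam \<nu> f B g \<omega> < x}"
    proof (cases "\<omega> \<in> ?E")
      case True
      then show ?thesis using w first_passage_less_iff[of g B \<omega> x] by (auto split: if_splits)
    next
      case False
      then have "\<omega> \<notin> ?L" by auto
      then have "Inf {} < x" "\<omega> \<in> space M" using w by (auto split: if_splits)
      then show ?thesis using none[of \<omega>] False by auto
    qed
  qed
  also have "\<dots> \<in> sets M" using passage_sets[OF B cont] by auto
  finally show "{\<omega> \<in> space M. first_passage lam \<nu> f B g \<omega> < x} \<in> sets M" .
qed

end

lemma fatou_expectation:
  fixes X :: "nat \<Rightarrow> 'a \<Rightarrow> real"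
  assumes X[measurable]: "\<And>n. X n \<in> borel_measurable M" "Z \<in> borel_measurable M"
    and lim: "AE \<omega> in M. (\<lambda>n. X n \<omega>) \<longlonglongrightarrow> Z \<omega>"
    and X: "\<And>n. integrable M (X n)" "\<And>n. AE \<omega> in M. 0 \<le> X n \<omega>" "\<And>n. (\<integral>\<omega>. X n \<omega> \<partial>M) \<le> C"
  shows "integrable M Z" "(\<integral>\<omega>. Z \<omega> \<partial>M) \<le> C" "AE \<omega> in M. 0 \<le> Z \<omega>"
proof -
  have C: "0 \<le> C" using X(3)[of 0] integral_nonneg_AE[OF X(2)[of 0]] by linarith
  have "AE \<omega> in M. \<forall>n. 0 \<le> X n \<omega>" using X(2) by (simp add: AE_all_countable)
  then show nn: "AE \<omega> in M. 0 \<le> Z \<omega>" using lim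
    by eventually_elim (auto intro: LIMSEQ_le_const)
  have "(\<integral>\<^sup>+\<omega>. ennreal (Z \<omega>) \<partial>M) = (\<integral>\<^sup>+\<omega>. liminf (\<lambda>n. ennreal (X n \<omega>)) \<partial>M)"
  proof (rule nn_integral_cong_AE, use lim in eventually_elim)
    fix \<omega> assume "(\<lambda>n. X n \<omega>) \<longlonglongrightarrow> Z \<omega>"
    then have "(\<lambda>n. ennreal (X n \<omega>)) \<longlonglongrightarrow> ennreal (Z \<omega>)" by (intro tendsto_intros) auto
    then show "ennreal (Z \<omega>) = liminf (\<lambda>n. ennreal (X n \<omega>))"
      by (intro lim_imp_Liminf[symmetric]) auto
  qed
  also have "\<dots> \<le> liminf (\<lambda>n. \<integral>\<^sup>+\<omega>. ennreal (X n \<omega>) \<partial>M)"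
    by (rule nn_integral_liminf) measurable
  also have "\<dots> \<le> liminf (\<lambda>n::nat. ennreal C)"
    by (intro Liminf_mono always_eventually allI)
      (use X in \<open>auto simp: nn_integral_eq_integral intro!: ennreal_leI\<close>)
  finally have F: "(\<integral>\<^sup>+\<omega>. ennreal (Z \<omega>) \<partial>M) \<le> ennreal C" by (simp add: Liminf_const)
  then show iZ: "integrable M Z"
    by (intro integrableI_nonneg nn) (auto intro: le_less_trans)
  show "(\<integral>\<omega>. Z \<omega> \<partial>M) \<le> C"
    using F C iZ nn by (simp add: nn_integral_eq_integral)
qed

locale passage_bm = bm M F B + time_change lam \<nu> f
  for M :: "'a measure" and F B lam \<nu> f +
  fixes C :: real
  assumes growth: "\<And>x. 0 \<le> x \<Longrightarrow> f x \<le> C * (1 + x)\<^sup>2"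
begin

definition level :: "'a \<Rightarrow> real \<Rightarrow> real" where
  "level \<omega> = drifted (\<lambda>t. B t \<omega>)"

lemma continuous_level: "\<omega> \<in> space M \<Longrightarrow> continuous_on {0..} (level \<omega>)"
  unfolding level_def by (intro continuous_drifted continuous_B)

lemma level_measurable:
  assumes "0 \<le> s" "f s \<le> t"
  shows "(\<lambda>\<omega>. level \<omega> s) \<in> borel_measurable (F t)"
proof -
  have "B (f s) \<in> borel_measurable (F t)" by (rule adapted[OF f_nonneg[OF assms(1)] assms(2)])
  then show ?thesis unfolding level_def drifted_def by simp
qed

lemma level_0: "AE \<omega> in M. level \<omega> 0 = 0"
  using B_0 by eventually_elim (simp add: level_def drifted_def f_0)

lemma below_measurable:
  assumes "\<And>j. j \<le> i \<Longrightarrow> 0 \<le> s j" "\<And>j. j \<le> i \<Longrightarrow> f (s j) \<le> t"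
  shows "(\<lambda>\<omega>. of_bool (\<forall>j\<le>(i::nat). level \<omega> (s j) \<le> g) :: real) \<in> borel_measurable (F t)"
proof -
  have "{\<omega> \<in> space (F t). \<forall>j\<in>{..i}. level \<omega> (s j) \<le> g} \<in> sets (F t)"
    by (rule sets.sets_Collect_finite_All) (use level_measurable assms in auto)
  then have "(\<lambda>\<omega>. if \<forall>j\<in>{..i}. level \<omega> (s j) \<le> g then 1 else 0 :: real) \<in> borel_measurable (F t)"
    by (intro measurable_If) auto
  then show ?thesis by (simp only: of_bool_def atMost_iff Ball_def)
qed

context
  fixes g :: real
  assumes g: "0 \<le> g"
begin

abbreviation "\<theta> R \<omega> \<equiv> capped_passage (level \<omega>) g R"
abbreviation "\<tau> \<omega> \<equiv> first_passage lam \<nu> f B g \<omega>"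
abbreviation "never \<equiv> {\<omega> \<in> space M. \<not> (\<exists>s\<ge>0. g < level \<omega> s)}"

text \<open>
  Stopping at the first grid point above the level gives centred variables with second moment at most
  \<open>f R\<close>. As the mesh tends to \<open>0\<close> they converge pointwise to Brownian motion at the passage time, and
  the bound on the second moment lets the mean pass to the limit.
\<close>

lemma optional_stopping:
  assumes R: "0 < R"
  shows "\<theta> R \<in> borel_measurable M" "integrable M (\<lambda>\<omega>. B (f (\<theta> R \<omega>)) \<omega>)"
    "expectation (\<lambda>\<omega>. B (f (\<theta> R \<omega>)) \<omega>) = 0"
proof -
  define s where "s m i = real i * R / real (Suc m)" for m i :: nat
  define a where "a m i \<omega> = (of_bool (\<forall>j\<le>i. level \<omega> (s m j) \<le> g) :: real)" for m i \<omega>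
  define K where "K m \<omega> = grid_index (level \<omega>) g R (Suc m)" for m \<omega>
  define X where "X m \<omega> = (\<Sum>i<Suc m. a m i \<omega> * (B (f (s m (Suc i))) \<omega> - B (f (s m i)) \<omega>))" for m \<omega>
  have s: "0 \<le> s m i" "s m i \<le> s m (Suc i)" for m i
    using R by (auto simp: s_def divide_right_mono)
  have smono: "s m j \<le> s m i" if "j \<le> i" for m i j
    using R that by (simp add: s_def divide_right_mono mult_right_mono)
  have am: "a m i \<in> borel_measurable (F (f (s m i)))" for m i
    unfolding a_def by (rule below_measurable) (use s smono f_le in auto)
  have al: "(i < K m \<omega>) = (\<forall>j\<le>i. level \<omega> (s m j) \<le> g)" if "\<omega> \<in> space M" "i < Suc m" for m i \<omega>
    unfolding K_def s_def by (rule less_grid_index_iff[OF continuous_level[OF that(1)] that(2)])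
  have Kle: "K m \<omega> \<le> Suc m" if "\<omega> \<in> space M" for m \<omega>
    unfolding K_def by (rule grid_index_le[OF continuous_level[OF that]])
  have sum_a: "(\<Sum>i<Suc m. a m i \<omega> * x i) = (\<Sum>i<K m \<omega>. x i)" if "\<omega> \<in> space M" for m \<omega> and x :: "nat \<Rightarrow> real"
  proof -
    have "(\<Sum>i<K m \<omega>. x i) = (\<Sum>i<Suc m. if i < K m \<omega> then x i else 0)"
      using Kle[OF that, of m] by (intro sum.mono_neutral_cong_left) auto
    also have "\<dots> = (\<Sum>i<Suc m. a m i \<omega> * x i)"
      by (rule sum.cong) (use al[OF that] in \<open>auto simp: a_def\<close>)
    finally show ?thesis by simp
  qed
  have T_lim: "(\<lambda>m. s m (K m \<omega>)) \<longlonglongrightarrow> \<theta> R \<omega>" if "\<omega> \<in> space M" for \<omega>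
    using LIMSEQ_Suc[OF grid_passage_tendsto[OF continuous_level[OF that] R]] by (simp add: s_def K_def)
  have Xeq: "X m \<omega> = B (f (s m (K m \<omega>))) \<omega> - B 0 \<omega>" if "\<omega> \<in> space M" for m \<omega>
  proof -
    have "X m \<omega> = (\<Sum>i<K m \<omega>. B (f (s m (Suc i))) \<omega> - B (f (s m i)) \<omega>)"
      unfolding X_def by (rule sum_a[OF that])
    also have "\<dots> = B (f (s m (K m \<omega>))) \<omega> - B (f (s m 0)) \<omega>" by (rule sum_lessThan_telescope)
    finally show ?thesis by (simp add: s_def f_0)
  qed
  have ab: "\<bar>a m i \<omega>\<bar> \<le> 1" for m i \<omega> by (simp add: a_def)
  have ia2: "integrable M (\<lambda>\<omega>. (a m i \<omega>)\<^sup>2)" for m i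
  proof (rule integrable_const_bound[of _ 1])
    show "(\<lambda>\<omega>. (a m i \<omega>)\<^sup>2) \<in> borel_measurable M"
      by (rule borel_measurable_power[OF measurable_F[OF am]])
    show "AE \<omega> in M. norm ((a m i \<omega>)\<^sup>2) \<le> 1" by (simp add: a_def)
  qed
  note mt = martingale_transform[of "\<lambda>i. f (s m i)" "a m" 1 "Suc m" for m, OF f_nonneg[OF s(1)] f_le[OF s] am ab]
  have X1: "integrable M (X m)" "integrable M (\<lambda>\<omega>. (X m \<omega>)\<^sup>2)" "expectation (X m) = 0" for m
    using mt(2,3,4)[of m] unfolding X_def .
  have X2: "expectation (\<lambda>\<omega>. (X m \<omega>)\<^sup>2) \<le> f R" for m
  proof -
    have "expectation (\<lambda>\<omega>. (X m \<omega>)\<^sup>2) = expectation (\<lambda>\<omega>. \<Sum>i<Suc m. (a m i \<omega>)\<^sup>2 * (f (s m (Suc i)) - f (s m i)))"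
      unfolding X_def by (rule mt(5))
    also have "\<dots> \<le> f R"
    proof (rule integral_le_const)
      show "integrable M (\<lambda>\<omega>. \<Sum>i<Suc m. (a m i \<omega>)\<^sup>2 * (f (s m (Suc i)) - f (s m i)))"
        by (intro Bochner_Integration.integrable_sum integrable_mult_left ia2)
      show "AE \<omega> in M. (\<Sum>i<Suc m. (a m i \<omega>)\<^sup>2 * (f (s m (Suc i)) - f (s m i))) \<le> f R"
      proof (rule AE_I2)
        fix \<omega>
        have "(\<Sum>i<Suc m. (a m i \<omega>)\<^sup>2 * (f (s m (Suc i)) - f (s m i))) \<le> (\<Sum>i<Suc m. f (s m (Suc i)) - f (s m i))"
          using f_le[OF s] by (intro sum_mono) (auto simp: a_def)
        also have "\<dots> = f (s m (Suc m)) - f (s m 0)" by (rule sum_lessThan_telescope)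
        also have "\<dots> = f R" using R by (simp add: s_def f_0 del: of_nat_Suc)
        finally show "(\<Sum>i<Suc m. (a m i \<omega>)\<^sup>2 * (f (s m (Suc i)) - f (s m i))) \<le> f R" .
      qed
    qed
    finally show ?thesis .
  qed
  have X_lim: "(\<lambda>m. X m \<omega>) \<longlonglongrightarrow> B (f (\<theta> R \<omega>)) \<omega> - B 0 \<omega>" if w: "\<omega> \<in> space M" for \<omega>
  proof -
    have "continuous_on {0..} (\<lambda>s. B (f s) \<omega>)"
      by (rule continuous_on_compose2[OF continuous_B[OF w] f_cont]) (use f_nonneg in auto)
    then have "(\<lambda>m. B (f (s m (K m \<omega>))) \<omega>) \<longlonglongrightarrow> B (f (\<theta> R \<omega>)) \<omega>"
      by (rule continuous_on_tendsto_compose[OF _ T_lim[OF w]])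
        (use capped_passage_bounds(1)[OF continuous_level[OF w]] R s in auto)
    then show ?thesis unfolding Xeq[OF w] by (intro tendsto_intros)
  qed
  have Tm: "(\<lambda>\<omega>. s m (K m \<omega>)) \<in> borel_measurable M" for m
  proof -
    have "(\<lambda>\<omega>. (\<Sum>i<Suc m. a m i \<omega> * 1) * R / Suc m) \<in> borel_measurable M"
      using measurable_F[OF am] by measurable
    moreover have "(\<Sum>i<Suc m. a m i \<omega> * 1) * R / Suc m = s m (K m \<omega>)" if "\<omega> \<in> space M" for \<omega>
      unfolding sum_a[OF that] by (simp add: s_def)
    ultimately show ?thesis by (subst measurable_cong[symmetric]) auto
  qed
  show "\<theta> R \<in> borel_measurable M"
    by (rule borel_measurable_LIMSEQ_real[OF T_lim Tm])
  have Zm: "(\<lambda>\<omega>. B (f (\<theta> R \<omega>)) \<omega> - B 0 \<omega>) \<in> borel_measurable M"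
    by (rule borel_measurable_LIMSEQ_real[OF X_lim]) (use X1 in auto)
  have X1m: "X m \<in> borel_measurable M" for m using X1(1) by auto
  have lim: "AE \<omega> in M. (\<lambda>m. X m \<omega>) \<longlonglongrightarrow> B (f (\<theta> R \<omega>)) \<omega> - B 0 \<omega>" using X_lim by auto
  note L2 = expectation_tendsto_of_L2_bounded[OF prob_space_axioms X1m Zm lim X1(2) X2]
  have i: "integrable M (\<lambda>\<omega>. B (f (\<theta> R \<omega>)) \<omega> - B 0 \<omega>)" by (rule L2(1))
  have e: "expectation (\<lambda>\<omega>. B (f (\<theta> R \<omega>)) \<omega> - B 0 \<omega>) = 0"
    using L2(2) unfolding X1(3) by (simp add: LIMSEQ_const_iff)
  have B0m: "B 0 \<in> borel_measurable M" by (rule B_measurable) simp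
  have i0: "integrable M (B 0)" and e0: "expectation (B 0) = 0"
    using integrable_cong_AE[OF B0m _ B_0] integral_cong_AE[OF B0m _ B_0] by auto
  show "integrable M (\<lambda>\<omega>. B (f (\<theta> R \<omega>)) \<omega>)" "expectation (\<lambda>\<omega>. B (f (\<theta> R \<omega>)) \<omega>) = 0"
    using Bochner_Integration.integrable_add[OF i i0] Bochner_Integration.integral_add[OF i i0] e e0 by auto
qed

lemma capped_bounds:
  assumes "\<omega> \<in> space M" "0 \<le> R"
  shows "0 \<le> \<theta> R \<omega>" "\<theta> R \<omega> \<le> R"
  using capped_passage_bounds[OF continuous_level[OF assms(1)] assms(2)] by auto

lemma capped_integrable:
  assumes "0 < R" shows "integrable M (\<theta> R)"
  by (rule integrable_const_bound[of _ R])
    (use capped_bounds assms optional_stopping(1)[OF assms] in auto)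

lemma level_at_capped:
  assumes "0 < R"
  shows "integrable M (\<lambda>\<omega>. level \<omega> (\<theta> R \<omega>))"
    "expectation (\<lambda>\<omega>. level \<omega> (\<theta> R \<omega>)) = (1 + lam) * expectation (\<theta> R)"
proof -
  have eq: "level \<omega> (\<theta> R \<omega>) = (1 + lam) * \<theta> R \<omega> - \<nu> * B (f (\<theta> R \<omega>)) \<omega>" for \<omega>
    unfolding level_def drifted_def ..
  show "integrable M (\<lambda>\<omega>. level \<omega> (\<theta> R \<omega>))"
    "expectation (\<lambda>\<omega>. level \<omega> (\<theta> R \<omega>)) = (1 + lam) * expectation (\<theta> R)"
    unfolding eq using capped_integrable[OF assms] optional_stopping(2,3)[OF assms] by auto
qed

lemma capped_expectation_le:
  assumes "0 < R" shows "(1 + lam) * expectation (\<theta> R) \<le> g"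
  unfolding level_at_capped(2)[OF assms, symmetric]
proof (rule integral_le_const[OF level_at_capped(1)[OF assms]])
  show "AE \<omega> in M. level \<omega> (\<theta> R \<omega>) \<le> g"
    using level_0 AE_space
  proof eventually_elim
    case (elim \<omega>)
    then show ?case
      using at_capped_passage_le[OF continuous_level, of \<omega> R g] assms g by auto
  qed
qed

lemma passes_sets: "{\<omega> \<in> space M. \<exists>s\<ge>0. g < level \<omega> s} \<in> sets M"
  unfolding level_def using passage_sets(2)[OF B_measurable continuous_B] by auto

text \<open>
  A path that never passes has the capped passage time \<open>n\<close> for every cap \<open>n\<close>, whereas the means of these
  times are bounded by \<open>g / (1 + lam)\<close>.
\<close>

lemma passes_AE: "AE \<omega> in M. \<exists>s\<ge>0. g < level \<omega> s"
proof -
  have ns: "never \<in> sets M"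
  proof -
    have "never = space M - {\<omega> \<in> space M. \<exists>s\<ge>0. g < level \<omega> s}" by auto
    then show ?thesis using passes_sets by auto
  qed
  have "real n * prob never \<le> g / (1 + lam)" if n: "0 < n" for n :: nat
  proof -
    have "real n * prob never = expectation (\<lambda>\<omega>. real n * indicator never \<omega>)" using ns by simp
    also have "\<dots> \<le> expectation (\<theta> (real n))"
    proof (rule integral_mono)
      show "integrable M (\<lambda>\<omega>. real n * indicat_real never \<omega>)"
        by (rule integrable_const_bound[of _ "real n"]) (use ns in \<open>auto simp: indicator_def\<close>)
      fix \<omega> assume w: "\<omega> \<in> space M"
      show "real n * indicat_real never \<omega> \<le> \<theta> (real n) \<omega>"
      proof (cases "\<omega> \<in> never")
        case True
        then have "{s. 0 \<le> s \<and> s \<le> real n \<and> g < level \<omega> s} = {}" by auto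
        then have "\<theta> (real n) \<omega> = real n" unfolding capped_passage_def by (simp only: cInf_singleton)
        then show ?thesis using True by simp
      next
        case False
        then show ?thesis using capped_bounds(1)[OF w, of "real n"] by simp
      qed
    qed (use capped_integrable n in auto)
    also have "\<dots> \<le> g / (1 + lam)"
      using capped_expectation_le[of "real n"] n lam by (simp add: field_simps)
    finally show ?thesis .
  qed
  note key = this
  have "prob never \<le> 0"
  proof (rule ccontr)
    assume "\<not> prob never \<le> 0"
    then obtain n :: nat where n: "g / (1 + lam) < real n * prob never"
      using reals_Archimedean3[of "prob never"] by (meson not_le)
    have "0 \<le> g / (1 + lam)" using g lam by simp
    then have "0 < n" using n by (cases n) auto
    then show False using key[of n] n by linarith
  qed
  then have "prob never = 0" using measure_nonneg[of M never] by linarith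
  then have "emeasure M never = 0" unfolding emeasure_eq_measure by (simp only: ennreal_0)
  then have "never \<in> null_sets M" using ns by (rule null_setsI)
  then have "AE \<omega> in M. \<omega> \<notin> never" by (rule AE_not_in)
  then show ?thesis using AE_space by eventually_elim blast
qed

lemma first_passage_measurable_M: "\<tau> \<in> borel_measurable M"
  using first_passage_measurable[OF B_measurable continuous_B] by auto

lemma capped_eq_min:
  assumes "\<omega> \<in> space M" "\<exists>s\<ge>0. g < level \<omega> s" "0 \<le> R"
  shows "\<theta> R \<omega> = min R (\<tau> \<omega>)"
  using capped_passage_eq_min[OF continuous_level[OF assms(1)] assms(2,3)]
  by (simp add: first_passage_eq level_def)

text \<open>
  The capped passage times increase to the passage time, so this is Fatou's lemma.
\<close>

lemma first_passage_integrable: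
  "integrable M \<tau>" "expectation \<tau> \<le> g / (1 + lam)" "AE \<omega> in M. 0 \<le> \<tau> \<omega>"
proof -
  have lim: "AE \<omega> in M. (\<lambda>n. \<theta> (real (Suc n)) \<omega>) \<longlonglongrightarrow> \<tau> \<omega>"
    using passes_AE AE_space
  proof eventually_elim
    case (elim \<omega>)
    obtain n0 :: nat where n0: "\<tau> \<omega> < real n0" using reals_Archimedean2 by blast
    have "\<forall>\<^sub>F n in sequentially. \<theta> (real (Suc n)) \<omega> = \<tau> \<omega>"
      using eventually_ge_at_top[of n0]
    proof eventually_elim
      case (elim n)
      then show ?case using capped_eq_min[OF \<open>\<omega> \<in> space M\<close>, of "real (Suc n)"] \<open>\<exists>s\<ge>0. g < level \<omega> s\<close> n0 by auto
    qed
    then show ?case by (rule tendsto_eventually)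
  qed
  have le: "expectation (\<theta> (real (Suc n))) \<le> g / (1 + lam)" for n
    using capped_expectation_le[of "real (Suc n)"] lam by (simp add: field_simps)
  have nn: "AE \<omega> in M. 0 \<le> \<theta> (real (Suc n)) \<omega>" for n
    by (rule AE_I2) (use capped_bounds(1) in auto)
  have pos: "0 < real (Suc n)" for n by simp
  note F = fatou_expectation[OF optional_stopping(1)[OF pos] first_passage_measurable_M lim
      capped_integrable[OF pos] nn le]
  show "integrable M \<tau>" "expectation \<tau> \<le> g / (1 + lam)" "AE \<omega> in M. 0 \<le> \<tau> \<omega>"
    by (rule F)+
qed

end

end

text \<open>
  The increments of \<open>f\<close> telescope over the grid points below \<open>x\<close>, and the last of them overshoots \<open>x\<close> by
  at most one mesh width.
\<close>

lemma (in time_change) truncated_variation: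
  assumes s: "\<And>i. s (Suc i) = s i + d" "0 \<le> d" "0 \<le> s 0" "s 0 \<le> x + d"
  shows "(\<Sum>i<m. if s i < x then f (s (Suc i)) - f (s i) else 0) \<le> f (min (s m) (x + d)) - f (s 0)"
proof (induction m)
  case 0
  then show ?case using s by simp
next
  case (Suc m)
  have s0: "0 \<le> s i" for i using s by (induction i) auto
  have x0: "0 \<le> x + d" using s by simp
  show ?case
  proof (cases "s m < x")
    case True
    then have "min (s m) (x + d) = s m" "min (s (Suc m)) (x + d) = s (Suc m)" using s(1,2) by auto
    then show ?thesis using Suc True by simp
  next
    case False
    have "f (min (s m) (x + d)) \<le> f (min (s (Suc m)) (x + d))"
      using s s0 x0 by (intro f_le) auto
    then show ?thesis using Suc False by simp
  qed
qed

context passage_bm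
begin

lemma stays_sets:
  assumes "0 < R"
  shows "{\<omega> \<in> space M. \<forall>s\<in>{0..R}. level \<omega> s \<le> g} \<in> sets (F (f R))"
proof -
  have spF: "space (F t) = space M" for t using subalg by (simp add: subalgebra_def)
  let ?E = "\<lambda>q. {\<omega> \<in> space (F (f R)). g < level \<omega> q}"
  have "?E q \<in> sets (F (f R))" if "0 \<le> q" "q \<le> R" for q
    using level_measurable[OF that(1) f_le[OF that]] by measurable
  then have "(\<Union>q\<in>\<rat> \<inter> {0..R}. ?E q) \<in> sets (F (f R))"
    by (intro sets.countable_UN') (auto intro: countable_Int1 countable_rat)
  then have "space (F (f R)) - (\<Union>q\<in>\<rat> \<inter> {0..R}. ?E q) \<in> sets (F (f R))" by blast
  also have "space (F (f R)) - (\<Union>q\<in>\<rat> \<inter> {0..R}. ?E q) = {\<omega> \<in> space M. \<forall>s\<in>{0..R}. level \<omega> s \<le> g}"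
  proof (intro equalityI subsetI)
    fix \<omega> assume w: "\<omega> \<in> space (F (f R)) - (\<Union>q\<in>\<rat> \<inter> {0..R}. ?E q)"
    then have sp: "\<omega> \<in> space M" by (simp add: spF)
    have "level \<omega> s \<le> g" if "s \<in> {0..R}" for s
    proof (rule le_on_rationals_imp_le[OF assms _ _ that])
      show "continuous_on {0..R} (level \<omega>)"
        by (rule continuous_on_subset[OF continuous_level[OF sp]]) auto
      fix q assume "q \<in> \<rat>" "q \<in> {0..R}"
      then show "level \<omega> q \<le> g" using w by (auto simp: not_less)
    qed
    then show "\<omega> \<in> {\<omega> \<in> space M. \<forall>s\<in>{0..R}. level \<omega> s \<le> g}" using sp by simp
  qed (auto simp: spF not_less)
  finally show ?thesis .
qed

text \<open>
  If the path is still below the level at time \<open>R\<close> and \<open>v\<close> denotes the height of the Brownian motion, then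
  a passage before the time \<open>e v\<close>, with \<open>e\<close> small, requires Brownian motion to fall from \<open>v\<close> to at most
  \<open>v / 2\<close>: where the drifted path exceeds \<open>g \<ge> 0\<close> one has \<open>\<nu> B < (1 + lam) e v \<le> \<nu> v / 2\<close>. Up to this
  time the variance is at most \<open>9 C e\<^sup>2 v\<^sup>2\<close>, by the quadratic growth of \<open>f\<close>, so Chebyshev's inequality
  bounds the probability of the fall by a half. Hence with probability at least a half the passage time
  exceeds \<open>e v\<close>, and the mean of \<open>v\<close> is at most \<open>2 / e\<close> times the mean of the passage time. The
  increments carry the weight \<open>1 / sqrt v\<close>, which makes the estimate linear in \<open>v\<close>. The height is capped at
  \<open>L\<close> so that finitely many grid points reach every horizon \<open>e v\<close>.
\<close>

lemma high_value_bound: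
  assumes g: "0 \<le> g" and \<nu>0: "0 < \<nu>"
    and e: "0 < e" "(1 + lam) * e \<le> \<nu> / 2" "72 * C * e\<^sup>2 \<le> 1"
    and R: "1 \<le> R" "R \<le> e * L"
  defines "\<Lambda> \<equiv> {\<omega> \<in> space M. \<forall>s\<in>{0..R}. level \<omega> s \<le> g}"
  defines "E \<equiv> {\<omega> \<in> \<Lambda>. R \<le> e * B (f R) \<omega>}"
  shows "expectation (\<lambda>\<omega>. min (B (f R) \<omega>) L * indicator E \<omega>)
    \<le> (2 / e) * expectation (\<lambda>\<omega>. first_passage lam \<nu> f B g \<omega> * indicator \<Lambda> \<omega>)"
proof -
  have spF: "space (F t) = space M" for t using subalg by (simp add: subalgebra_def)
  have R0: "0 \<le> R" "0 < R" using R by auto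
  have L0: "0 < L" using R e by (metis less_le_trans zero_less_one zero_less_mult_pos)
  define v where "v \<omega> = min (B (f R) \<omega>) L" for \<omega>
  have BR: "B (f R) \<in> borel_measurable (F (f R))" by (rule adapted[OF f_nonneg[OF R0(1)] order_refl])
  have vF: "v \<in> borel_measurable (F (f R))" unfolding v_def using BR by simp
  have \<Lambda>F: "\<Lambda> \<in> sets (F (f R))" unfolding \<Lambda>_def by (rule stays_sets[OF R0(2)])
  have EF: "E \<in> sets (F (f R))"
  proof -
    have "E = \<Lambda> \<inter> {\<omega> \<in> space (F (f R)). R \<le> e * B (f R) \<omega>}"
      by (auto simp: E_def \<Lambda>_def spF)
    moreover have "{\<omega> \<in> space (F (f R)). R \<le> e * B (f R) \<omega>} \<in> sets (F (f R))"
      using BR by measurable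
    ultimately show ?thesis using \<Lambda>F by auto
  qed
  have EM[measurable]: "E \<in> sets M" and \<Lambda>M[measurable]: "\<Lambda> \<in> sets M"
    using EF \<Lambda>F subalg[of "f R"] by (auto simp: subalgebra_def)
  have vM[measurable]: "v \<in> borel_measurable M" by (rule measurable_F[OF vF])
  have Esp: "\<omega> \<in> space M" if "\<omega> \<in> E" for \<omega> using that by (simp add: E_def \<Lambda>_def)
  have vE: "R \<le> e * v \<omega>" "v \<omega> \<le> B (f R) \<omega>" "v \<omega> \<le> L" "0 < v \<omega>" if "\<omega> \<in> E" for \<omega>
  proof -
    show 1: "R \<le> e * v \<omega>" using that R e by (auto simp: v_def E_def min_def)
    show "v \<omega> \<le> B (f R) \<omega>" "v \<omega> \<le> L" by (auto simp: v_def)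
    have "0 < e * v \<omega>" using 1 R0 by linarith
    then show "0 < v \<omega>" using e by (simp add: zero_less_mult_iff)
  qed
  have iv: "integrable M (\<lambda>\<omega>. v \<omega> * indicator A \<omega>)" if "A \<in> sets M" "A \<subseteq> E" for A
  proof (rule integrable_const_bound[of _ L])
    show "AE \<omega> in M. norm (v \<omega> * indicator A \<omega>) \<le> L"
      using vE(3,4) that(2) L0 by (intro AE_I2) (auto simp: indicator_def subset_iff less_imp_le)
  qed (use that in measurable)
  define EvE where "EvE = expectation (\<lambda>\<omega>. v \<omega> * indicator E \<omega>)"
  \<comment> \<open>The grid ends beyond every horizon \<open>e v\<close>, as \<open>v \<le> L\<close>.\<close>
  define h where "h = e * L + 1 - R"
  have h0: "1 \<le> h" using R by (simp add: h_def)
  define d where "d m = h / real (Suc m)" for m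
  have d0: "0 < d m" for m using h0 by (simp add: d_def)
  define s where "s m i = R + real i * d m" for m i
  have sSuc: "s m (Suc i) = s m i + d m" for m i by (simp add: s_def algebra_simps)
  have sR: "R \<le> s m i" for m i using d0[of m] by (simp add: s_def)
  then have s0: "0 \<le> s m i" for m i using R0 order_trans by blast
  have smono: "s m j \<le> s m i" if "j \<le> i" for m i j
    using that d0[of m] by (simp add: s_def mult_right_mono)
  have s_last: "s m (Suc m) = e * L + 1" for m by (simp add: s_def d_def h_def del: of_nat_Suc)
  define P where "P m = {\<omega> \<in> E. \<exists>i\<le>Suc m. s m i < e * v \<omega> \<and> g < level \<omega> (s m i)}" for m
  have PM[measurable]: "P m \<in> sets M" for m
  proof -
    have "{\<omega> \<in> space M. s m i < e * v \<omega> \<and> g < level \<omega> (s m i)} \<in> sets M" for i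
      using measurable_F[OF level_measurable[OF s0 order_refl], of m i] by measurable
    moreover have "P m = (\<Union>i\<in>{..Suc m}. E \<inter> {\<omega> \<in> space M. s m i < e * v \<omega> \<and> g < level \<omega> (s m i)})"
      using Esp by (auto simp: P_def)
    ultimately show ?thesis by auto
  qed
  have PE: "P m \<subseteq> E" for m by (auto simp: P_def)
  \<comment> \<open>On \<open>P m\<close> the stopped sum has dropped by at least half of its starting height, so that \<open>v \<le> 4 S\<^sup>2\<close>.\<close>
  have half: "expectation (\<lambda>\<omega>. v \<omega> * indicator (P m) \<omega>) \<le> EvE / 2" if m: "d m \<le> 1" for m
  proof -
    define a where "a i \<omega> = indicator E \<omega> * of_bool (s m i < e * v \<omega>) *
        of_bool (\<forall>j\<le>i. level \<omega> (s m j) \<le> g) / sqrt (v \<omega>)" for i \<omega>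
    define S where "S \<omega> = (\<Sum>i<Suc m. a i \<omega> * (B (f (s m (Suc i))) \<omega> - B (f (s m i)) \<omega>))" for \<omega>
    have am: "a i \<in> borel_measurable (F (f (s m i)))" for i
    proof -
      have le: "f R \<le> f (s m i)" using f_le[OF R0(1) sR] .
      have 1: "E \<in> sets (F (f (s m i)))" using EF F_mono[OF le] by (auto simp: subalgebra_def)
      have 2: "v \<in> borel_measurable (F (f (s m i)))" by (rule measurable_F_mono[OF le vF])
      have 3: "(\<lambda>\<omega>. of_bool (\<forall>j\<le>i. level \<omega> (s m j) \<le> g) :: real) \<in> borel_measurable (F (f (s m i)))"
        by (rule below_measurable) (use s0 smono f_le in auto)
      have "(\<lambda>\<omega>. if s m i < e * v \<omega> then 1 else 0 :: real) \<in> borel_measurable (F (f (s m i)))"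
        using 2 by measurable
      then have 4: "(\<lambda>\<omega>. of_bool (s m i < e * v \<omega>) :: real) \<in> borel_measurable (F (f (s m i)))"
        by (simp only: of_bool_def)
      show ?thesis unfolding a_def
        by (rule borel_measurable_divide[OF borel_measurable_times[OF borel_measurable_times[OF
                borel_measurable_indicator[OF 1] 4] 3] measurable_compose[OF 2 borel_measurable_sqrt]])
    qed
    have ab: "\<bar>a i \<omega>\<bar> \<le> sqrt e" for i \<omega>
    proof (cases "\<omega> \<in> E")
      case True
      have "1 \<le> e * v \<omega>" using vE(1)[OF True] R by simp
      then have "1 / v \<omega> \<le> e" using vE(4)[OF True] by (simp add: field_simps)
      then have "sqrt (1 / v \<omega>) \<le> sqrt e" by simp
      moreover have "\<bar>a i \<omega>\<bar> \<le> 1 / sqrt (v \<omega>)" using vE(4)[OF True] True by (auto simp: a_def)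
      ultimately show ?thesis by (simp add: real_sqrt_divide)
    qed (use e in \<open>simp add: a_def\<close>)
    have u: "0 \<le> f (s m 0)" "f (s m i) \<le> f (s m (Suc i))" for i
      using f_nonneg[OF s0] f_le[OF s0 smono] by auto
    note mt = martingale_transform[of "\<lambda>i. f (s m i)" a "sqrt e" "Suc m", OF u am ab]
    have S2i: "integrable M (\<lambda>\<omega>. (S \<omega>)\<^sup>2)" unfolding S_def by (rule mt(3))
    have S2: "expectation (\<lambda>\<omega>. (S \<omega>)\<^sup>2)
        = expectation (\<lambda>\<omega>. \<Sum>i<Suc m. (a i \<omega>)\<^sup>2 * (f (s m (Suc i)) - f (s m i)))"
      unfolding S_def by (rule mt(5))
    have ia2: "integrable M (\<lambda>\<omega>. (a i \<omega>)\<^sup>2)" for i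
    proof (rule integrable_const_bound[of _ e])
      show "(\<lambda>\<omega>. (a i \<omega>)\<^sup>2) \<in> borel_measurable M"
        by (rule borel_measurable_power[OF measurable_F[OF am]])
      show "AE \<omega> in M. norm ((a i \<omega>)\<^sup>2) \<le> e"
        using ab[of i] e by (intro AE_I2) (metis abs_le_square_iff abs_of_nonneg real_norm_def real_sqrt_ge_zero real_sqrt_pow2 less_imp_le zero_le_power2)
    qed
    have "expectation (\<lambda>\<omega>. (S \<omega>)\<^sup>2) \<le> expectation (\<lambda>\<omega>. 9 * C * e\<^sup>2 * (v \<omega> * indicator E \<omega>))"
      unfolding S2
    proof (rule integral_mono)
      show "integrable M (\<lambda>\<omega>. \<Sum>i<Suc m. (a i \<omega>)\<^sup>2 * (f (s m (Suc i)) - f (s m i)))"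
        by (intro Bochner_Integration.integrable_sum integrable_mult_left ia2)
      show "integrable M (\<lambda>\<omega>. 9 * C * e\<^sup>2 * (v \<omega> * indicator E \<omega>))"
        by (intro integrable_mult_right iv EM order_refl)
      fix \<omega> assume "\<omega> \<in> space M"
      show "(\<Sum>i<Suc m. (a i \<omega>)\<^sup>2 * (f (s m (Suc i)) - f (s m i))) \<le> 9 * C * e\<^sup>2 * (v \<omega> * indicator E \<omega>)"
      proof (cases "\<omega> \<in> E")
        case True
        define x where "x = e * v \<omega>"
        have x: "1 \<le> x" "R \<le> x" using vE(1)[OF True] R by (auto simp: x_def)
        have v0: "0 < v \<omega>" using vE(4)[OF True] .
        have "(\<Sum>i<Suc m. (a i \<omega>)\<^sup>2 * (f (s m (Suc i)) - f (s m i)))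
          \<le> (\<Sum>i<Suc m. 1 / v \<omega> * (if s m i < x then f (s m (Suc i)) - f (s m i) else 0))"
        proof (rule sum_mono)
          fix i
          have "(a i \<omega>)\<^sup>2 \<le> of_bool (s m i < x) / v \<omega>"
            using v0 True by (auto simp: a_def x_def power_divide)
          then have "(a i \<omega>)\<^sup>2 * (f (s m (Suc i)) - f (s m i)) \<le> of_bool (s m i < x) / v \<omega> * (f (s m (Suc i)) - f (s m i))"
            using u(2)[of i] by (intro mult_right_mono) auto
          then show "(a i \<omega>)\<^sup>2 * (f (s m (Suc i)) - f (s m i))
            \<le> 1 / v \<omega> * (if s m i < x then f (s m (Suc i)) - f (s m i) else 0)"
            by (cases "s m i < x") auto
        qed
        also have "\<dots> = 1 / v \<omega> * (\<Sum>i<Suc m. if s m i < x then f (s m (Suc i)) - f (s m i) else 0)"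
          by (rule sum_distrib_left[symmetric])
        also have "\<dots> \<le> 1 / v \<omega> * (C * (3 * x)\<^sup>2)"
        proof (rule mult_left_mono)
          have "s m 0 \<le> x + d m" using x d0[of m] by (simp add: s_def)
          then have "(\<Sum>i<Suc m. if s m i < x then f (s m (Suc i)) - f (s m i) else 0)
            \<le> f (min (s m (Suc m)) (x + d m)) - f (s m 0)"
            by (intro truncated_variation sSuc s0 less_imp_le[OF d0])
          also have "\<dots> \<le> f (min (s m (Suc m)) (x + d m))" using u(1) by simp
          also have "\<dots> \<le> f (x + 1)" using m s0[of m "Suc m"] x d0[of m] by (intro f_le) auto
          also have "\<dots> \<le> C * (1 + (x + 1))\<^sup>2" using x by (intro growth) auto
          also have "\<dots> \<le> C * (3 * x)\<^sup>2"
          proof (intro mult_left_mono power_mono)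
            show "0 \<le> C" using growth[of 0] f_0 by simp
          qed (use x in auto)
          finally show "(\<Sum>i<Suc m. if s m i < x then f (s m (Suc i)) - f (s m i) else 0) \<le> C * (3 * x)\<^sup>2" .
        qed (use v0 in simp)
        also have "\<dots> = 9 * C * e\<^sup>2 * (v \<omega> * indicator E \<omega>)"
          using v0 True by (simp add: x_def power2_eq_square field_simps)
        finally show ?thesis .
      qed (simp add: a_def)
    qed
    also have "\<dots> = 9 * C * e\<^sup>2 * EvE" by (simp add: EvE_def)
    finally have S2le: "expectation (\<lambda>\<omega>. (S \<omega>)\<^sup>2) \<le> 9 * C * e\<^sup>2 * EvE" .
    have "expectation (\<lambda>\<omega>. v \<omega> * indicator (P m) \<omega>) \<le> expectation (\<lambda>\<omega>. 4 * (S \<omega>)\<^sup>2)"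
    proof (rule integral_mono)
      show "integrable M (\<lambda>\<omega>. v \<omega> * indicator (P m) \<omega>)" by (rule iv[OF PM PE])
      show "integrable M (\<lambda>\<omega>. 4 * (S \<omega>)\<^sup>2)" using S2i by simp
      fix \<omega> assume "\<omega> \<in> space M"
      show "v \<omega> * indicator (P m) \<omega> \<le> 4 * (S \<omega>)\<^sup>2"
      proof (cases "\<omega> \<in> P m")
        case True
        then obtain i where E: "\<omega> \<in> E" and i: "i \<le> Suc m" "s m i < e * v \<omega>" "g < level \<omega> (s m i)"
          by (auto simp: P_def)
        have v0: "0 < v \<omega>" using vE(4)[OF E] .
        define k where "k = (LEAST i. g < level \<omega> (s m i))"
        have k: "g < level \<omega> (s m k)" unfolding k_def by (rule LeastI[where P = "\<lambda>i. g < level \<omega> (s m i)", OF i(3)])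
        have ki: "k \<le> i" unfolding k_def by (rule Least_le[where P = "\<lambda>i. g < level \<omega> (s m i)", OF i(3)])
        have kx: "s m k < e * v \<omega>" using smono[OF ki, of m] i(2) by simp
        have below: "level \<omega> (s m j) \<le> g" if "j < k" for j
          using not_less_Least[of j "\<lambda>i. g < level \<omega> (s m i)"] that unfolding k_def by simp
        have a_eq: "a j \<omega> = (if j < k then 1 / sqrt (v \<omega>) else 0)" for j
        proof (cases "j < k")
          case True
          then have "s m j < e * v \<omega>" using smono[of j k m] kx by simp
          moreover have "\<forall>l\<le>j. level \<omega> (s m l) \<le> g" using below True by simp
          ultimately show ?thesis using True E by (simp add: a_def)
        next
          case False
          then have "\<not> (\<forall>l\<le>j. level \<omega> (s m l) \<le> g)" using k by (metis not_le not_less)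
          then show ?thesis using False by (simp add: a_def)
        qed
        have "S \<omega> = (\<Sum>j<Suc m. if j < k then 1 / sqrt (v \<omega>) * (B (f (s m (Suc j))) \<omega> - B (f (s m j)) \<omega>) else 0)"
          unfolding S_def a_eq by (rule sum.cong) auto
        also have "\<dots> = (\<Sum>j<k. 1 / sqrt (v \<omega>) * (B (f (s m (Suc j))) \<omega> - B (f (s m j)) \<omega>))"
          using ki i(1) by (intro sum.mono_neutral_cong_right) auto
        also have "\<dots> = 1 / sqrt (v \<omega>) * (\<Sum>j<k. B (f (s m (Suc j))) \<omega> - B (f (s m j)) \<omega>)"
          by (rule sum_distrib_left[symmetric])
        also have "(\<Sum>j<k. B (f (s m (Suc j))) \<omega> - B (f (s m j)) \<omega>) = B (f (s m k)) \<omega> - B (f (s m 0)) \<omega>"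
          by (rule sum_lessThan_telescope)
        finally have Seq: "S \<omega> = (B (f (s m k)) \<omega> - B (f R) \<omega>) / sqrt (v \<omega>)" by (simp add: s_def)
        have "\<nu> * B (f (s m k)) \<omega> < (1 + lam) * s m k" using k g by (simp add: level_def drifted_def)
        also have "\<dots> \<le> (1 + lam) * (e * v \<omega>)" using kx lam by (intro mult_left_mono) auto
        also have "\<dots> \<le> \<nu> / 2 * v \<omega>" using mult_right_mono[OF e(2), of "v \<omega>"] v0 by (simp add: mult.assoc)
        finally have "\<nu> * B (f (s m k)) \<omega> < \<nu> * (v \<omega> / 2)" by simp
        then have "B (f (s m k)) \<omega> < v \<omega> / 2" using \<nu>0 by simp
        then have drop: "v \<omega> / 2 \<le> B (f R) \<omega> - B (f (s m k)) \<omega>" using vE(2)[OF E] by simp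
        have "(v \<omega> / 2)\<^sup>2 \<le> (B (f R) \<omega> - B (f (s m k)) \<omega>)\<^sup>2" using drop v0 by (intro power_mono) auto
        then have "(v \<omega> / 2)\<^sup>2 / v \<omega> \<le> (B (f R) \<omega> - B (f (s m k)) \<omega>)\<^sup>2 / v \<omega>"
          using v0 by (intro divide_right_mono) auto
        also have "\<dots> = (S \<omega>)\<^sup>2" unfolding Seq using v0 by (simp add: power_divide power2_commute)
        finally have "v \<omega> / 4 \<le> (S \<omega>)\<^sup>2" using v0 by (simp add: power2_eq_square)
        then show ?thesis using True by simp
      qed simp
    qed
    also have "\<dots> = 4 * expectation (\<lambda>\<omega>. (S \<omega>)\<^sup>2)" by simp
    also have "\<dots> \<le> 36 * C * e\<^sup>2 * EvE" using S2le by linarith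
    also have "\<dots> \<le> EvE / 2"
    proof -
      have "0 \<le> EvE" unfolding EvE_def
        by (rule integral_nonneg_AE, rule AE_I2) (use vE(4) in \<open>auto simp: indicator_def less_imp_le\<close>)
      from mult_right_mono[OF e(3) this] show ?thesis by linarith
    qed
    finally show ?thesis .
  qed
  \<comment> \<open>The limit inferior of the grid events contains every path that passes before \<open>e v\<close>.\<close>
  define G where "G = (\<Union>n. \<Inter>m\<in>{n..}. P m)"
  have GM[measurable]: "G \<in> sets M" unfolding G_def by measurable
  have GE: "G \<subseteq> E" by (auto simp: G_def P_def)
  have d_lim: "\<forall>\<^sub>F m in sequentially. d m < r" if "0 < r" for r
  proof -
    have "d \<longlonglongrightarrow> 0" unfolding d_def using LIMSEQ_Suc[OF lim_const_over_n[of h]] by simp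
    then show ?thesis using that by (intro order_tendstoD)
  qed
  have "expectation (\<lambda>\<omega>. v \<omega> * indicator G \<omega>) \<le> EvE / 2"
  proof (rule tendsto_upperbound)
    show "(\<lambda>m. expectation (\<lambda>\<omega>. v \<omega> * indicator (P m \<inter> G) \<omega>)) \<longlonglongrightarrow> expectation (\<lambda>\<omega>. v \<omega> * indicator G \<omega>)"
    proof (rule integral_dominated_convergence[where w = "\<lambda>_. L"])
      show "AE \<omega> in M. (\<lambda>m. v \<omega> * indicator (P m \<inter> G) \<omega>) \<longlonglongrightarrow> v \<omega> * indicator G \<omega>"
      proof (rule AE_I2)
        fix \<omega>
        have "\<forall>\<^sub>F m in sequentially. v \<omega> * indicator (P m \<inter> G) \<omega> = v \<omega> * indicator G \<omega>"
        proof (cases "\<omega> \<in> G")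
          case True
          then obtain n where "\<And>m. n \<le> m \<Longrightarrow> \<omega> \<in> P m" by (auto simp: G_def)
          then show ?thesis using True by (intro eventually_mono[OF eventually_ge_at_top[of n]]) auto
        qed simp
        then show "(\<lambda>m. v \<omega> * indicator (P m \<inter> G) \<omega>) \<longlonglongrightarrow> v \<omega> * indicator G \<omega>" by (rule tendsto_eventually)
      qed
      show "AE \<omega> in M. norm (v \<omega> * indicator (P m \<inter> G) \<omega>) \<le> L" for m
        using vE(3,4) GE L0 by (intro AE_I2) (auto simp: indicator_def subset_iff less_imp_le)
    qed auto
    show "\<forall>\<^sub>F m in sequentially. expectation (\<lambda>\<omega>. v \<omega> * indicator (P m \<inter> G) \<omega>) \<le> EvE / 2"
      using d_lim[OF zero_less_one]
    proof (rule eventually_mono)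
      fix m assume "d m < 1"
      have "expectation (\<lambda>\<omega>. v \<omega> * indicator (P m \<inter> G) \<omega>) \<le> expectation (\<lambda>\<omega>. v \<omega> * indicator (P m) \<omega>)"
      proof (rule integral_mono)
        show "integrable M (\<lambda>\<omega>. v \<omega> * indicator (P m \<inter> G) \<omega>)" by (rule iv) (use GE PM GM in blast)+
        show "integrable M (\<lambda>\<omega>. v \<omega> * indicator (P m) \<omega>)" by (rule iv[OF PM PE])
        show "v \<omega> * indicator (P m \<inter> G) \<omega> \<le> v \<omega> * indicator (P m) \<omega>" for \<omega>
          using vE(4)[of \<omega>] GE by (cases "\<omega> \<in> G") (auto simp: indicator_def P_def)
      qed
      then show "expectation (\<lambda>\<omega>. v \<omega> * indicator (P m \<inter> G) \<omega>) \<le> EvE / 2"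
        using half[of m] \<open>d m < 1\<close> by simp
    qed
  qed simp
  moreover have "expectation (\<lambda>\<omega>. v \<omega> * indicator (E - G) \<omega>)
      \<le> (1 / e) * expectation (\<lambda>\<omega>. first_passage lam \<nu> f B g \<omega> * indicator \<Lambda> \<omega>)"
  proof -
    have i\<tau>: "integrable M (\<lambda>\<omega>. first_passage lam \<nu> f B g \<omega> * indicator \<Lambda> \<omega>)"
      by (rule integrable_mult_indicator[OF \<Lambda>M first_passage_integrable(1)[OF g], unfolded real_scaleR_def mult.commute[of "indicator _ _"]])
    have "expectation (\<lambda>\<omega>. v \<omega> * indicator (E - G) \<omega>)
      \<le> expectation (\<lambda>\<omega>. (1 / e) * (first_passage lam \<nu> f B g \<omega> * indicator \<Lambda> \<omega>))"
    proof (rule integral_mono_AE)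
      show "integrable M (\<lambda>\<omega>. v \<omega> * indicator (E - G) \<omega>)" by (rule iv) auto
      show "integrable M (\<lambda>\<omega>. (1 / e) * (first_passage lam \<nu> f B g \<omega> * indicator \<Lambda> \<omega>))"
        using i\<tau> by simp
      show "AE \<omega> in M. v \<omega> * indicator (E - G) \<omega> \<le> (1 / e) * (first_passage lam \<nu> f B g \<omega> * indicator \<Lambda> \<omega>)"
        using passes_AE[OF g] first_passage_integrable(3)[OF g] AE_space
      proof eventually_elim
        case (elim \<omega>)
        show ?case
        proof (cases "\<omega> \<in> E - G")
          case True
          have "\<not> first_passage lam \<nu> f B g \<omega> < e * v \<omega>"
          proof
            assume "first_passage lam \<nu> f B g \<omega> < e * v \<omega>"
            then obtain t where t: "0 \<le> t" "t < e * v \<omega>" "g < level \<omega> t"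
              using first_passage_less_iff[of g B \<omega> "e * v \<omega>"] elim(1) by (auto simp: level_def)
            have tR: "R < t" using t True by (force simp: E_def \<Lambda>_def)
            obtain r where r: "0 < r" "\<And>u. 0 \<le> u \<Longrightarrow> \<bar>u - t\<bar> < r \<Longrightarrow> g < level \<omega> u"
              using level_exceeded_nearby[OF continuous_level[OF elim(3)] t(1,3)] by metis
            have "\<forall>\<^sub>F m in sequentially. \<omega> \<in> P m"
              using d_lim[OF r(1)]
            proof (rule eventually_mono)
              fix m assume dm: "d m < r"
              define i where "i = nat \<lfloor>(t - R) / d m\<rfloor>"
              have nn: "0 \<le> (t - R) / d m" using tR d0[of m] by simp
              have "real i = of_int \<lfloor>(t - R) / d m\<rfloor>" using nn by (simp add: i_def)
              then have i: "real i \<le> (t - R) / d m" "(t - R) / d m < real i + 1" by linarith+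
              have le: "s m i \<le> t" and gt: "t < s m i + d m"
                using i d0[of m] by (auto simp: s_def field_simps)
              have "g < level \<omega> (s m i)" using le gt dm s0[of m i] by (intro r(2)) auto
              moreover have "s m i < e * v \<omega>" using le t by simp
              moreover have "i \<le> Suc m"
              proof (rule ccontr)
                assume "\<not> i \<le> Suc m"
                then have "s m (Suc m) \<le> s m i" by (intro smono) simp
                moreover have "e * v \<omega> \<le> e * L" using vE(3) True e by (intro mult_left_mono) auto
                ultimately show False using s_last[of m] le t by simp
              qed
              ultimately show "\<omega> \<in> P m" using True by (auto simp: P_def)
            qed
            then have "\<omega> \<in> G" by (auto simp: G_def eventually_sequentially)
            then show False using True by simp
          qed
          then have "v \<omega> \<le> (1 / e) * first_passage lam \<nu> f B g \<omega>" using e by (simp add: field_simps)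
          then show ?thesis using True by (simp add: E_def)
        next
          case False
          then show ?thesis using elim(2) e by simp
        qed
      qed
    qed
    then show ?thesis by simp
  qed
  moreover have "EvE = expectation (\<lambda>\<omega>. v \<omega> * indicator G \<omega>) + expectation (\<lambda>\<omega>. v \<omega> * indicator (E - G) \<omega>)"
  proof -
    have "v \<omega> * indicator E \<omega> = v \<omega> * indicator G \<omega> + v \<omega> * indicator (E - G) \<omega>" for \<omega>
      using GE by (auto simp: indicator_def)
    then show ?thesis unfolding EvE_def
      using iv[OF GM GE] iv[of "E - G"] by simp
  qed
  ultimately have "EvE \<le> (2 / e) * expectation (\<lambda>\<omega>. first_passage lam \<nu> f B g \<omega> * indicator \<Lambda> \<omega>)"
    by simp
  then show ?thesis unfolding EvE_def v_def .
qed

end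

context passage_bm
begin

lemma B_integrable: "0 \<le> t \<Longrightarrow> integrable M (B t)"
proof -
  assume t: "0 \<le> t"
  have "AE \<omega> in M. B t \<omega> - B 0 \<omega> = B t \<omega>" using B_0 by eventually_elim simp
  moreover have "integrable M (\<lambda>\<omega>. B t \<omega> - B 0 \<omega>)" by (rule increment_integrable(1)[OF order_refl t])
  ultimately show "integrable M (B t)"
    using integrable_cong_AE[of "\<lambda>\<omega>. B t \<omega> - B 0 \<omega>" M "B t"] B_measurable[OF t] B_measurable[of 0] by auto
qed

lemma high_value_bound_unbounded:
  assumes g: "0 \<le> g" and \<nu>0: "0 < \<nu>"
    and e: "0 < e" "(1 + lam) * e \<le> \<nu> / 2" "72 * C * e\<^sup>2 \<le> 1"
    and R: "1 \<le> R"
  defines "\<Lambda> \<equiv> {\<omega> \<in> space M. \<forall>s\<in>{0..R}. level \<omega> s \<le> g}"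
  defines "E \<equiv> {\<omega> \<in> \<Lambda>. R \<le> e * B (f R) \<omega>}"
  shows "expectation (\<lambda>\<omega>. B (f R) \<omega> * indicator E \<omega>)
    \<le> (2 / e) * expectation (\<lambda>\<omega>. first_passage lam \<nu> f B g \<omega> * indicator \<Lambda> \<omega>)"
    and "E \<in> sets M" "\<Lambda> \<in> sets M"
proof -
  have R0: "0 \<le> R" "0 < R" using R by auto
  have BM: "B (f R) \<in> borel_measurable M" and Bi: "integrable M (B (f R))"
    using B_measurable B_integrable f_nonneg[OF R0(1)] by auto
  show \<Lambda>M: "\<Lambda> \<in> sets M" unfolding \<Lambda>_def
    using stays_sets[OF R0(2), of g] subalg[of "f R"] by (auto simp: subalgebra_def)
  have "E = \<Lambda> \<inter> {\<omega> \<in> space M. R \<le> e * B (f R) \<omega>}" by (auto simp: E_def \<Lambda>_def)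
  moreover have "{\<omega> \<in> space M. R \<le> e * B (f R) \<omega>} \<in> sets M" using BM by measurable
  ultimately show EM: "E \<in> sets M" using \<Lambda>M by auto
  show "expectation (\<lambda>\<omega>. B (f R) \<omega> * indicator E \<omega>)
    \<le> (2 / e) * expectation (\<lambda>\<omega>. first_passage lam \<nu> f B g \<omega> * indicator \<Lambda> \<omega>)"
  proof (rule tendsto_upperbound)
    show "(\<lambda>n. expectation (\<lambda>\<omega>. min (B (f R) \<omega>) (real n) * indicator E \<omega>))
        \<longlonglongrightarrow> expectation (\<lambda>\<omega>. B (f R) \<omega> * indicator E \<omega>)"
    proof (rule integral_dominated_convergence[where w = "\<lambda>\<omega>. \<bar>B (f R) \<omega>\<bar>"])
      show "AE \<omega> in M. (\<lambda>n. min (B (f R) \<omega>) (real n) * indicator E \<omega>) \<longlonglongrightarrow> B (f R) \<omega> * indicator E \<omega>"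
      proof (rule AE_I2)
        fix \<omega>
        obtain n :: nat where "B (f R) \<omega> \<le> real n" using real_arch_simple by blast
        then have "\<forall>\<^sub>F n in sequentially. min (B (f R) \<omega>) (real n) * indicator E \<omega> = B (f R) \<omega> * indicator E \<omega>"
          by (intro eventually_mono[OF eventually_ge_at_top[of n]]) (auto simp: min_def)
        then show "(\<lambda>n. min (B (f R) \<omega>) (real n) * indicator E \<omega>) \<longlonglongrightarrow> B (f R) \<omega> * indicator E \<omega>"
          by (rule tendsto_eventually)
      qed
    qed (use BM Bi EM in \<open>auto simp: indicator_def\<close>)
    obtain n0 :: nat where n0: "R / e \<le> real n0" using real_arch_simple by blast
    show "\<forall>\<^sub>F n in sequentially. expectation (\<lambda>\<omega>. min (B (f R) \<omega>) (real n) * indicator E \<omega>)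
      \<le> (2 / e) * expectation (\<lambda>\<omega>. first_passage lam \<nu> f B g \<omega> * indicator \<Lambda> \<omega>)"
      using eventually_ge_at_top[of n0]
    proof (rule eventually_mono)
      fix n assume "n0 \<le> n"
      then have "R / e \<le> real n" using n0 by linarith
      then have "R \<le> e * real n" using e by (simp add: field_simps)
      from high_value_bound[OF g \<nu>0 e R this]
      show "expectation (\<lambda>\<omega>. min (B (f R) \<omega>) (real n) * indicator E \<omega>)
        \<le> (2 / e) * expectation (\<lambda>\<omega>. first_passage lam \<nu> f B g \<omega> * indicator \<Lambda> \<omega>)"
        unfolding E_def \<Lambda>_def .
    qed
  qed simp
qed

text \<open>
  Values of Brownian motion below \<open>R / e\<close> are dominated by the passage time itself, which is at least
  \<open>R\<close> on the event considered. The higher values are covered by the preceding estimate.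
\<close>

lemma late_martingale_bound:
  assumes g: "0 \<le> g"
  shows "\<exists>c\<ge>0. \<forall>R\<ge>1.
    \<nu> * expectation (\<lambda>\<omega>. max 0 (B (f R) \<omega>) * indicator {\<omega> \<in> space M. \<forall>s\<in>{0..R}. level \<omega> s \<le> g} \<omega>)
    \<le> c * expectation (\<lambda>\<omega>. first_passage lam \<nu> f B g \<omega> * indicator {\<omega> \<in> space M. \<forall>s\<in>{0..R}. level \<omega> s \<le> g} \<omega>)"
proof (cases "\<nu> = 0")
  case True
  then show ?thesis by (intro exI[of _ 0]) auto
next
  case False
  then have \<nu>0: "0 < \<nu>" using \<nu> by simp
  have C0: "0 \<le> C" using growth[of 0] f_0 by simp
  \<comment> \<open>The two terms ensure \<open>(1 + lam) e \<le> \<nu> / 2\<close> and \<open>72 C e\<^sup>2 \<le> 1\<close>.\<close>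
  define e where "e = min (\<nu> / (2 * (1 + lam))) (1 / (9 * sqrt (C + 1)))"
  have e0: "0 < e" using \<nu>0 lam C0 by (simp add: e_def)
  have "(1 + lam) * e \<le> (1 + lam) * (\<nu> / (2 * (1 + lam)))"
    using lam by (intro mult_left_mono) (auto simp: e_def)
  also have "\<dots> = \<nu> / 2" using lam by (simp add: field_simps)
  finally have e1: "(1 + lam) * e \<le> \<nu> / 2" .
  have "e\<^sup>2 \<le> (1 / (9 * sqrt (C + 1)))\<^sup>2" using e0 by (intro power_mono) (auto simp: e_def)
  also have "\<dots> = 1 / (81 * (C + 1))" using C0 by (simp add: power_divide power_mult_distrib)
  finally have "72 * C * e\<^sup>2 \<le> 72 * C * (1 / (81 * (C + 1)))" using C0 by (intro mult_left_mono) auto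
  also have "\<dots> \<le> 1" using C0 by (simp add: field_simps)
  finally have e2: "72 * C * e\<^sup>2 \<le> 1" .
  show ?thesis
  proof (rule exI[of _ "\<nu> * (3 / e)"], intro conjI allI impI)
    fix R :: real assume R: "1 \<le> R"
    define \<Lambda> where "\<Lambda> = {\<omega> \<in> space M. \<forall>s\<in>{0..R}. level \<omega> s \<le> g}"
    define E where "E = {\<omega> \<in> \<Lambda>. R \<le> e * B (f R) \<omega>}"
    note H = high_value_bound_unbounded[OF g \<nu>0 e0 e1 e2 R, folded \<Lambda>_def, folded E_def]
    have BM: "B (f R) \<in> borel_measurable M" and Bi: "integrable M (B (f R))"
      using B_measurable B_integrable f_nonneg[of R] R by auto
    let ?t = "\<lambda>\<omega>. first_passage lam \<nu> f B g \<omega> * indicator \<Lambda> \<omega>"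
    have it: "integrable M ?t"
      by (rule integrable_mult_indicator[OF H(3) first_passage_integrable(1)[OF g], unfolded real_scaleR_def mult.commute[of "indicator _ _"]])
    have iBE: "integrable M (\<lambda>\<omega>. B (f R) \<omega> * indicator E \<omega>)"
      by (rule integrable_mult_indicator[OF H(2) Bi, unfolded real_scaleR_def mult.commute[of "indicator _ _"]])
    have iBp: "integrable M (\<lambda>\<omega>. max 0 (B (f R) \<omega>) * indicator \<Lambda> \<omega>)"
      by (rule integrable_mult_indicator[OF H(3) integrable_max[OF _ Bi], unfolded real_scaleR_def mult.commute[of "indicator _ _"]]) simp
    have "expectation (\<lambda>\<omega>. max 0 (B (f R) \<omega>) * indicator \<Lambda> \<omega>)
      \<le> expectation (\<lambda>\<omega>. (1 / e) * ?t \<omega> + B (f R) \<omega> * indicator E \<omega>)"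
    proof (rule integral_mono_AE)
      show "AE \<omega> in M. max 0 (B (f R) \<omega>) * indicator \<Lambda> \<omega> \<le> (1 / e) * ?t \<omega> + B (f R) \<omega> * indicator E \<omega>"
        using passes_AE[OF g] first_passage_integrable(3)[OF g]
      proof eventually_elim
        case (elim \<omega>)
        show ?case
        proof (cases "\<omega> \<in> \<Lambda>")
          case True
          have tR: "R \<le> first_passage lam \<nu> f B g \<omega>"
          proof (rule ccontr)
            assume "\<not> R \<le> first_passage lam \<nu> f B g \<omega>"
            then obtain s where "0 \<le> s" "s < R" "g < level \<omega> s"
              using first_passage_less_iff[of g B \<omega> R] elim(1) by (auto simp: level_def)
            then show False using True by (force simp: \<Lambda>_def)
          qed
          show ?thesis
          proof (cases "\<omega> \<in> E")
            case E: True
            then have "R \<le> e * B (f R) \<omega>" by (simp add: E_def)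
            then have "0 < e * B (f R) \<omega>" using R by linarith
            then have "0 < B (f R) \<omega>" using e0 by (simp add: zero_less_mult_iff)
            then show ?thesis using E True elim(2) e0 by simp
          next
            case False
            then have "e * B (f R) \<omega> \<le> first_passage lam \<nu> f B g \<omega>" using True tR by (simp add: E_def)
            then have "B (f R) \<omega> \<le> first_passage lam \<nu> f B g \<omega> / e" using e0 by (simp add: field_simps)
            then show ?thesis using False True elim(2) e0 by simp
          qed
        next
          case False
          then show ?thesis by (simp add: E_def)
        qed
      qed
    qed (use it iBE iBp in auto)
    also have "\<dots> = (1 / e) * expectation ?t + expectation (\<lambda>\<omega>. B (f R) \<omega> * indicator E \<omega>)"
      using it iBE by simp
    also have "\<dots> \<le> (1 / e) * expectation ?t + (2 / e) * expectation ?t" using H(1) by simp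
    also have "\<dots> = (3 / e) * expectation ?t" by (simp add: field_simps)
    finally have "\<nu> * expectation (\<lambda>\<omega>. max 0 (B (f R) \<omega>) * indicator \<Lambda> \<omega>) \<le> \<nu> * ((3 / e) * expectation ?t)"
      using \<nu>0 by (intro mult_left_mono) auto
    then show "\<nu> * expectation (\<lambda>\<omega>. max 0 (B (f R) \<omega>) * indicator {\<omega> \<in> space M. \<forall>s\<in>{0..R}. level \<omega> s \<le> g} \<omega>)
      \<le> \<nu> * (3 / e) * expectation (\<lambda>\<omega>. first_passage lam \<nu> f B g \<omega> * indicator {\<omega> \<in> space M. \<forall>s\<in>{0..R}. level \<omega> s \<le> g} \<omega>)"
      unfolding \<Lambda>_def by (simp only: mult.assoc)
  qed (use \<nu>0 e0 in simp)
qed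

text \<open>
  At the capped passage time the drifted path is at the level \<open>g\<close> unless the cap is reached. Its mean is
  \<open>(1 + lam)\<close> times the mean of the capped time, and the contribution of the cap is bounded by the mean
  of the passage time over paths that stay below the level up to \<open>R\<close>; it vanishes as \<open>R\<close> grows.
\<close>

lemma first_passage_expectation_ge:
  assumes g: "0 \<le> g"
  shows "g \<le> (1 + lam) * expectation (first_passage lam \<nu> f B g)"
proof -
  let ?\<tau> = "first_passage lam \<nu> f B g"
  define \<Lambda> where "\<Lambda> R = {\<omega> \<in> space M. \<forall>s\<in>{0..R}. level \<omega> s \<le> g}" for R
  obtain c where c: "0 \<le> c" "\<And>R. 1 \<le> R \<Longrightarrow> \<nu> * expectation (\<lambda>\<omega>. max 0 (B (f R) \<omega>) * indicator (\<Lambda> R) \<omega>)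
    \<le> c * expectation (\<lambda>\<omega>. ?\<tau> \<omega> * indicator (\<Lambda> R) \<omega>)"
    using late_martingale_bound[OF g] unfolding \<Lambda>_def by blast
  note i\<tau> = first_passage_integrable[OF g]
  have \<Lambda>M: "\<Lambda> R \<in> sets M" if "0 < R" for R
    unfolding \<Lambda>_def using stays_sets[OF that, of g] subalg[of "f R"] by (auto simp: subalgebra_def)
  have key: "g - (g + c) * expectation (\<lambda>\<omega>. ?\<tau> \<omega> * indicator (\<Lambda> R) \<omega>) \<le> (1 + lam) * expectation ?\<tau>"
    if R: "1 \<le> R" for R
  proof -
    have R0: "0 < R" using R by simp
    let ?\<theta> = "\<lambda>\<omega>. capped_passage (level \<omega>) g R"
    let ?t = "\<lambda>\<omega>. ?\<tau> \<omega> * indicator (\<Lambda> R) \<omega>"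
    have Bi: "integrable M (B (f R))" using B_integrable f_nonneg[of R] R by auto
    have it: "integrable M ?t"
      by (rule integrable_mult_indicator[OF \<Lambda>M[OF R0] i\<tau>(1), unfolded real_scaleR_def mult.commute[of "indicator _ _"]])
    have iBp: "integrable M (\<lambda>\<omega>. max 0 (B (f R) \<omega>) * indicator (\<Lambda> R) \<omega>)"
      by (rule integrable_mult_indicator[OF \<Lambda>M[OF R0] integrable_max[OF _ Bi], unfolded real_scaleR_def mult.commute[of "indicator _ _"]]) simp
    have "g - g * expectation ?t - \<nu> * expectation (\<lambda>\<omega>. max 0 (B (f R) \<omega>) * indicator (\<Lambda> R) \<omega>)
      = expectation (\<lambda>\<omega>. g - g * ?t \<omega> - \<nu> * (max 0 (B (f R) \<omega>) * indicator (\<Lambda> R) \<omega>))"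
      using it iBp by (simp add: prob_space)
    also have "\<dots> \<le> expectation (\<lambda>\<omega>. level \<omega> (?\<theta> \<omega>))"
    proof (rule integral_mono_AE)
      show "integrable M (\<lambda>\<omega>. level \<omega> (?\<theta> \<omega>))" by (rule level_at_capped(1)[OF g R0])
      show "AE \<omega> in M. g - g * ?t \<omega> - \<nu> * (max 0 (B (f R) \<omega>) * indicator (\<Lambda> R) \<omega>) \<le> level \<omega> (?\<theta> \<omega>)"
        using passes_AE[OF g] i\<tau>(3) level_0 AE_space
      proof eventually_elim
        case (elim \<omega>)
        note y = continuous_level[OF elim(4)]
        show ?case
        proof (cases "\<omega> \<in> \<Lambda> R")
          case True
          then have \<theta>: "?\<theta> \<omega> = R"
            using capped_passage_eq_iff[OF y R0, of g] elim(3) g by (simp add: \<Lambda>_def)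
          have "R \<le> ?\<tau> \<omega>"
            using capped_eq_min[OF g elim(4,1), of R] \<theta> R0 by simp
          then have "g * 1 \<le> g * ?\<tau> \<omega>" using R g by (intro mult_left_mono) auto
          moreover have "\<nu> * B (f R) \<omega> \<le> \<nu> * max 0 (B (f R) \<omega>)" using \<nu> by (intro mult_left_mono) auto
          moreover have "0 \<le> (1 + lam) * R" using lam R0 by simp
          ultimately show ?thesis unfolding \<theta> using True by (simp add: level_def drifted_def)
        next
          case False
          then have "?\<theta> \<omega> < R"
            using capped_passage_eq_iff[OF y R0, of g] elim(3,4) g capped_bounds(2)[OF g elim(4), of R] R0
            by (auto simp: \<Lambda>_def less_le)
          then have "g \<le> level \<omega> (?\<theta> \<omega>)" using at_capped_passage_ge[OF y, of R g] R0 by simp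
          then show ?thesis using False by simp
        qed
      qed
    qed (use it iBp in auto)
    also have "\<dots> = (1 + lam) * expectation ?\<theta>" by (rule level_at_capped(2)[OF g R0])
    also have "\<dots> \<le> (1 + lam) * expectation ?\<tau>"
    proof (rule mult_left_mono)
      show "expectation ?\<theta> \<le> expectation ?\<tau>"
      proof (rule integral_mono_AE[OF capped_integrable[OF g R0] i\<tau>(1)])
        show "AE \<omega> in M. ?\<theta> \<omega> \<le> ?\<tau> \<omega>"
          using passes_AE[OF g] AE_space
        proof eventually_elim
          case (elim \<omega>)
          then show ?case using capped_eq_min[OF g elim(2,1), of R] R0 by simp
        qed
      qed
    qed (use lam in simp)
    finally show ?thesis using c(2)[OF R] by (simp add: algebra_simps)
  qed
  have lim: "(\<lambda>n. expectation (\<lambda>\<omega>. ?\<tau> \<omega> * indicator (\<Lambda> (real (Suc n))) \<omega>)) \<longlonglongrightarrow> expectation (\<lambda>\<omega>. 0)"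
  proof (rule integral_dominated_convergence[where w = "\<lambda>\<omega>. \<bar>?\<tau> \<omega>\<bar>"])
    show "AE \<omega> in M. (\<lambda>n. ?\<tau> \<omega> * indicator (\<Lambda> (real (Suc n))) \<omega>) \<longlonglongrightarrow> 0"
      using passes_AE[OF g]
    proof eventually_elim
      case (elim \<omega>)
      then obtain s where s: "0 \<le> s" "g < level \<omega> s" by auto
      obtain n0 :: nat where n0: "s \<le> real n0" using real_arch_simple by blast
      have "\<forall>\<^sub>F n in sequentially. ?\<tau> \<omega> * indicator (\<Lambda> (real (Suc n))) \<omega> = 0"
        using eventually_ge_at_top[of n0]
      proof (rule eventually_mono)
        fix n assume "n0 \<le> n"
        then have "s \<in> {0..real (Suc n)}" using n0 s by simp
        then have "\<omega> \<notin> \<Lambda> (real (Suc n))" using s(2) unfolding \<Lambda>_def by force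
        then show "?\<tau> \<omega> * indicator (\<Lambda> (real (Suc n))) \<omega> = 0" by simp
      qed
      then show ?case by (rule tendsto_eventually)
    qed
    show "(\<lambda>\<omega>. ?\<tau> \<omega> * indicator (\<Lambda> (real (Suc n))) \<omega>) \<in> borel_measurable M" for n
      by (intro borel_measurable_times borel_measurable_indicator \<Lambda>M) (use i\<tau>(1) in auto)
  qed (use i\<tau>(1) in \<open>auto simp: indicator_def\<close>)
  have "(\<lambda>n. g - (g + c) * expectation (\<lambda>\<omega>. ?\<tau> \<omega> * indicator (\<Lambda> (real (Suc n))) \<omega>)) \<longlonglongrightarrow> g - (g + c) * expectation (\<lambda>\<omega>. 0)"
    by (intro tendsto_intros lim)
  then have "(\<lambda>n. g - (g + c) * expectation (\<lambda>\<omega>. ?\<tau> \<omega> * indicator (\<Lambda> (real (Suc n))) \<omega>)) \<longlonglongrightarrow> g" by simp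
  then show ?thesis by (rule LIMSEQ_le_const2) (use key in auto)
qed

lemma first_passage_mean:
  shows "AE \<omega> in M. \<exists>s\<ge>0. g < level \<omega> s"
    "integrable M (first_passage lam \<nu> f B g)"
    "expectation (first_passage lam \<nu> f B g) = max 0 g / (1 + lam)"
    "AE \<omega> in M. 0 \<le> first_passage lam \<nu> f B g \<omega>"
proof -
  let ?\<tau> = "first_passage lam \<nu> f B g"
  have "(AE \<omega> in M. \<exists>s\<ge>0. g < level \<omega> s) \<and> integrable M ?\<tau> \<and> expectation ?\<tau> = max 0 g / (1 + lam)
    \<and> (AE \<omega> in M. 0 \<le> ?\<tau> \<omega>)"
  proof (cases "0 \<le> g")
    case True
    have "expectation ?\<tau> = g / (1 + lam)"
      using first_passage_integrable(2)[OF True] first_passage_expectation_ge[OF True] lam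
      by (simp add: field_simps)
    then show ?thesis using passes_AE[OF True] first_passage_integrable[OF True] True by simp
  next
    case False
    have m: "?\<tau> \<in> borel_measurable M" using first_passage_measurable[OF B_measurable continuous_B] by auto
    have pass: "AE \<omega> in M. \<exists>s\<ge>0. g < level \<omega> s" 
      using level_0
    proof eventually_elim
      case (elim \<omega>)
      then show ?case using False by (intro exI[of _ 0]) simp
    qed
    have z: "AE \<omega> in M. ?\<tau> \<omega> = 0"
      using level_0
    proof eventually_elim
      case (elim \<omega>)
      then have "g < drifted (\<lambda>t. B t \<omega>) 0" using False by (simp add: level_def)
      then have "?\<tau> \<omega> \<le> 0" "0 \<le> ?\<tau> \<omega>" using first_passage_le[of 0 g B \<omega>] first_passage_nonneg[of g B \<omega>] by auto
      then show ?case by simp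
    qed
    have "integrable M ?\<tau>" "expectation ?\<tau> = 0"
      using integrable_cong_AE[OF m _ z] integral_cong_AE[OF m _ z] by auto
    then show ?thesis using pass z False by (auto elim: AE_mp)
  qed
  then show "AE \<omega> in M. \<exists>s\<ge>0. g < level \<omega> s" "integrable M ?\<tau>"
    "expectation ?\<tau> = max 0 g / (1 + lam)" "AE \<omega> in M. 0 \<le> ?\<tau> \<omega>" by auto
qed

end

section \<open>Convolution with a probability kernel\<close>

locale prob_kernel =
  fixes K :: "real \<Rightarrow> real"
  assumes K_nonneg: "\<And>x. 0 \<le> x \<Longrightarrow> 0 \<le> K x"
    and K_integrable: "set_integrable lborel {0..} K"
    and K_integral: "(LINT x:{0..}|lborel. K x) = 1"
begin

definition kern :: "real \<Rightarrow> real" where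
  "kern u = indicator {0..} u * K u"

lemma kern_nonneg: "0 \<le> kern u"
  using K_nonneg by (simp add: kern_def indicator_def)

lemma kern_integrable: "integrable lborel kern"
  using K_integrable unfolding set_integrable_def kern_def real_scaleR_def .

lemma kern_measurable [measurable]: "kern \<in> borel_measurable borel"
  using borel_measurable_integrable[OF kern_integrable] by simp

lemma kern_integral: "integral\<^sup>L lborel kern = 1"
  using K_integral unfolding set_lebesgue_integral_def kern_def real_scaleR_def .

lemma kern_times_integrable:
  assumes "g \<in> borel_measurable borel" "\<And>u. 0 \<le> u \<Longrightarrow> \<bar>g u\<bar> \<le> C"
  shows "integrable lborel (\<lambda>u. kern u * g u)"
proof (rule Bochner_Integration.integrable_bound)
  show "integrable lborel (\<lambda>u. C * kern u)" using kern_integrable by simp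
  show "AE u in lborel. norm (kern u * g u) \<le> norm (C * kern u)"
  proof (rule AE_I2)
    fix u
    show "norm (kern u * g u) \<le> norm (C * kern u)"
    proof (cases "0 \<le> u")
      case True
      have "kern u * \<bar>g u\<bar> \<le> kern u * \<bar>C\<bar>"
        using assms(2)[OF True] kern_nonneg[of u] by (intro mult_left_mono) auto
      then show ?thesis using kern_nonneg[of u] by (simp add: abs_mult mult.commute)
    qed (simp add: kern_def)
  qed
qed (use assms(1) in simp)

text \<open>
  The integrand of a convolution at time \<open>s\<close> as a function of the time lag \<open>u\<close>; in this form the kernel
  does not depend on \<open>s\<close>.
\<close>

definition lag :: "real \<Rightarrow> (real \<Rightarrow> real) \<Rightarrow> real \<Rightarrow> real" where
  "lag s h u = indicator {0..s} u * h (s - u)"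

lemma lag_measurable:
  assumes "continuous_on {0..s} h"
  shows "lag s h \<in> borel_measurable borel"
proof -
  have "continuous_on {0..s} (\<lambda>u. h (s - u))"
    by (rule continuous_on_compose2[OF assms]) (auto intro!: continuous_intros)
  from borel_measurable_continuous_on_indicator[OF _ this] show ?thesis
    by (simp add: lag_def[abs_def])
qed

lemma convolution_eq: "(LINT r:{0..s}|lborel. K (s - r) * h r) = (\<integral>u. kern u * lag s h u \<partial>lborel)"
proof -
  have "(LINT r:{0..s}|lborel. K (s - r) * h r) = (\<integral>r. indicator {0..s} r * (K (s - r) * h r) \<partial>lborel)"
    by (simp add: set_lebesgue_integral_def)
  also have "\<dots> = \<bar>-1\<bar> *\<^sub>R (\<integral>u. indicator {0..s} (s + (-1) * u) * (K (s - (s + (-1) * u)) * h (s + (-1) * u)) \<partial>lborel)"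
    by (rule lborel_integral_real_affine) simp
  also have "\<dots> = (\<integral>u. kern u * lag s h u \<partial>lborel)"
    by (simp, rule Bochner_Integration.integral_cong) (auto simp: kern_def lag_def indicator_def)
  finally show ?thesis .
qed

lemma lag_integrable:
  assumes "continuous_on {0..s} h"
  shows "integrable lborel (\<lambda>u. kern u * lag s h u)"
proof -
  have "compact (h ` {0..s})" by (intro compact_continuous_image assms) auto
  then obtain C where C: "\<forall>x\<in>h ` {0..s}. norm x \<le> C" using compact_imp_bounded bounded_iff by metis
  show ?thesis
  proof (rule kern_times_integrable[OF lag_measurable[OF assms]])
    fix u
    show "\<bar>lag s h u\<bar> \<le> max 0 C"
    proof (cases "u \<in> {0..s}")
      case True
      then have "\<bar>h (s - u)\<bar> \<le> C" using C by auto
      then show ?thesis using True by (simp add: lag_def)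
    qed (simp add: lag_def)
  qed
qed

definition mass :: "real \<Rightarrow> real" where
  "mass d = (\<integral>u. kern u * indicator {..d} u \<partial>lborel)"

lemma mass_integrable: "integrable lborel (\<lambda>u. kern u * indicator {..d} u)"
  by (rule kern_times_integrable[of _ 1]) (auto simp: indicator_def)

lemma mass_bounds: "0 \<le> mass d" "mass d \<le> 1"
proof -
  show "0 \<le> mass d" unfolding mass_def
    by (rule integral_nonneg_AE) (use kern_nonneg in auto)
  have "mass d \<le> integral\<^sup>L lborel kern" unfolding mass_def
    by (rule integral_mono[OF mass_integrable kern_integrable])
      (use kern_nonneg in \<open>auto simp: indicator_def\<close>)
  then show "mass d \<le> 1" by (simp add: kern_integral)
qed

lemma mass_tendsto: "(mass \<longlongrightarrow> 1) at_top"
proof -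
  have "((\<lambda>d. mass d) \<longlongrightarrow> integral\<^sup>L lborel kern) at_top"
    unfolding mass_def
  proof (rule integral_dominated_convergence_at_top[where w = kern])
    show "AE u in lborel. ((\<lambda>d. kern u * indicator {..d} u) \<longlongrightarrow> kern u) at_top"
    proof (rule AE_I2)
      fix u
      have "\<forall>\<^sub>F d in at_top. kern u * indicator {..d} u = kern u"
        using eventually_ge_at_top[of u] by eventually_elim simp
      then show "((\<lambda>d. kern u * indicator {..d} u) \<longlongrightarrow> kern u) at_top" by (rule tendsto_eventually)
    qed
    show "\<forall>\<^sub>F d in at_top. AE u in lborel. norm (kern u * indicator {..d} u) \<le> kern u"
      by (rule always_eventually) (use kern_nonneg in \<open>auto simp: indicator_def abs_mult\<close>)
  qed (use kern_integrable in auto)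
  then show ?thesis by (simp add: kern_integral)
qed

text \<open>
  Suppose that \<open>h\<close> exceeds \<open>x - G a + e\<close> on all of \<open>[a, b]\<close>. Apart from the small mass beyond \<open>L\<close>, the
  convolution then averages values that are at least \<open>x (s - L) - G a + e\<close>, and so \<open>x\<close> grows by
  \<open>e / 2\<close> over every period of length \<open>L\<close>. A bounded function cannot do this over a long interval.
\<close>

lemma delayed_growth:
  assumes eq: "\<And>s. 0 \<le> s \<Longrightarrow> s \<le> b \<Longrightarrow> x s = G s + (LINT r:{0..s}|lborel. K (s - r) * h r)"
    and h: "continuous_on {0..b} h" "\<And>r. r \<in> {0..b} \<Longrightarrow> \<bar>h r\<bar> \<le> C"
    and x: "mono_on {0..b} x" "0 \<le> x 0" "x b \<le> R"
    and G: "mono_on {0..b} G" "0 \<le> G a"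
    and small: "(1 - mass L) * (R + e + C) \<le> e / 2" and e: "0 < e" and L: "0 \<le> L" and a: "0 \<le> a"
    and k: "a + real k * L \<le> b" "R < real k * (e / 2)"
  shows "\<exists>s\<in>{a..b}. h s \<le> x s - G a + e"
proof (rule ccontr)
  assume "\<not> (\<exists>s\<in>{a..b}. h s \<le> x s - G a + e)"
  then have big: "x s - G a + e < h s" if "s \<in> {a..b}" for s using that by force
  have ab: "a \<le> b" using k(1) L by (smt (verit) mult_nonneg_nonneg of_nat_0_le_iff)
  have xm: "x s \<le> x t" if "0 \<le> s" "s \<le> t" "t \<le> b" for s t
    using x(1) that by (auto simp: mono_on_def)
  have C0: "0 \<le> C" using h(2)[of a] a ab by force
  have step: "x (s - L) + e / 2 \<le> x s" if s: "a + L \<le> s" "s \<le> b" for s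
  proof -
    have s0: "0 \<le> s" "s - L \<le> s" "0 \<le> s - L" using s a L by auto
    define D where "D = x (s - L) - G a + e"
    have hc: "continuous_on {0..s} h" by (rule continuous_on_subset[OF h(1)]) (use s in auto)
    let ?g = "\<lambda>u. if u \<le> L then D else - C"
    have gi: "integrable lborel (\<lambda>u. kern u * ?g u)"
      by (rule kern_times_integrable[of _ "max \<bar>D\<bar> \<bar>C\<bar>"]) auto
    have "(\<integral>u. kern u * ?g u \<partial>lborel) \<le> (\<integral>u. kern u * lag s h u \<partial>lborel)"
    proof (rule integral_mono[OF gi lag_integrable[OF hc]])
      fix u
      show "kern u * ?g u \<le> kern u * lag s h u"
      proof (cases "0 \<le> u")
        case True
        have "?g u \<le> lag s h u"
        proof (cases "u \<le> L")
          case uL: True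
          have "D \<le> x (s - u) - G a + e" using xm[of "s - L" "s - u"] s s0 uL True by (simp add: D_def)
          also have "\<dots> \<le> h (s - u)" using big[of "s - u"] s uL True by auto
          finally show ?thesis using uL True s a by (simp add: lag_def)
        next
          case False
          then show ?thesis using h(2)[of "s - u"] True s C0 by (auto simp: lag_def indicator_def)
        qed
        then show ?thesis using kern_nonneg[of u] by (intro mult_left_mono) auto
      qed (simp add: kern_def)
    qed
    also have "(\<integral>u. kern u * ?g u \<partial>lborel) = (\<integral>u. (D + C) * (kern u * indicator {..L} u) - C * kern u \<partial>lborel)"
      by (rule Bochner_Integration.integral_cong) (auto simp: indicator_def algebra_simps)
    also have "\<dots> = (D + C) * mass L - C"
      using mass_integrable kern_integrable by (simp add: mass_def kern_integral)
    finally have "G s + ((D + C) * mass L - C) \<le> x s" using eq[of s] s s0 by (simp add: convolution_eq)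
    moreover have "G a \<le> G s" using G(1) a s L by (auto simp: mono_on_def)
    moreover have "G a * mass L \<le> G a" using G(2) mass_bounds[of L] by (simp add: mult_left_le)
    moreover have "(1 - mass L) * (x (s - L) + e + C) \<le> (1 - mass L) * (R + e + C)"
      using xm[of "s - L" b] x(3) s s0 mass_bounds[of L] by (intro mult_left_mono) auto
    ultimately show ?thesis using small by (simp add: D_def algebra_simps)
  qed
  have "real j * (e / 2) \<le> x (a + real j * L)" if "j \<le> k" for j
    using that
  proof (induction j)
    case 0
    then show ?case using xm[of 0 a] x(2) a ab by simp
  next
    case (Suc j)
    have le: "a + real (Suc j) * L \<le> b"
    proof -
      have "real (Suc j) * L \<le> real k * L" using Suc.prems L by (intro mult_right_mono) auto
      then show ?thesis using k(1) by simp
    qed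
    have "x (a + real (Suc j) * L - L) + e / 2 \<le> x (a + real (Suc j) * L)"
      by (rule step) (use le L in \<open>auto simp: algebra_simps\<close>)
    moreover have "a + real (Suc j) * L - L = a + real j * L" by (simp add: algebra_simps)
    ultimately show ?case using Suc by (simp add: algebra_simps)
  qed
  from this[of k] have "real k * (e / 2) \<le> x (a + real k * L)" by simp
  also have "\<dots> \<le> x b" using k(1) a L by (intro xm) auto
  finally show False using k(2) x(3) by simp
qed

end

section \<open>Weak solutions\<close>

text \<open>
  Conditioning preserves the mean and contracts the \<open>L\<^sup>1\<close> norm.
\<close>

lemma (in prob_space) integral_abs_cond_exp_le:
  assumes sub: "subalgebra M F" and Y: "integrable M Y" and Z[measurable]: "Z \<in> borel_measurable M"
    and eq: "AE \<omega> in M. real_cond_exp M F Y \<omega> = Z \<omega>"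
  shows "integrable M Z" "expectation Z = expectation Y" "expectation (\<lambda>\<omega>. \<bar>Z \<omega>\<bar>) \<le> expectation (\<lambda>\<omega>. \<bar>Y \<omega>\<bar>)"
proof -
  interpret finite_measure_subalgebra M F by unfold_locales (rule sub)
  have [measurable]: "Y \<in> borel_measurable M" using Y by auto
  have m: "real_cond_exp M F Y \<in> borel_measurable M" by simp
  note c = real_cond_exp_int[OF Y]
  show iZ: "integrable M Z" using integrable_cong_AE[OF m Z eq] c(1) by blast
  show "expectation Z = expectation Y" using integral_cong_AE[OF m Z eq] c(2) by simp
  have "(\<integral>\<^sup>+\<omega>. ennreal \<bar>Z \<omega>\<bar> \<partial>M) \<le> (\<integral>\<^sup>+\<omega>. nn_cond_exp M F (\<lambda>x. ennreal \<bar>Y x\<bar>) \<omega> \<partial>M)"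
    by (rule nn_integral_mono_AE) (use real_cond_exp_abs[of Y] eq in auto)
  also have "\<dots> = (\<integral>\<^sup>+\<omega>. ennreal \<bar>Y \<omega>\<bar> \<partial>M)"
    using nn_cond_exp_intg[of "\<lambda>_. 1" "\<lambda>x. ennreal \<bar>Y x\<bar>"] by simp
  finally show "expectation (\<lambda>\<omega>. \<bar>Z \<omega>\<bar>) \<le> expectation (\<lambda>\<omega>. \<bar>Y \<omega>\<bar>)"
    using iZ Y by (simp add: nn_integral_eq_integral)
qed

text \<open>
  The process is the limit of its values at \<open>\<lfloor>n s\<rfloor> / n\<close>, which depend on the time through countably many
  values.
\<close>

lemma continuous_process_jointly_measurable:
  fixes Z :: "real \<Rightarrow> 'a \<Rightarrow> real"
  assumes Z: "\<And>s. Z s \<in> borel_measurable M" and cont: "\<And>\<omega>. \<omega> \<in> space M \<Longrightarrow> continuous_on UNIV (\<lambda>s. Z s \<omega>)"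
  shows "(\<lambda>(s, \<omega>). Z s \<omega>) \<in> borel_measurable ((lborel :: real measure) \<Otimes>\<^sub>M M)"
proof (rule borel_measurable_LIMSEQ_real)
  fix p assume "p \<in> space ((lborel :: real measure) \<Otimes>\<^sub>M M)"
  then obtain s \<omega> where p: "p = (s, \<omega>)" "\<omega> \<in> space M" by (auto simp: space_pair_measure)
  have "(\<lambda>n. of_int \<lfloor>s * real (Suc n)\<rfloor> / real (Suc n)) \<longlonglongrightarrow> s"
  proof (rule real_tendsto_sandwich)
    show "(\<lambda>n. s - 1 / real (Suc n)) \<longlonglongrightarrow> s"
      using LIMSEQ_Suc[OF tendsto_diff[OF tendsto_const lim_const_over_n[of 1]]] by simp
    show "\<forall>\<^sub>F n in sequentially. s - 1 / real (Suc n) \<le> of_int \<lfloor>s * real (Suc n)\<rfloor> / real (Suc n)"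
    proof (intro always_eventually allI)
      fix n
      have "s * real (Suc n) - 1 \<le> of_int \<lfloor>s * real (Suc n)\<rfloor>" by linarith
      then have "(s * real (Suc n) - 1) / real (Suc n) \<le> of_int \<lfloor>s * real (Suc n)\<rfloor> / real (Suc n)"
        by (intro divide_right_mono) auto
      then show "s - 1 / real (Suc n) \<le> of_int \<lfloor>s * real (Suc n)\<rfloor> / real (Suc n)"
        by (simp add: diff_divide_distrib del: of_nat_Suc)
    qed
    show "\<forall>\<^sub>F n in sequentially. of_int \<lfloor>s * real (Suc n)\<rfloor> / real (Suc n) \<le> s"
      by (intro always_eventually allI) (simp add: pos_divide_le_eq del: of_nat_Suc)
  qed auto
  then have "(\<lambda>n. Z (of_int \<lfloor>s * real (Suc n)\<rfloor> / real (Suc n)) \<omega>) \<longlonglongrightarrow> Z s \<omega>"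
    by (rule continuous_on_tendsto_compose[OF cont[OF p(2)]]) auto
  then show "(\<lambda>n. Z (of_int \<lfloor>fst p * real (Suc n)\<rfloor> / real (Suc n)) (snd p)) \<longlonglongrightarrow> (case p of (s, \<omega>) \<Rightarrow> Z s \<omega>)"
    by (simp add: p)
next
  fix n
  show "(\<lambda>p. Z (of_int \<lfloor>fst p * real (Suc n)\<rfloor> / real (Suc n)) (snd p)) \<in> borel_measurable ((lborel :: real measure) \<Otimes>\<^sub>M M)"
  proof (rule measurable_compose_countable[where f = "\<lambda>i p. Z (of_int i / real (Suc n)) (snd p)" and g = "\<lambda>p. \<lfloor>fst p * real (Suc n)\<rfloor>"])
    show "(\<lambda>p. Z (of_int i / real (Suc n)) (snd p)) \<in> borel_measurable ((lborel :: real measure) \<Otimes>\<^sub>M M)" for i :: int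
      using measurable_compose[OF measurable_snd Z] .
    show "(\<lambda>p. \<lfloor>fst p * real (Suc n)\<rfloor>) \<in> measurable ((lborel :: real measure) \<Otimes>\<^sub>M M) (count_space UNIV)"
      by measurable
  qed
qed

locale weak_sol = prob_kernel K + time_change lam \<nu> f for K lam \<nu> f +
  fixes M :: "'a measure" and F :: "real \<Rightarrow> 'a measure" and W X :: "real \<Rightarrow> 'a \<Rightarrow> real"
    and S :: real and G :: "real \<Rightarrow> real"
  assumes sol: "weak_solution M F W X S G K f lam \<nu>" and S: "0 < S"
    and G_nonneg: "\<And>t. 0 \<le> t \<Longrightarrow> 0 \<le> G t" and G_mono: "mono_on {0..} G"
begin

sublocale bm M F W
  using sol by unfold_locales (simp add: weak_solution_def)

definition mart :: "real \<Rightarrow> 'a \<Rightarrow> real" where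
  "mart t \<omega> = W (f (X t \<omega>)) \<omega>"

lemma X_measurable: "t \<in> {0..S} \<Longrightarrow> X t \<in> borel_measurable M"
  using sol by (simp add: weak_solution_def)

lemma X_0: "\<omega> \<in> space M \<Longrightarrow> X 0 \<omega> = 0"
  using sol by (simp add: weak_solution_def)

lemma X_mono: "\<omega> \<in> space M \<Longrightarrow> 0 \<le> s \<Longrightarrow> s \<le> t \<Longrightarrow> t \<le> S \<Longrightarrow> X s \<omega> \<le> X t \<omega>"
  using sol by (auto simp: weak_solution_def mono_on_def)

lemma X_nonneg: "\<omega> \<in> space M \<Longrightarrow> 0 \<le> t \<Longrightarrow> t \<le> S \<Longrightarrow> 0 \<le> X t \<omega>"
  using X_mono[of \<omega> 0 t] X_0 by simp

lemma X_continuous: "\<omega> \<in> space M \<Longrightarrow> continuous_on {0..S} (\<lambda>t. X t \<omega>)"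
  using sol by (simp add: weak_solution_def)

lemma mart_continuous:
  assumes "\<omega> \<in> space M" shows "continuous_on {0..S} (\<lambda>t. mart t \<omega>)"
proof -
  have 1: "continuous_on {0..S} (\<lambda>t. f (X t \<omega>))"
  proof (rule continuous_on_compose2[OF f_cont X_continuous[OF assms]])
    show "(\<lambda>t. X t \<omega>) ` {0..S} \<subseteq> {0..}" using X_nonneg[OF assms] by auto
  qed
  show ?thesis
    unfolding mart_def
  proof (rule continuous_on_compose2[OF continuous_B[OF assms] 1])
    show "(\<lambda>t. f (X t \<omega>)) ` {0..S} \<subseteq> {0..}" by (intro image_subsetI) (simp add: f_nonneg X_nonneg[OF assms])
  qed
qed

lemma martingale: "martingale_on M (natural_filtration M mart) {0..S} mart"
  using sol by (simp add: weak_solution_def mart_def[abs_def])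

lemma mart_integrable: "t \<in> {0..S} \<Longrightarrow> integrable M (mart t)"
  using martingale by (simp add: martingale_on_def)

lemma mart_moments:
  assumes t: "t \<in> {0..S}"
  shows "expectation (mart t) = 0" "expectation (\<lambda>\<omega>. \<bar>mart t \<omega>\<bar>) \<le> expectation (\<lambda>\<omega>. \<bar>mart S \<omega>\<bar>)"
proof -
  have *: "subalgebra M (natural_filtration M mart s) \<and>
      (AE \<omega> in M. real_cond_exp M (natural_filtration M mart s) (mart u) \<omega> = mart s \<omega>)"
    if "s \<in> {0..S}" "u \<in> {0..S}" "s \<le> u" for s u
    using martingale that by (auto simp: martingale_on_def)
  have meas: "mart s \<in> borel_measurable M" if "s \<in> {0..S}" for s
    using mart_integrable[OF that] by auto
  have 0: "0 \<in> {0..S}" "0 \<le> t" "S \<in> {0..S}" "t \<le> S" using t S by auto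
  have "expectation (mart 0) = expectation (mart t)"
    by (rule integral_abs_cond_exp_le(2)[OF conjunct1[OF *[OF 0(1) t 0(2)]] mart_integrable[OF t] meas[OF 0(1)]
          conjunct2[OF *[OF 0(1) t 0(2)]]])
  moreover have "expectation (mart 0) = expectation (\<lambda>\<omega>. 0)"
  proof (rule integral_cong_AE[OF meas[OF 0(1)]])
    show "AE \<omega> in M. mart 0 \<omega> = 0"
      using B_0 AE_space by eventually_elim (simp add: mart_def X_0 f_0)
  qed simp
  ultimately show "expectation (mart t) = 0" by simp
  show "expectation (\<lambda>\<omega>. \<bar>mart t \<omega>\<bar>) \<le> expectation (\<lambda>\<omega>. \<bar>mart S \<omega>\<bar>)"
    by (rule integral_abs_cond_exp_le(3)[OF conjunct1[OF *[OF t 0(3,4)]] mart_integrable[OF 0(3)] meas[OF t]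
          conjunct2[OF *[OF t 0(3,4)]]])
qed

text \<open>
  The time-changed Brownian motion is centred, and its \<open>L\<^sup>1\<close> norm is largest at the final time, so Fubini's
  theorem applies to the product with the integrable kernel.
\<close>

lemma convolved_martingale:
  assumes t: "t \<in> {0..S}"
  shows "integrable M (\<lambda>\<omega>. \<integral>u. kern u * lag t (\<lambda>s. mart s \<omega>) u \<partial>lborel)"
    "expectation (\<lambda>\<omega>. \<integral>u. kern u * lag t (\<lambda>s. mart s \<omega>) u \<partial>lborel) = 0"
proof -
  interpret P: pair_sigma_finite lborel M ..
  \<comment> \<open>Freezing the process outside \<open>[0, t]\<close> makes it continuous on the whole line.\<close>
  define cl where "cl s = max 0 (min t s)" for s :: real
  define A where "A = (\<lambda>u \<omega>. kern u * lag t (\<lambda>s. mart s \<omega>) u)"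
  define D where "D = expectation (\<lambda>\<omega>. \<bar>mart S \<omega>\<bar>)"
  have cl: "cl s \<in> {0..S}" for s using t by (auto simp: cl_def)
  have "(\<lambda>(s, \<omega>). mart (cl s) \<omega>) \<in> borel_measurable (lborel \<Otimes>\<^sub>M M)"
  proof (rule continuous_process_jointly_measurable)
    show "mart (cl s) \<in> borel_measurable M" for s using mart_integrable[OF cl] by auto
    show "continuous_on UNIV (\<lambda>s. mart (cl s) \<omega>)" if "\<omega> \<in> space M" for \<omega>
      by (rule continuous_on_compose2[OF mart_continuous[OF that]])
        (use cl in \<open>auto simp: cl_def intro!: continuous_intros\<close>)
  qed
  then have jm: "(\<lambda>p. mart (cl (fst p)) (snd p)) \<in> borel_measurable (lborel \<Otimes>\<^sub>M M)"
    by (simp add: case_prod_beta')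
  have "(\<lambda>p. (t - fst p, snd p)) \<in> measurable (lborel \<Otimes>\<^sub>M M) (lborel \<Otimes>\<^sub>M M)" by measurable
  from measurable_compose[OF this jm]
  have jm2: "(\<lambda>p. mart (cl (t - fst p)) (snd p)) \<in> borel_measurable (lborel \<Otimes>\<^sub>M M)" by simp
  have "(\<lambda>p. kern (fst p) * (indicator {0..t} (fst p) * mart (cl (t - fst p)) (snd p))) \<in> borel_measurable (lborel \<Otimes>\<^sub>M M)"
    using jm2 by measurable
  moreover have A_eq: "A u \<omega> = kern u * (indicator {0..t} u * mart (cl (t - u)) \<omega>)" for u \<omega>
    by (auto simp: A_def lag_def indicator_def cl_def)
  ultimately have Am: "(\<lambda>(u, \<omega>). A u \<omega>) \<in> borel_measurable (lborel \<Otimes>\<^sub>M M)"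
    by (simp add: case_prod_beta')
  have iA: "integrable M (A u)" "expectation (A u) = 0" "expectation (\<lambda>\<omega>. norm (A u \<omega>)) \<le> kern u * D" for u
  proof -
    show "integrable M (A u)" unfolding A_eq[abs_def] using mart_integrable[OF cl] by simp
    show "expectation (A u) = 0" unfolding A_eq[abs_def] using mart_moments(1)[OF cl] mart_integrable[OF cl] by simp
    have "norm (A u \<omega>) = kern u * indicator {0..t} u * \<bar>mart (cl (t - u)) \<omega>\<bar>" for \<omega>
      unfolding A_eq using kern_nonneg[of u] by (simp add: abs_mult)
    then have "expectation (\<lambda>\<omega>. norm (A u \<omega>)) = kern u * indicator {0..t} u * expectation (\<lambda>\<omega>. \<bar>mart (cl (t - u)) \<omega>\<bar>)"
      using mart_integrable[OF cl] by simp
    also have "\<dots> \<le> kern u * indicator {0..t} u * D"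
      using mart_moments(2)[OF cl, of "t - u"] kern_nonneg[of u] by (intro mult_left_mono) (auto simp: D_def)
    also have "\<dots> \<le> kern u * D"
    proof -
      have "0 \<le> D" unfolding D_def by simp
      then show ?thesis using kern_nonneg[of u] by (auto simp: indicator_def)
    qed
    finally show "expectation (\<lambda>\<omega>. norm (A u \<omega>)) \<le> kern u * D" .
  qed
  have iAA: "integrable (lborel \<Otimes>\<^sub>M M) (\<lambda>(u, \<omega>). A u \<omega>)"
  proof (rule P.Fubini_integrable[OF Am])
    have nm: "(\<lambda>(u, \<omega>). norm (A u \<omega>)) \<in> borel_measurable (lborel \<Otimes>\<^sub>M M)"
      using Am by (simp add: case_prod_beta')
    show "integrable lborel (\<lambda>u. \<integral>\<omega>. norm (case (u, \<omega>) of (u, \<omega>) \<Rightarrow> A u \<omega>) \<partial>M)"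
    proof (rule Bochner_Integration.integrable_bound)
      show "integrable lborel (\<lambda>u. kern u * D)" using kern_integrable by simp
      show "(\<lambda>u. \<integral>\<omega>. norm (case (u, \<omega>) of (u, \<omega>) \<Rightarrow> A u \<omega>) \<partial>M) \<in> borel_measurable lborel"
        using borel_measurable_lebesgue_integral[OF nm] by simp
      show "AE u in lborel. norm (\<integral>\<omega>. norm (case (u, \<omega>) of (u, \<omega>) \<Rightarrow> A u \<omega>) \<partial>M) \<le> norm (kern u * D)"
      proof (rule AE_I2)
        fix u
        have "0 \<le> expectation (\<lambda>\<omega>. norm (A u \<omega>))" by simp
        then show "norm (\<integral>\<omega>. norm (case (u, \<omega>) of (u, \<omega>) \<Rightarrow> A u \<omega>) \<partial>M) \<le> norm (kern u * D)"
          using iA(3)[of u] by simp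
      qed
    qed
    show "AE u in lborel. integrable M (\<lambda>\<omega>. case (u, \<omega>) of (u, \<omega>) \<Rightarrow> A u \<omega>)" using iA(1) by simp
  qed
  show "integrable M (\<lambda>\<omega>. \<integral>u. kern u * lag t (\<lambda>s. mart s \<omega>) u \<partial>lborel)"
    using P.integrable_snd[OF iAA] by (simp add: A_def)
  have "expectation (\<lambda>\<omega>. \<integral>u. A u \<omega> \<partial>lborel) = (\<integral>u. expectation (A u) \<partial>lborel)"
    by (rule P.Fubini_integral[OF iAA])
  then show "expectation (\<lambda>\<omega>. \<integral>u. kern u * lag t (\<lambda>s. mart s \<omega>) u \<partial>lborel) = 0"
    unfolding iA(2) by (simp add: A_def)
qed

lemma equation: "AE \<omega> in M. \<forall>t\<in>{0..S}. X t \<omega> = G t +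
    (LINT s:{0..t}|lborel. K (t - s) * (- lam * X s \<omega> + \<nu> * mart s \<omega>))"
  using sol by (simp add: weak_solution_def mart_def)

text \<open>
  As \<open>X\<close> is non-decreasing, its convolution with the kernel is at least the mass of the lags up to
  \<open>t - t'\<close> times \<open>X\<close> at time \<open>t'\<close>.
\<close>

lemma pathwise_bound:
  assumes t: "t \<in> {0..S}" "t' \<in> {0..t}"
  shows "AE \<omega> in M. X t \<omega> + lam * mass (t - t') * X t' \<omega>
      \<le> G t + \<nu> * (\<integral>u. kern u * lag t (\<lambda>s. mart s \<omega>) u \<partial>lborel)"
  using equation AE_space
proof eventually_elim
  case (elim \<omega>)
  have tS: "{0..t} \<subseteq> {0..S}" using t by auto
  have cX: "continuous_on {0..t} (\<lambda>s. X s \<omega>)" and cm: "continuous_on {0..t} (\<lambda>s. mart s \<omega>)"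
    using continuous_on_subset[OF X_continuous[OF elim(2)] tS] continuous_on_subset[OF mart_continuous[OF elim(2)] tS] by auto
  have "X t \<omega> = G t + (\<integral>u. kern u * lag t (\<lambda>s. - lam * X s \<omega> + \<nu> * mart s \<omega>) u \<partial>lborel)"
    using elim(1) t by (simp add: convolution_eq)
  also have "(\<lambda>u. kern u * lag t (\<lambda>s. - lam * X s \<omega> + \<nu> * mart s \<omega>) u)
    = (\<lambda>u. \<nu> * (kern u * lag t (\<lambda>s. mart s \<omega>) u) - lam * (kern u * lag t (\<lambda>s. X s \<omega>) u))"
    by (auto simp: lag_def fun_eq_iff algebra_simps)
  also have "(\<integral>u. \<nu> * (kern u * lag t (\<lambda>s. mart s \<omega>) u) - lam * (kern u * lag t (\<lambda>s. X s \<omega>) u) \<partial>lborel)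
    = \<nu> * (\<integral>u. kern u * lag t (\<lambda>s. mart s \<omega>) u \<partial>lborel) - lam * (\<integral>u. kern u * lag t (\<lambda>s. X s \<omega>) u \<partial>lborel)"
    using lag_integrable[OF cX] lag_integrable[OF cm] by simp
  finally have eq: "X t \<omega> = G t + (\<nu> * (\<integral>u. kern u * lag t (\<lambda>s. mart s \<omega>) u \<partial>lborel)
      - lam * (\<integral>u. kern u * lag t (\<lambda>s. X s \<omega>) u \<partial>lborel))" .
  have "mass (t - t') * X t' \<omega> = (\<integral>u. kern u * indicator {..t - t'} u * X t' \<omega> \<partial>lborel)"
    unfolding mass_def using mass_integrable[of "t - t'"] by simp
  also have "\<dots> \<le> (\<integral>u. kern u * lag t (\<lambda>s. X s \<omega>) u \<partial>lborel)"
  proof (rule integral_mono[OF _ lag_integrable[OF cX]])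
    show "integrable lborel (\<lambda>u. kern u * indicator {..t - t'} u * X t' \<omega>)" using mass_integrable[of "t - t'"] by simp
    fix u
    show "kern u * indicator {..t - t'} u * X t' \<omega> \<le> kern u * lag t (\<lambda>s. X s \<omega>) u"
    proof (cases "0 \<le> u")
      case True
      have "indicator {..t - t'} u * X t' \<omega> \<le> lag t (\<lambda>s. X s \<omega>) u"
        using True t X_mono[OF elim(2), of t' "t - u"] X_nonneg[OF elim(2), of "t - u"]
        by (auto simp: lag_def indicator_def)
      then show ?thesis using kern_nonneg[of u] by (simp add: mult.assoc mult_left_mono)
    qed (simp add: kern_def)
  qed
  finally have "lam * (mass (t - t') * X t' \<omega>) \<le> lam * (\<integral>u. kern u * lag t (\<lambda>s. X s \<omega>) u \<partial>lborel)"
    using lam by (rule mult_left_mono)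
  then show ?case using eq by (simp add: mult.assoc)
qed

lemma X_integrable:
  assumes t: "t \<in> {0..S}" shows "integrable M (X t)"
proof (rule Bochner_Integration.integrable_bound)
  let ?I = "\<lambda>\<omega>. \<integral>u. kern u * lag t (\<lambda>s. mart s \<omega>) u \<partial>lborel"
  show "integrable M (\<lambda>\<omega>. G t + \<nu> * ?I \<omega>)" using convolved_martingale(1)[OF t] by simp
  have t': "t \<in> {0..t}" using t by auto
  show "AE \<omega> in M. norm (X t \<omega>) \<le> norm (G t + \<nu> * ?I \<omega>)"
    using pathwise_bound[OF t t'] AE_space
  proof eventually_elim
    case (elim \<omega>)
    have "0 \<le> X t \<omega>" using X_nonneg[OF elim(2)] t by auto
    moreover have "0 \<le> lam * mass (t - t) * X t \<omega>" using lam mass_bounds(1) calculation by simp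
    ultimately show ?case using elim(1) by simp
  qed
qed (rule X_measurable[OF t])

text \<open>
  When the mass is nearly \<open>1\<close> and the means at the two times are close, this reads
  \<open>(1 + lam) E X\<^sub>t \<le> G t\<close> up to a small error.
\<close>

lemma mean_bound:
  assumes t: "t \<in> {0..S}" "t' \<in> {0..t}"
  shows "expectation (X t) + lam * mass (t - t') * expectation (X t') \<le> G t"
proof -
  let ?I = "\<lambda>\<omega>. \<integral>u. kern u * lag t (\<lambda>s. mart s \<omega>) u \<partial>lborel"
  have t': "t' \<in> {0..S}" using t by auto
  have "expectation (X t) + lam * mass (t - t') * expectation (X t')
    = expectation (\<lambda>\<omega>. X t \<omega> + lam * mass (t - t') * X t' \<omega>)"
    using X_integrable[OF t(1)] X_integrable[OF t'] by simp
  also have "\<dots> \<le> expectation (\<lambda>\<omega>. G t + \<nu> * ?I \<omega>)"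
    by (rule integral_mono_AE[OF _ _ pathwise_bound[OF t]])
      (use X_integrable[OF t(1)] X_integrable[OF t'] convolved_martingale(1)[OF t(1)] in auto)
  also have "\<dots> = G t" using convolved_martingale[OF t(1)] by (simp add: prob_space)
  finally show ?thesis .
qed

end

section \<open>Functionals of Brownian paths\<close>

lemma C_path_continuous: "\<phi> \<in> C_paths \<Longrightarrow> continuous_on {0..} \<phi>"
  by (simp add: C_paths_def)

context time_change
begin

definition passage :: "real \<Rightarrow> (real \<Rightarrow> real) \<Rightarrow> real" where
  "passage g \<phi> = first_passage lam \<nu> f (\<lambda>t \<phi>. \<phi> t) g \<phi>"

lemma passage_measurable: "passage g \<in> borel_measurable path_space"
  unfolding passage_def[abs_def]
  by (rule first_passage_measurable) (auto intro: eval_measurable C_path_continuous)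

end

lemma (in passage_bm) passage_path: "passage g (path \<omega>) = first_passage lam \<nu> f B g \<omega>"
proof -
  have "drifted (path \<omega>) s = drifted (\<lambda>t. B t \<omega>) s" if "0 \<le> s" for s
    using that f_nonneg by (simp add: drifted_def path_eq)
  then have "{s. 0 \<le> s \<and> g < drifted (\<lambda>t. path \<omega> t) s} = {s. 0 \<le> s \<and> g < drifted (\<lambda>t. B t \<omega>) s}" by auto
  then show ?thesis unfolding passage_def first_passage_eq by (simp only:)
qed

text \<open>
  One family of measurable sets that encodes both a bound and a modulus of continuity; for fixed \<open>L\<close> and
  \<open>e\<close> it exhausts the continuous paths.
\<close>

definition regular_paths :: "real \<Rightarrow> real \<Rightarrow> nat \<Rightarrow> (real \<Rightarrow> real) set" where
  "regular_paths L e k = {\<phi> \<in> C_paths. \<forall>s\<in>{0..L}. \<forall>r\<in>{0..L}. \<bar>s - r\<bar> \<le> 1 / Suc k \<longrightarrow>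
      \<bar>\<phi> s - \<phi> r\<bar> \<le> e \<and> \<bar>\<phi> s\<bar> \<le> real k}"

lemma regular_paths_sets:
  assumes L: "0 < L"
  shows "regular_paths L e k \<in> sets path_space"
proof -
  define d where "d = 1 / real (Suc k)"
  have d: "0 < d" by (simp add: d_def)
  define P where "P s r = {\<phi> \<in> space path_space. \<bar>\<phi> s - \<phi> r\<bar> \<le> e \<and> \<bar>\<phi> s\<bar> \<le> real k}" for s r
  have P: "P s r \<in> sets path_space" if "0 \<le> s" "0 \<le> r" for s r
    unfolding P_def using eval_measurable[OF that(1)] eval_measurable[OF that(2)] by measurable
  define I where "I = {p \<in> \<rat> \<times> \<rat>. fst p \<in> {0..L} \<and> snd p \<in> {0..L} \<and> \<bar>fst p - snd p\<bar> \<le> d}"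
  have I: "countable I" "I \<noteq> {}"
  proof -
    have "countable (\<rat> \<times> \<rat> :: (real \<times> real) set)" by (intro countable_SIGMA countable_rat)
    then show "countable I" by (rule countable_subset[rotated]) (auto simp: I_def)
    have "(0, 0) \<in> I" using L d by (auto simp: I_def)
    then show "I \<noteq> {}" by blast
  qed
  have "(\<Inter>p\<in>I. P (fst p) (snd p)) \<in> sets path_space"
    by (rule sets.countable_INT'[OF I]) (use P in \<open>auto simp: I_def\<close>)
  also have "(\<Inter>p\<in>I. P (fst p) (snd p)) = regular_paths L e k"
  proof (intro equalityI subsetI)
    fix \<phi> assume \<phi>: "\<phi> \<in> (\<Inter>p\<in>I. P (fst p) (snd p))"
    then have C: "\<phi> \<in> C_paths" using I(2) by (auto simp: P_def)
    have cont: "continuous_on {a..b} \<phi>" if "0 \<le> a" for a b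
      by (rule continuous_on_subset[OF C_path_continuous[OF C]]) (use that in auto)
    have rat: "\<bar>\<phi> s - \<phi> r\<bar> \<le> e" if "s \<in> \<rat>" "r \<in> \<rat>" "s \<in> {0..L}" "r \<in> {0..L}" "\<bar>s - r\<bar> \<le> d" for s r
    proof -
      have "(s, r) \<in> I" using that by (simp add: I_def)
      then show ?thesis using \<phi> by (fastforce simp: P_def)
    qed
    have half: "\<bar>\<phi> s - \<phi> r\<bar> \<le> e" if s: "s \<in> \<rat>" "s \<in> {0..L}" "r \<in> {0..L}" "\<bar>s - r\<bar> \<le> d" for s r
    proof (rule le_on_rationals_imp_le[where g = "\<lambda>r. \<bar>\<phi> s - \<phi> r\<bar>" and a = "max 0 (s - d)" and b = "min L (s + d)"])
      show "continuous_on {max 0 (s - d)..min L (s + d)} (\<lambda>r. \<bar>\<phi> s - \<phi> r\<bar>)"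
        by (intro continuous_intros cont) auto
    qed (use s d L rat in auto)
    have "\<bar>\<phi> s - \<phi> r\<bar> \<le> e" if s: "s \<in> {0..L}" "r \<in> {0..L}" "\<bar>s - r\<bar> \<le> d" for s r
    proof (rule le_on_rationals_imp_le[where g = "\<lambda>s. \<bar>\<phi> s - \<phi> r\<bar>" and a = "max 0 (r - d)" and b = "min L (r + d)"])
      show "continuous_on {max 0 (r - d)..min L (r + d)} (\<lambda>s. \<bar>\<phi> s - \<phi> r\<bar>)"
        by (intro continuous_intros cont) auto
    qed (use s d L half in auto)
    moreover have "\<bar>\<phi> s\<bar> \<le> real k" if s: "s \<in> {0..L}" for s
    proof (rule le_on_rationals_imp_le[OF L _ _ s])
      show "continuous_on {0..L} (\<lambda>s. \<bar>\<phi> s\<bar>)" by (intro continuous_intros cont) auto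
      fix q assume "q \<in> \<rat>" "q \<in> {0..L}"
      then have "(q, q) \<in> I" using d by (simp add: I_def)
      then show "\<bar>\<phi> q\<bar> \<le> real k" using \<phi> by (fastforce simp: P_def)
    qed
    ultimately show "\<phi> \<in> regular_paths L e k" using C by (simp add: regular_paths_def d_def)
  next
    fix \<phi> assume "\<phi> \<in> regular_paths L e k"
    then show "\<phi> \<in> (\<Inter>p\<in>I. P (fst p) (snd p))"
      by (auto simp: regular_paths_def P_def I_def d_def)
  qed
  finally show ?thesis .
qed

lemma regular_paths_exhaust:
  assumes L: "0 < L" and e: "0 < e" and \<mu>: "prob_space \<mu>" "sets \<mu> = sets path_space"
  shows "(\<lambda>k. measure \<mu> (regular_paths L e k)) \<longlonglongrightarrow> 1"
proof -
  interpret prob_space \<mu> by fact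
  have sp: "space \<mu> = C_paths" using sets_eq_imp_space_eq[OF \<mu>(2)] by simp
  have "incseq (regular_paths L e)"
  proof (rule incseq_SucI, rule subsetI)
    fix k \<phi> assume \<phi>: "\<phi> \<in> regular_paths L e k"
    have le: "1 / real (Suc (Suc k)) \<le> 1 / real (Suc k)" by (simp add: field_simps)
    show "\<phi> \<in> regular_paths L e (Suc k)"
      unfolding regular_paths_def
    proof (intro CollectI conjI ballI impI)
      show "\<phi> \<in> C_paths" using \<phi> by (simp add: regular_paths_def)
      fix s r assume sr: "s \<in> {0..L}" "r \<in> {0..L}" "\<bar>s - r\<bar> \<le> 1 / real (Suc (Suc k))"
      have "\<bar>s - r\<bar> \<le> 1 / real (Suc k)" using sr(3) le by (rule order_trans)
      then have *: "\<bar>\<phi> s - \<phi> r\<bar> \<le> e" "\<bar>\<phi> s\<bar> \<le> real k"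
        using \<phi> sr(1,2) unfolding regular_paths_def by blast+
      show "\<bar>\<phi> s - \<phi> r\<bar> \<le> e" by (rule *)
      show "\<bar>\<phi> s\<bar> \<le> real (Suc k)" using *(2) by simp
    qed
  qed
  moreover have "(\<Union>k. regular_paths L e k) = C_paths"
  proof (intro equalityI subsetI)
    fix \<phi> assume C: "\<phi> \<in> C_paths"
    obtain b where b: "\<And>t. t \<in> {0..L} \<Longrightarrow> \<bar>\<phi> t\<bar> \<le> b" using C_paths_bounded[OF C] by metis
    have "continuous_on {0..L} \<phi>" by (rule continuous_on_subset[OF C_path_continuous[OF C]]) auto
    then have "uniformly_continuous_on {0..L} \<phi>" by (intro compact_uniformly_continuous) auto
    from this[unfolded uniformly_continuous_on_def dist_real_def, rule_format, OF e]
    obtain d where d: "0 < d" "\<And>r s. r \<in> {0..L} \<Longrightarrow> s \<in> {0..L} \<Longrightarrow> \<bar>s - r\<bar> < d \<Longrightarrow> \<bar>\<phi> s - \<phi> r\<bar> < e"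
      by auto
    obtain k1 :: nat where k1: "1 / Suc k1 < d" using nat_approx_posE[OF d(1)] by auto
    obtain k2 :: nat where k2: "b \<le> real k2" using real_arch_simple by blast
    define k where "k = max k1 k2"
    have "1 / real (Suc k) \<le> 1 / real (Suc k1)" unfolding k_def by (intro divide_left_mono) auto
    then have "1 / real (Suc k) < d" using k1 by linarith
    have "b \<le> real k" using k2 by (simp add: k_def)
    have "\<phi> \<in> regular_paths L e k"
      unfolding regular_paths_def
    proof (intro CollectI conjI ballI impI C)
      fix s r assume sr: "s \<in> {0..L}" "r \<in> {0..L}" "\<bar>s - r\<bar> \<le> 1 / real (Suc k)"
      have "\<bar>s - r\<bar> < d" using sr(3) \<open>1 / real (Suc k) < d\<close> by linarith
      from d(2)[OF sr(2,1) this] show "\<bar>\<phi> s - \<phi> r\<bar> \<le> e" by linarith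
      show "\<bar>\<phi> s\<bar> \<le> real k" using b[OF sr(1)] \<open>b \<le> real k\<close> by linarith
    qed
    then show "\<phi> \<in> (\<Union>k. regular_paths L e k)" by blast
  qed (auto simp: regular_paths_def)
  moreover have "range (regular_paths L e) \<subseteq> sets \<mu>" using regular_paths_sets[OF L] \<mu>(2) by auto
  ultimately have "(\<lambda>k. measure \<mu> (regular_paths L e k)) \<longlonglongrightarrow> measure \<mu> C_paths"
    using finite_Lim_measure_incseq[of "regular_paths L e"] by simp
  then show ?thesis using prob_space unfolding sp by simp
qed

section \<open>Rescaled solutions and first-passage times\<close>

text \<open>
  Both asymptotic regimes at once: the first one has \<open>c = 1\<close> and \<open>fs = f\<close>. The convergence of the levels
  concerns positive times only, because at time \<open>0\<close> the levels of the first regime vanish while their limit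
  at positive times need not.
\<close>

locale scaling_limit = prob_kernel K + time_change lam \<nu> f + lim: time_change lam \<nu> fs
  for K lam \<nu> f fs +
  fixes M :: "nat \<Rightarrow> 'a measure" and F :: "nat \<Rightarrow> real \<Rightarrow> 'a measure" and W X :: "nat \<Rightarrow> real \<Rightarrow> 'a \<Rightarrow> real"
    and G :: "real \<Rightarrow> real" and c :: "nat \<Rightarrow> real" and T :: real and Gs :: "real \<Rightarrow> real" and C :: real
    and N :: "'b measure" and FB :: "real \<Rightarrow> 'b measure" and B :: "real \<Rightarrow> 'b \<Rightarrow> real"
  assumes sols: "\<And>n. 1 \<le> n \<Longrightarrow> weak_solution (M n) (F n) (W n) (X n) (real n * T) G K f lam \<nu>"
    and T: "0 < T" and G_nonneg: "\<And>t. 0 \<le> t \<Longrightarrow> 0 \<le> G t" and G_mono: "mono_on {0..} G"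
    and c: "\<And>n. 0 < c n"
    and growth: "\<And>x. 0 \<le> x \<Longrightarrow> fs x \<le> C * (1 + x)\<^sup>2"
    and f_lim: "\<And>R e. 0 < e \<Longrightarrow> \<forall>\<^sub>F n in sequentially. \<forall>x\<in>{0..R}. \<bar>(c n)\<^sup>2 * f (x / c n) - fs x\<bar> \<le> e"
    and G_lim: "\<And>t. 0 < t \<Longrightarrow> t \<le> T \<Longrightarrow> (\<lambda>n. c n * G (real n * t)) \<longlonglongrightarrow> Gs t"
    and Gs_left: "\<And>t h. 0 < t \<Longrightarrow> t \<le> T \<Longrightarrow> h < Gs t \<Longrightarrow> \<exists>t'. 0 < t' \<and> t' < t \<and> h < Gs t'"
    and bmB: "bm N FB B"
begin

definition w :: "nat \<Rightarrow> real \<Rightarrow> 'a \<Rightarrow> real" where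
  "w n t \<omega> = c n * W n (t / (c n)\<^sup>2) \<omega>"

definition y :: "nat \<Rightarrow> real \<Rightarrow> 'a \<Rightarrow> real" where
  "y n t \<omega> = c n * X n (real n * t) \<omega>"

lemma ws: "1 \<le> n \<Longrightarrow> weak_sol K lam \<nu> f (M n) (F n) (W n) (X n) (real n * T) G"
  using sols T G_nonneg G_mono by unfold_locales auto

lemma pb: "1 \<le> n \<Longrightarrow> passage_bm (M n) (\<lambda>t. F n (t / (c n)\<^sup>2)) (w n) lam \<nu> fs C"
proof -
  assume n: "1 \<le> n"
  have "bm (M n) (F n) (W n)" using sols[OF n] by (simp add: bm_def weak_solution_def)
  from bm_scale[OF this c[of n]] have "bm (M n) (\<lambda>t. F n (t / (c n)\<^sup>2)) (w n)"
    unfolding w_def[abs_def] .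
  then show ?thesis using growth lim.time_change_axioms
    by (simp add: passage_bm_def passage_bm_axioms_def)
qed

lemma pbN: "passage_bm N FB B lam \<nu> fs C"
  using growth lim.time_change_axioms bmB by (simp add: passage_bm_def passage_bm_axioms_def)

definition hit :: "nat \<Rightarrow> real \<Rightarrow> 'a \<Rightarrow> real" where
  "hit n g \<omega> = first_passage lam \<nu> fs (w n) g \<omega>"

abbreviation "wpath n \<equiv> bm.path (w n)"

lemma prob_M: "1 \<le> n \<Longrightarrow> prob_space (M n)"
proof -
  assume "1 \<le> n"
  then interpret passage_bm "M n" "\<lambda>t. F n (t / (c n)\<^sup>2)" "w n" lam \<nu> fs C by (rule pb)
  show ?thesis by (rule prob_space_axioms)
qed

lemma wpath_measurable: "1 \<le> n \<Longrightarrow> wpath n \<in> measurable (M n) path_space"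
proof -
  assume "1 \<le> n"
  then interpret passage_bm "M n" "\<lambda>t. F n (t / (c n)\<^sup>2)" "w n" lam \<nu> fs C by (rule pb)
  show ?thesis by (rule path_measurable)
qed

text \<open>
  All rescaled Brownian motions and \<open>B\<close> have this law on path space, so that estimates of functionals of
  \<open>w n\<close> are automatically uniform in \<open>n\<close>.
\<close>

definition wiener :: "(real \<Rightarrow> real) measure" where
  "wiener = distr N path_space (bm.path B)"

lemma wiener: "prob_space wiener" "sets wiener = sets path_space"
proof -
  interpret passage_bm N FB B lam \<nu> fs C by (rule pbN)
  show "prob_space wiener" unfolding wiener_def by (rule prob_space_distr[OF path_measurable])
qed (simp add: wiener_def)

lemma w_law: "1 \<le> n \<Longrightarrow> distr (M n) path_space (wpath n) = wiener"
  unfolding wiener_def using bm_law_unique[OF passage_bm.axioms(1)[OF pb] bmB] .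

lemma hit_path: "1 \<le> n \<Longrightarrow> hit n g \<omega> = lim.passage g (wpath n \<omega>)"
proof -
  assume "1 \<le> n"
  then interpret passage_bm "M n" "\<lambda>t. F n (t / (c n)\<^sup>2)" "w n" lam \<nu> fs C by (rule pb)
  show ?thesis unfolding hit_def by (rule passage_path[symmetric])
qed

lemma hit_moments:
  assumes n: "1 \<le> n"
  shows "integrable (M n) (hit n g)" "(\<integral>\<omega>. hit n g \<omega> \<partial>M n) = max 0 g / (1 + lam)"
    "AE \<omega> in M n. 0 \<le> hit n g \<omega>" "h \<le> g \<Longrightarrow> AE \<omega> in M n. hit n h \<omega> \<le> hit n g \<omega>"
proof -
  interpret passage_bm "M n" "\<lambda>t. F n (t / (c n)\<^sup>2)" "w n" lam \<nu> fs C by (rule pb[OF n])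
  have eq: "hit n g = first_passage lam \<nu> fs (w n) g" for g by (rule ext) (simp add: hit_def)
  show "integrable (M n) (hit n g)" "(\<integral>\<omega>. hit n g \<omega> \<partial>M n) = max 0 g / (1 + lam)" "AE \<omega> in M n. 0 \<le> hit n g \<omega>"
    unfolding eq by (rule first_passage_mean)+
  show "AE \<omega> in M n. hit n h \<omega> \<le> hit n g \<omega>" if "h \<le> g"
    using first_passage_mean(1)[of g]
  proof eventually_elim
    case (elim \<omega>)
    have "Inf {s. 0 \<le> s \<and> h < lim.drifted (\<lambda>t. w n t \<omega>) s} \<le> Inf {s. 0 \<le> s \<and> g < lim.drifted (\<lambda>t. w n t \<omega>) s}"
    proof (rule cInf_superset_mono)
      show "{s. 0 \<le> s \<and> g < lim.drifted (\<lambda>t. w n t \<omega>) s} \<noteq> {}" using elim by (auto simp: level_def)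
      show "bdd_below {s. 0 \<le> s \<and> h < lim.drifted (\<lambda>t. w n t \<omega>) s}" by (rule bdd_belowI[of _ 0]) auto
      show "{s. 0 \<le> s \<and> g < lim.drifted (\<lambda>t. w n t \<omega>) s} \<subseteq> {s. 0 \<le> s \<and> h < lim.drifted (\<lambda>t. w n t \<omega>) s}" using that by auto
    qed
    then show ?case unfolding hit_def lim.first_passage_eq .
  qed
qed

lemma y_facts:
  assumes n: "1 \<le> n" and t: "0 \<le> t" "t \<le> T"
  shows "integrable (M n) (y n t)" "\<omega> \<in> space (M n) \<Longrightarrow> 0 \<le> y n t \<omega>"
    "(\<integral>\<omega>. y n t \<omega> \<partial>M n) \<le> c n * G (real n * t)"
    "0 \<le> t' \<Longrightarrow> t' \<le> t \<Longrightarrow> (\<integral>\<omega>. y n t \<omega> \<partial>M n) + lam * mass (real n * (t - t')) * (\<integral>\<omega>. y n t' \<omega> \<partial>M n)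
      \<le> c n * G (real n * t)"
proof -
  interpret weak_sol K lam \<nu> f "M n" "F n" "W n" "X n" "real n * T" G by (rule ws[OF n])
  have nt: "real n * t \<in> {0..real n * T}" using t by (auto intro: mult_left_mono)
  have y: "y n s = (\<lambda>\<omega>. c n * X n (real n * s) \<omega>)" for s by (rule ext) (simp add: y_def)
  show "integrable (M n) (y n t)" unfolding y using X_integrable[OF nt] by simp
  show "0 \<le> y n t \<omega>" if "\<omega> \<in> space (M n)" using X_nonneg[OF that] nt c[of n] by (simp add: y_def)
  show *: "(\<integral>\<omega>. y n t \<omega> \<partial>M n) + lam * mass (real n * (t - t')) * (\<integral>\<omega>. y n t' \<omega> \<partial>M n) \<le> c n * G (real n * t)"
    if "0 \<le> t'" "t' \<le> t" for t'
  proof -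
    have "real n * t' \<in> {0..real n * t}" using that by (auto intro: mult_left_mono)
    from mean_bound[OF nt this]
    have "c n * (expectation (X n (real n * t)) + lam * mass (real n * t - real n * t') * expectation (X n (real n * t')))
      \<le> c n * G (real n * t)" using c[of n] by (intro mult_left_mono) auto
    then show ?thesis unfolding y by (simp add: algebra_simps)
  qed
  have "0 \<le> (\<integral>\<omega>. y n t \<omega> \<partial>M n)"
    by (rule integral_nonneg_AE) (use X_nonneg nt c[of n] in \<open>auto simp: y_def\<close>)
  then have "0 \<le> lam * mass (real n * (t - t)) * (\<integral>\<omega>. y n t \<omega> \<partial>M n)" using lam mass_bounds by simp
  then show "(\<integral>\<omega>. y n t \<omega> \<partial>M n) \<le> c n * G (real n * t)" using *[of t] t by simp
qed

lemma passage_tail: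
  assumes "0 < r"
  obtains A where "0 < A" "\<And>n. 1 \<le> n \<Longrightarrow> (\<integral>\<omega>. hit n g \<omega> * indicator {A<..} (hit n g \<omega>) \<partial>M n) < r"
proof -
  interpret PN: passage_bm N FB B lam \<nu> fs C by (rule pbN)
  have pm: "lim.passage g \<in> borel_measurable path_space" by (rule lim.passage_measurable)
  have ip: "integrable wiener (lim.passage g)"
  proof -
    have "integrable N (\<lambda>\<omega>. lim.passage g (bm.path B \<omega>))"
      using PN.first_passage_mean(2)[of g] by (simp add: PN.passage_path)
    then show ?thesis unfolding wiener_def
      using pm by (subst integrable_distr_eq[OF PN.path_measurable]) auto
  qed
  let ?h = "\<lambda>A x. x * indicator {A<..} x :: real"
  have hm: "(\<lambda>\<phi>. ?h A (lim.passage g \<phi>)) \<in> borel_measurable path_space" for A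
    using pm by measurable
  have "(\<lambda>k. \<integral>\<phi>. ?h (real k) (lim.passage g \<phi>) \<partial>wiener) \<longlonglongrightarrow> (\<integral>\<phi>. 0 \<partial>wiener)"
  proof (rule integral_dominated_convergence[where w = "\<lambda>\<phi>. \<bar>lim.passage g \<phi>\<bar>"])
    show "AE \<phi> in wiener. (\<lambda>k. ?h (real k) (lim.passage g \<phi>)) \<longlonglongrightarrow> 0"
    proof (rule AE_I2)
      fix \<phi>
      obtain k0 :: nat where "lim.passage g \<phi> \<le> real k0" using real_arch_simple by blast
      then have "\<forall>\<^sub>F k in sequentially. ?h (real k) (lim.passage g \<phi>) = 0"
        by (intro eventually_mono[OF eventually_ge_at_top[of k0]]) (auto simp: indicator_def)
      then show "(\<lambda>k. ?h (real k) (lim.passage g \<phi>)) \<longlonglongrightarrow> 0" by (rule tendsto_eventually)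
    qed
    show "(\<lambda>\<phi>. ?h (real k) (lim.passage g \<phi>)) \<in> borel_measurable wiener" for k
      using hm[of "real k"] by (simp add: wiener_def)
  qed (use ip in \<open>auto simp: indicator_def\<close>)
  then have "(\<lambda>k. \<integral>\<phi>. ?h (real k) (lim.passage g \<phi>) \<partial>wiener) \<longlonglongrightarrow> 0" by simp
  from order_tendstoD(2)[OF this assms] obtain k0
    where k0: "\<And>k. k0 \<le> k \<Longrightarrow> (\<integral>\<phi>. ?h (real k) (lim.passage g \<phi>) \<partial>wiener) < r"
    by (auto simp: eventually_sequentially)
  show ?thesis
  proof (rule that[of "real (Suc k0)"])
    fix n :: nat assume n: "1 \<le> n"
    have "(\<integral>\<omega>. ?h (real (Suc k0)) (hit n g \<omega>) \<partial>M n) = (\<integral>\<phi>. ?h (real (Suc k0)) (lim.passage g \<phi>) \<partial>wiener)"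
      unfolding w_law[OF n, symmetric] hit_path[OF n]
      by (rule integral_distr[OF wpath_measurable[OF n] hm, symmetric])
    then show "(\<integral>\<omega>. ?h (real (Suc k0)) (hit n g \<omega>) \<partial>M n) < r" using k0[of "Suc k0"] by simp
  qed simp
qed

text \<open>
  The passage times \<open>hit n g\<close> are identically distributed and integrable, hence uniformly integrable.
\<close>

lemma passage_small_on_small_events:
  assumes E: "\<And>n. 1 \<le> n \<Longrightarrow> E n \<in> sets (M n)" and lim0: "(\<lambda>n. measure (M n) (E n)) \<longlonglongrightarrow> 0"
  shows "(\<lambda>n. \<integral>\<omega>. hit n g \<omega> * indicator (E n) \<omega> \<partial>M n) \<longlonglongrightarrow> 0"
proof (rule LIMSEQ_I)
  fix r :: real assume r: "0 < r"
  obtain A where A: "0 < A" "\<And>n. 1 \<le> n \<Longrightarrow> (\<integral>\<omega>. hit n g \<omega> * indicator {A<..} (hit n g \<omega>) \<partial>M n) < r / 2"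
    using passage_tail[of "r / 2" g] r by auto
  have "\<forall>\<^sub>F n in sequentially. measure (M n) (E n) < r / (2 * A)"
    using r A by (intro order_tendstoD(2)[OF lim0]) auto
  then obtain n0 where n0: "\<And>n. n0 \<le> n \<Longrightarrow> measure (M n) (E n) < r / (2 * A)"
    by (auto simp: eventually_sequentially)
  have "norm ((\<integral>\<omega>. hit n g \<omega> * indicator (E n) \<omega> \<partial>M n) - 0) < r" if n: "max 1 n0 \<le> n" for n
  proof -
    have n1: "1 \<le> n" using n by simp
    interpret prob_space "M n" by (rule prob_M[OF n1])
    note tm = hit_moments[OF n1, of g]
    have m[measurable]: "hit n g \<in> borel_measurable (M n)" using tm(1) by auto
    have Em[measurable]: "E n \<in> sets (M n)" by (rule E[OF n1])
    have i1: "integrable (M n) (\<lambda>\<omega>. hit n g \<omega> * indicator (E n) \<omega>)"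
      by (rule Bochner_Integration.integrable_bound[OF tm(1)]) (auto simp: indicator_def)
    have i2: "integrable (M n) (\<lambda>\<omega>. hit n g \<omega> * indicator {A<..} (hit n g \<omega>))"
      by (rule Bochner_Integration.integrable_bound[OF tm(1)]) (auto simp: indicator_def)
    have i3: "integrable (M n) (\<lambda>\<omega>. A * indicator (E n) \<omega>)"
      by (rule integrable_const_bound[of _ A]) (use A in \<open>auto simp: indicator_def\<close>)
    have "(\<integral>\<omega>. hit n g \<omega> * indicator (E n) \<omega> \<partial>M n)
      \<le> (\<integral>\<omega>. A * indicator (E n) \<omega> + hit n g \<omega> * indicator {A<..} (hit n g \<omega>) \<partial>M n)"
      by (rule integral_mono_AE[OF i1 Bochner_Integration.integrable_add[OF i3 i2]])
        (use tm(3) A in \<open>auto simp: indicator_def\<close>)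
    also have "\<dots> = A * prob (E n) + (\<integral>\<omega>. hit n g \<omega> * indicator {A<..} (hit n g \<omega>) \<partial>M n)"
      using i2 i3 by simp
    also have "\<dots> < r / 2 + r / 2"
    proof (rule add_strict_mono)
      show "A * prob (E n) < r / 2" using n0[of n] n A by (simp add: field_simps)
    qed (rule A(2)[OF n1])
    finally have "(\<integral>\<omega>. hit n g \<omega> * indicator (E n) \<omega> \<partial>M n) < r" by simp
    moreover have "0 \<le> (\<integral>\<omega>. hit n g \<omega> * indicator (E n) \<omega> \<partial>M n)"
      by (rule integral_nonneg_AE) (use tm(3) in auto)
    ultimately show ?thesis by simp
  qed
  then show "\<exists>n0. \<forall>n\<ge>n0. norm ((\<integral>\<omega>. hit n g \<omega> * indicator (E n) \<omega> \<partial>M n) - 0) < r" by blast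
qed

end

context scaling_limit
begin

lemma wpath_regular:
  assumes L: "0 < L" and e: "0 < e" and r: "0 < r"
  obtains k where "\<And>n. 1 \<le> n \<Longrightarrow>
    measure (M n) {\<omega> \<in> space (M n). wpath n \<omega> \<notin> regular_paths L e k} < r"
    "\<And>n. 1 \<le> n \<Longrightarrow> {\<omega> \<in> space (M n). wpath n \<omega> \<notin> regular_paths L e k} \<in> sets (M n)"
proof -
  from order_tendstoD(1)[OF regular_paths_exhaust[OF L e wiener], of "1 - r"] r
  obtain k where k: "1 - r < measure wiener (regular_paths L e k)"
    by (auto simp: eventually_sequentially)
  show ?thesis
  proof (rule that[of k])
    fix n :: nat assume n: "1 \<le> n"
    interpret prob_space "M n" by (rule prob_M[OF n])
    let ?G = "wpath n -` regular_paths L e k \<inter> space (M n)"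
    have G: "?G \<in> sets (M n)" by (rule measurable_sets[OF wpath_measurable[OF n] regular_paths_sets[OF L]])
    have eq: "{\<omega> \<in> space (M n). wpath n \<omega> \<notin> regular_paths L e k} = space (M n) - ?G" by auto
    show "{\<omega> \<in> space (M n). wpath n \<omega> \<notin> regular_paths L e k} \<in> sets (M n)" unfolding eq using G by auto
    have "prob ?G = measure wiener (regular_paths L e k)"
      unfolding w_law[OF n, symmetric]
      by (rule measure_distr[OF wpath_measurable[OF n] regular_paths_sets[OF L], symmetric])
    then show "prob {\<omega> \<in> space (M n). wpath n \<omega> \<notin> regular_paths L e k} < r"
      unfolding eq prob_compl[OF G] using k by simp
  qed
qed

lemma Gs_nonneg: "0 < t \<Longrightarrow> t \<le> T \<Longrightarrow> 0 \<le> Gs t"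
  by (rule LIMSEQ_le_const[OF G_lim]) (auto intro!: mult_nonneg_nonneg G_nonneg less_imp_le[OF c])

text \<open>
  In the original time the interval \<open>[n t', n t]\<close> is long, so \<open>delayed_growth\<close> applies to
  \<open>x = c X\<close> and \<open>h = c (- lam X + \<nu> W (f X))\<close>. It yields a time at which
  \<open>(1 + lam) x - \<nu> w (c\<^sup>2 f (x / c)) \<ge> c G - e\<close>. Replacing \<open>c\<^sup>2 f (x / c)\<close> by \<open>fs x\<close> costs another \<open>e\<close> on
  regular paths.
\<close>

lemma reaches_level:
  assumes n: "1 \<le> n" and t: "0 < t'" "t' < t" "t \<le> T" and \<omega>: "\<omega> \<in> space (M n)"
    and eq: "\<forall>s\<in>{0..real n * T}. X n s \<omega> = G s +
        (LINT r:{0..s}|lborel. K (s - r) * (- lam * X n r \<omega> + \<nu> * W n (f (X n r \<omega>)) \<omega>))"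
    and R: "0 < R" "y n t \<omega> \<le> R" and reg: "wpath n \<omega> \<in> regular_paths L \<epsilon> k"
    and L: "fs R + 1 \<le> L"
    and close: "\<And>x. x \<in> {0..R} \<Longrightarrow> \<bar>(c n)\<^sup>2 * f (x / c n) - fs x\<bar> \<le> min 1 (1 / Suc k)"
    and e: "0 < e" "\<nu> * \<epsilon> \<le> e"
    and D: "0 \<le> D" "(1 - mass D) * (R + e + (lam * R + \<nu> * real k)) \<le> e / 2"
    and j: "real j * D \<le> real n * (t - t')" "R < real j * (e / 2)"
  shows "\<exists>x\<in>{0..y n t \<omega>}. c n * G (real n * t') - 2 * e \<le> lim.drifted (\<lambda>s. w n s \<omega>) x"
proof -
  interpret weak_sol K lam \<nu> f "M n" "F n" "W n" "X n" "real n * T" G by (rule ws[OF n])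
  interpret S: passage_bm "M n" "\<lambda>t. F n (t / (c n)\<^sup>2)" "w n" lam \<nu> fs C by (rule pb[OF n])
  have c0: "0 < c n" by (rule c)
  have n0: "0 < real n" using n by simp
  define a where "a = real n * t'"
  define b where "b = real n * t"
  have ab: "0 < a" "a < b" "b \<le> real n * T" using n0 t by (auto simp: a_def b_def)
  have sub: "{0..b} \<subseteq> {0..real n * T}" using ab by auto
  define x where "x s = c n * X n s \<omega>" for s
  define h where "h s = c n * (- lam * X n s \<omega> + \<nu> * W n (f (X n s \<omega>)) \<omega>)" for s
  have x_b: "x b = y n t \<omega>" by (simp add: x_def y_def b_def)
  have xmono: "x s \<le> x r" if "0 \<le> s" "s \<le> r" "r \<le> b" for s r
    unfolding x_def using X_mono[OF \<omega> that(1,2)] that ab c0 by (intro mult_left_mono) auto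
  have x0: "0 \<le> x s" if "s \<in> {0..b}" for s
    unfolding x_def using X_nonneg[OF \<omega>, of s] that sub c0 by auto
  have xR: "x s \<in> {0..R}" if "s \<in> {0..b}" for s
    using x0[OF that] xmono[of s b] that R(2) x_b by auto
  have wW: "c n * W n (f (X n s \<omega>)) \<omega> = w n ((c n)\<^sup>2 * f (x s / c n)) \<omega>" for s
    using c0 by (simp add: w_def x_def)
  have time: "(c n)\<^sup>2 * f (x s / c n) \<in> {0..L}" "fs (x s) \<in> {0..L}"
    "\<bar>(c n)\<^sup>2 * f (x s / c n) - fs (x s)\<bar> \<le> 1 / Suc k" if s: "s \<in> {0..b}" for s
  proof -
    have 1: "\<bar>(c n)\<^sup>2 * f (x s / c n) - fs (x s)\<bar> \<le> min 1 (1 / Suc k)" by (rule close[OF xR[OF s]])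
    have 2: "fs (x s) \<le> fs R" "0 \<le> fs (x s)" using xR[OF s] by (auto intro: lim.f_le lim.f_nonneg)
    have 3: "0 \<le> (c n)\<^sup>2 * f (x s / c n)" using x0[OF s] c0 by (intro mult_nonneg_nonneg f_nonneg) auto
    show "(c n)\<^sup>2 * f (x s / c n) \<in> {0..L}" "fs (x s) \<in> {0..L}" "\<bar>(c n)\<^sup>2 * f (x s / c n) - fs (x s)\<bar> \<le> 1 / Suc k"
    proof -
      have 1: "\<bar>(c n)\<^sup>2 * f (x s / c n) - fs (x s)\<bar> \<le> 1" "\<bar>(c n)\<^sup>2 * f (x s / c n) - fs (x s)\<bar> \<le> 1 / Suc k"
        using 1 unfolding min.bounded_iff by blast+
      show "(c n)\<^sup>2 * f (x s / c n) \<in> {0..L}" using 1(1) 2 3 L unfolding atLeastAtMost_iff by linarith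
      show "fs (x s) \<in> {0..L}" using 2 L by simp
      show "\<bar>(c n)\<^sup>2 * f (x s / c n) - fs (x s)\<bar> \<le> 1 / Suc k" by (rule 1(2))
    qed
  qed
  have reg': "\<bar>w n p \<omega> - w n q \<omega>\<bar> \<le> \<epsilon>" "\<bar>w n p \<omega>\<bar> \<le> real k"
    if "p \<in> {0..L}" "q \<in> {0..L}" "\<bar>p - q\<bar> \<le> 1 / Suc k" for p q
  proof -
    have "\<bar>S.path \<omega> p - S.path \<omega> q\<bar> \<le> \<epsilon> \<and> \<bar>S.path \<omega> p\<bar> \<le> real k"
      using reg that unfolding regular_paths_def by blast
    then show "\<bar>w n p \<omega> - w n q \<omega>\<bar> \<le> \<epsilon>" "\<bar>w n p \<omega>\<bar> \<le> real k"
      using that S.path_eq[of p \<omega>] S.path_eq[of q \<omega>] by auto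
  qed
  have "\<exists>s\<in>{a..b}. h s \<le> x s - c n * G a + e"
  proof (rule delayed_growth[where b = b and G = "\<lambda>s. c n * G s" and C = "lam * R + \<nu> * real k" and R = R and L = D and k = j])
    fix s assume s: "0 \<le> s" "s \<le> b"
    have "x s = c n * G s + c n * (LINT r:{0..s}|lborel. K (s - r) * (- lam * X n r \<omega> + \<nu> * W n (f (X n r \<omega>)) \<omega>))"
      using eq s ab by (auto simp: x_def distrib_left[symmetric])
    also have "c n * (LINT r:{0..s}|lborel. K (s - r) * (- lam * X n r \<omega> + \<nu> * W n (f (X n r \<omega>)) \<omega>))
      = (LINT r:{0..s}|lborel. K (s - r) * h r)"
      unfolding set_integral_mult_right[symmetric]
      by (rule set_lebesgue_integral_cong) (auto simp: h_def)
    finally show "x s = c n * G s + (LINT r:{0..s}|lborel. K (s - r) * h r)" .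
  next
    have cm: "continuous_on {0..b} (\<lambda>s. mart s \<omega>)" and cX: "continuous_on {0..b} (\<lambda>s. X n s \<omega>)"
      using continuous_on_subset[OF mart_continuous[OF \<omega>] sub] continuous_on_subset[OF X_continuous[OF \<omega>] sub] by auto
    show "continuous_on {0..b} h"
      unfolding h_def by (intro continuous_intros cm[unfolded mart_def] cX)
  next
    fix s assume s: "s \<in> {0..b}"
    have "h s = - lam * x s + \<nu> * (c n * W n (f (X n s \<omega>)) \<omega>)" by (simp add: h_def x_def algebra_simps)
    also have "\<bar>\<dots>\<bar> \<le> lam * x s + \<nu> * \<bar>c n * W n (f (X n s \<omega>)) \<omega>\<bar>"
      using lam \<nu> x0[OF s] by (intro order_trans[OF abs_triangle_ineq]) (simp add: abs_mult)
    also have "\<dots> \<le> lam * R + \<nu> * real k"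
    proof (intro add_mono mult_left_mono lam \<nu>)
      show "x s \<le> R" using xR[OF s] by simp
      show "\<bar>c n * W n (f (X n s \<omega>)) \<omega>\<bar> \<le> real k" unfolding wW by (rule reg'(2)[OF time[OF s]])
    qed
    finally show "\<bar>h s\<bar> \<le> lam * R + \<nu> * real k" .
  next
    show "mono_on {0..b} x" using xmono by (auto simp: mono_on_def)
    show "0 \<le> x 0" using x0[of 0] ab by simp
    show "x b \<le> R" using R(2) x_b by simp
    show "mono_on {0..b} (\<lambda>s. c n * G s)"
      using G_mono c0 by (auto simp: mono_on_def intro!: mult_left_mono)
    show "0 \<le> c n * G a" using G_nonneg[of a] ab c0 by simp
    show "a + real j * D \<le> b" using j(1) by (simp add: a_def b_def algebra_simps)
  qed (use D e j ab in auto)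
  then obtain s where s: "s \<in> {a..b}" "h s \<le> x s - c n * G a + e" by blast
  have sb: "s \<in> {0..b}" using s ab by auto
  have hs: "h s = - lam * x s + \<nu> * w n ((c n)\<^sup>2 * f (x s / c n)) \<omega>"
    unfolding wW[symmetric] by (simp add: h_def x_def algebra_simps)
  have "\<nu> * w n (fs (x s)) \<omega> \<le> \<nu> * (w n ((c n)\<^sup>2 * f (x s / c n)) \<omega> + \<epsilon>)"
    using reg'(1)[OF time[OF sb]] \<nu> by (intro mult_left_mono) auto
  then have "\<nu> * w n (fs (x s)) \<omega> \<le> \<nu> * w n ((c n)\<^sup>2 * f (x s / c n)) \<omega> + e"
    using e(2) by (simp add: distrib_left)
  then have "c n * G a - 2 * e \<le> lim.drifted (\<lambda>s. w n s \<omega>) (x s)"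
    using s(2) hs by (simp add: lim.drifted_def algebra_simps)
  moreover have "x s \<in> {0..y n t \<omega>}" using x0[OF sb] xmono[of s b] sb x_b by auto
  ultimately show ?thesis by (auto simp: a_def)
qed

text \<open>
  The bad events are a large value of \<open>y n t\<close>, which is rare by Markov's inequality and the bound on the
  mean, and an irregular Brownian path, which is rare uniformly in \<open>n\<close> by equality in law.
\<close>

lemma hit_le_y_likely:
  assumes t: "0 < t" "t \<le> T" and h: "h < Gs t"
  shows "(\<lambda>n. measure (M n) {\<omega> \<in> space (M n). y n t \<omega> < hit n h \<omega>}) \<longlonglongrightarrow> 0"
proof (rule LIMSEQ_I)
  fix \<eta> :: real assume \<eta>: "0 < \<eta>"
  obtain t' where t': "0 < t'" "t' < t" "h < Gs t'" using Gs_left[OF t h] by blast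
  define e where "e = (Gs t' - h) / 4"
  have e: "0 < e" and h4: "Gs t' = h + 4 * e" using t' by (simp_all add: e_def field_simps)
  \<comment> \<open>By Markov's inequality \<open>y n t\<close> exceeds \<open>R\<close> with probability below \<open>\<eta> / 2\<close>.\<close>
  define R where "R = 2 * (Gs t + 1) / \<eta> + 1"
  have g0: "0 \<le> Gs t" by (rule Gs_nonneg[OF t])
  have R: "0 < R" using g0 \<eta> by (simp add: R_def add_nonneg_pos)
  have Rb: "(Gs t + 1) / R < \<eta> / 2"
  proof -
    have "2 * (Gs t + 1) < R * \<eta>" using \<eta> by (simp add: R_def field_simps)
    then show ?thesis using R by (simp add: field_simps)
  qed
  define \<epsilon> where "\<epsilon> = e / (\<nu> + 1)"
  have \<epsilon>: "0 < \<epsilon>" "\<nu> * \<epsilon> \<le> e" using e \<nu> by (auto simp: \<epsilon>_def field_simps)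
  define L where "L = fs R + 1"
  have L: "0 < L" using lim.f_nonneg[of R] R by (simp add: L_def)
  obtain k where k: "\<And>n. 1 \<le> n \<Longrightarrow> measure (M n) {\<omega> \<in> space (M n). wpath n \<omega> \<notin> regular_paths L \<epsilon> k} < \<eta> / 2"
    "\<And>n. 1 \<le> n \<Longrightarrow> {\<omega> \<in> space (M n). wpath n \<omega> \<notin> regular_paths L \<epsilon> k} \<in> sets (M n)"
    using wpath_regular[OF L \<epsilon>(1), of "\<eta> / 2"] \<eta> by auto
  define C' where "C' = R + e + (lam * R + \<nu> * real k)"
  have C': "0 < C'"
  proof -
    have "0 \<le> lam * R" "0 \<le> \<nu> * real k" using lam \<nu> R by auto
    then show ?thesis using R e unfolding C'_def by linarith
  qed
  have "1 - e / (2 * C') < 1" using e C' by simp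
  from order_tendstoD(1)[OF mass_tendsto this]
  obtain D0 where D0: "\<And>d. D0 \<le> d \<Longrightarrow> 1 - e / (2 * C') < mass d" by (auto simp: eventually_at_top_linorder)
  define D where "D = max 0 D0"
  have D: "0 \<le> D" "(1 - mass D) * C' \<le> e / 2"
  proof -
    have "1 - mass D \<le> e / (2 * C')" using D0[of D] by (simp add: D_def)
    then have "(1 - mass D) * C' \<le> e / (2 * C') * C'" using C' by (intro mult_right_mono) auto
    then show "(1 - mass D) * C' \<le> e / 2" using C' by simp
  qed (simp add: D_def)
  obtain j :: nat where j: "R / (e / 2) < real j" using reals_Archimedean2 by blast
  have j2: "R < real j * (e / 2)" using j e by (simp add: field_simps)
  have "0 < min 1 (1 / real (Suc k))" by simp
  from f_lim[OF this] have ev1: "\<forall>\<^sub>F n in sequentially. \<forall>x\<in>{0..R}. \<bar>(c n)\<^sup>2 * f (x / c n) - fs x\<bar> \<le> min 1 (1 / real (Suc k))" .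
  have ev2: "\<forall>\<^sub>F n in sequentially. c n * G (real n * t) < Gs t + 1"
    using G_lim[OF t] by (rule order_tendstoD) simp
  have ev3: "\<forall>\<^sub>F n in sequentially. Gs t' - e < c n * G (real n * t')"
    using t' t e by (intro order_tendstoD(1)[OF G_lim]) auto
  have ev4: "\<forall>\<^sub>F n in sequentially. real j * D / (t - t') \<le> real n"
    by (rule eventually_compose_filterlim[OF eventually_ge_at_top filterlim_real_sequentially])
  have "\<forall>\<^sub>F n in sequentially. norm (measure (M n) {\<omega> \<in> space (M n). y n t \<omega> < hit n h \<omega>} - 0) < \<eta>"
    using ev1 ev2 ev3 ev4 eventually_ge_at_top[of 1]
  proof eventually_elim
    case (elim n)
    note n = elim(5)
    interpret prob_space "M n" by (rule prob_M[OF n])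
    note yf = y_facts[OF n less_imp_le[OF t(1)] t(2)]
    have jD: "real j * D \<le> real n * (t - t')" using elim(4) t' by (simp add: field_simps)
    let ?A = "{\<omega> \<in> space (M n). R \<le> y n t \<omega>}"
    let ?E = "{\<omega> \<in> space (M n). wpath n \<omega> \<notin> regular_paths L \<epsilon> k}"
    let ?H = "{\<omega> \<in> space (M n). y n t \<omega> < hit n h \<omega>}"
    have ym: "y n t \<in> borel_measurable (M n)" using yf(1) by auto
    have As: "?A \<in> sets (M n)" using ym by measurable
    have "prob ?A \<le> (\<integral>\<omega>. y n t \<omega> \<partial>M n) / R"
      by (rule integral_Markov_inequality_measure[OF yf(1), where A = "{}"]) (use yf(2) R in auto)
    also have "\<dots> \<le> (Gs t + 1) / R" using yf(3) elim(2) R by (intro divide_right_mono) auto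
    also have "\<dots> < \<eta> / 2" by (rule Rb)
    finally have A: "prob ?A < \<eta> / 2" .
    have "AE \<omega> in M n. \<omega> \<in> ?H \<longrightarrow> \<omega> \<in> ?A \<union> ?E"
    proof -
      interpret weak_sol K lam \<nu> f "M n" "F n" "W n" "X n" "real n * T" G by (rule ws[OF n])
      show ?thesis using equation[unfolded mart_def]
      proof eventually_elim
        case (elim \<omega>)
        show ?case
        proof (rule impI, rule ccontr)
          assume H: "\<omega> \<in> ?H" and "\<omega> \<notin> ?A \<union> ?E"
          then have \<omega>: "\<omega> \<in> space (M n)" "y n t \<omega> \<le> R" "wpath n \<omega> \<in> regular_paths L \<epsilon> k" by auto
          have "\<exists>x\<in>{0..y n t \<omega>}. c n * G (real n * t') - 2 * e \<le> lim.drifted (\<lambda>s. w n s \<omega>) x"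
          proof (rule reaches_level[OF n t'(1,2) t(2) \<omega>(1) elim R \<omega>(2,3)])
            show "fs R + 1 \<le> L" by (simp add: L_def)
            show "\<bar>(c n)\<^sup>2 * f (x / c n) - fs x\<bar> \<le> min 1 (1 / real (Suc k))" if "x \<in> {0..R}" for x
              using \<open>\<forall>x\<in>{0..R}. \<bar>(c n)\<^sup>2 * f (x / c n) - fs x\<bar> \<le> min 1 (1 / real (Suc k))\<close> that by blast
            show "(1 - mass D) * (R + e + (lam * R + \<nu> * real k)) \<le> e / 2" using D(2) by (simp add: C'_def)
          qed (use e \<epsilon>(2) D(1) jD j2 in auto)
          then obtain x where x: "0 \<le> x" "x \<le> y n t \<omega>" "c n * G (real n * t') - 2 * e \<le> lim.drifted (\<lambda>s. w n s \<omega>) x"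
            by auto
          have "h < lim.drifted (\<lambda>s. w n s \<omega>) x" using x(3) \<open>Gs t' - e < c n * G (real n * t')\<close> e h4 by linarith
          then have "hit n h \<omega> \<le> x" unfolding hit_def by (rule lim.first_passage_le[OF x(1)])
          then show False using H x(2) by simp
        qed
      qed
    qed
    then have "prob ?H \<le> prob (?A \<union> ?E)"
      by (rule finite_measure_mono_AE) (use As k(2)[OF n] in blast)
    also have "\<dots> \<le> prob ?A + prob ?E" by (rule measure_Un_le[OF As k(2)[OF n]])
    also have "\<dots> < \<eta>" using A k(1)[OF n] by simp
    finally show ?case by simp
  qed
  then show "\<exists>n0. \<forall>n\<ge>n0. norm (measure (M n) {\<omega> \<in> space (M n). y n t \<omega> < hit n h \<omega>} - 0) < \<eta>"
    by (simp add: eventually_sequentially)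
qed

text \<open>
  An upper bound for the mean of the positive part of \<open>hit n h - y n t\<close>.
\<close>

definition deficit :: "nat \<Rightarrow> real \<Rightarrow> real \<Rightarrow> real" where
  "deficit n t h = (\<integral>\<omega>. hit n h \<omega> * indicator {\<omega> \<in> space (M n). y n t \<omega> < hit n h \<omega>} \<omega> \<partial>M n)"

lemma deficit_set: "1 \<le> n \<Longrightarrow> 0 \<le> t \<Longrightarrow> t \<le> T \<Longrightarrow> {\<omega> \<in> space (M n). y n t \<omega> < hit n h \<omega>} \<in> sets (M n)"
  using borel_measurable_integrable[OF y_facts(1)] borel_measurable_integrable[OF hit_moments(1)]
  by (intro borel_measurable_less) auto

lemma deficit_tendsto:
  assumes "0 < t" "t \<le> T" "h < Gs t"
  shows "(\<lambda>n. deficit n t h) \<longlonglongrightarrow> 0"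
  unfolding deficit_def
  by (rule passage_small_on_small_events[OF deficit_set hit_le_y_likely[OF assms]]) (use assms in auto)

lemma deficit_integrable:
  assumes n: "1 \<le> n" and t: "0 \<le> t" "t \<le> T"
  shows "integrable (M n) (\<lambda>\<omega>. hit n h \<omega> * indicator {\<omega> \<in> space (M n). y n t \<omega> < hit n h \<omega>} \<omega>)"
  using integrable_mult_indicator[OF deficit_set[OF n t] hit_moments(1)[OF n]]
  by (simp add: mult.commute)

lemma mean_lower:
  assumes n: "1 \<le> n" and t: "0 \<le> t" "t \<le> T"
  shows "max 0 h / (1 + lam) - deficit n t h \<le> (\<integral>\<omega>. y n t \<omega> \<partial>M n)"
proof -
  let ?E = "{\<omega> \<in> space (M n). y n t \<omega> < hit n h \<omega>}"
  have "max 0 h / (1 + lam) - deficit n t h = (\<integral>\<omega>. hit n h \<omega> - hit n h \<omega> * indicator ?E \<omega> \<partial>M n)"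
    using hit_moments(1,2)[OF n, of h] deficit_integrable[OF n t, of h] by (simp add: deficit_def)
  also have "\<dots> \<le> (\<integral>\<omega>. y n t \<omega> \<partial>M n)"
  proof (rule integral_mono)
    show "hit n h \<omega> - hit n h \<omega> * indicator ?E \<omega> \<le> y n t \<omega>" if "\<omega> \<in> space (M n)" for \<omega>
      using y_facts(2)[OF n t that] that by (auto simp: indicator_def)
  qed (use hit_moments(1)[OF n] deficit_integrable[OF n t] y_facts(1)[OF n t] in auto)
  finally show ?thesis .
qed

text \<open>
  The lower bound for the mean at an earlier time \<open>t'\<close> is inserted into the mean bound at time \<open>t\<close>:
  \<open>E y(t) + lam E y(t') \<le> Gs t\<close> up to small errors, where \<open>E y(t')\<close> is nearly at least \<open>Gs t / (1 + lam)\<close>.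
  In this form the argument also covers the final time.
\<close>

lemma mean_upper:
  assumes t: "0 < t" "t \<le> T" and r: "0 < r"
  shows "\<forall>\<^sub>F n in sequentially. (\<integral>\<omega>. y n t \<omega> \<partial>M n) < Gs t / (1 + lam) + r"
proof -
  have lam1: "0 < 1 + lam" using lam by simp
  obtain t' where t': "0 < t'" "t' < t" "Gs t - r < Gs t'" using Gs_left[OF t, of "Gs t - r"] r by auto
  define h where "h = Gs t - r"
  let ?u = "\<lambda>n. c n * G (real n * t) - lam * mass (real n * (t - t')) * (max 0 h / (1 + lam) - deficit n t' h)"
  have m: "(\<lambda>n. mass (real n * (t - t'))) \<longlonglongrightarrow> 1"
    by (rule filterlim_compose[OF mass_tendsto])
      (use t' in \<open>intro filterlim_at_top_mult_tendsto_pos[OF tendsto_const] filterlim_real_sequentially, auto\<close>)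
  have "?u \<longlonglongrightarrow> Gs t - lam * 1 * (max 0 h / (1 + lam) - 0)"
    by (intro tendsto_intros m G_lim[OF t] deficit_tendsto) (use t' t in \<open>auto simp: h_def\<close>)
  moreover have "Gs t - lam * 1 * (max 0 h / (1 + lam) - 0) < Gs t / (1 + lam) + r"
  proof -
    have "lam * (h / (1 + lam)) \<le> lam * (max 0 h / (1 + lam))"
      using lam lam1 by (intro mult_left_mono divide_right_mono) auto
    moreover have "Gs t - lam * (h / (1 + lam)) = Gs t / (1 + lam) + lam / (1 + lam) * r"
    proof -
      have q: "1 / (1 + lam) = 1 - lam / (1 + lam)" using lam1 by (simp add: field_simps)
      have "Gs t / (1 + lam) = Gs t * (1 / (1 + lam))" by simp
      also have "\<dots> = Gs t - lam / (1 + lam) * Gs t" unfolding q by (simp add: algebra_simps)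
      finally show ?thesis by (simp add: h_def algebra_simps diff_divide_distrib)
    qed
    moreover have "lam / (1 + lam) * r < 1 * r" using lam1 r by (intro mult_strict_right_mono) auto
    ultimately show ?thesis by simp
  qed
  ultimately have "\<forall>\<^sub>F n in sequentially. ?u n < Gs t / (1 + lam) + r" by (rule order_tendstoD)
  then show ?thesis using eventually_ge_at_top[of 1]
  proof eventually_elim
    case (elim n)
    have le: "lam * mass (real n * (t - t')) * (max 0 h / (1 + lam) - deficit n t' h)
      \<le> lam * mass (real n * (t - t')) * (\<integral>\<omega>. y n t' \<omega> \<partial>M n)"
      using lam mass_bounds(1) mean_lower[OF elim(2), of t' h] t' t by (intro mult_left_mono) auto
    show ?case using y_facts(4)[OF elim(2), of t t'] t t' le elim(1) by simp
  qed
qed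

text \<open>
  Up to a small error \<open>y n t\<close> dominates the passage time at a level \<open>h\<close> just below \<open>Gs t\<close>, while its mean
  is asymptotically at most the mean of the passage time at \<open>Gs t\<close>. As these two means differ by \<open>(Gs t - h) / (1 + lam)\<close>,
  all three variables are close in \<open>L\<^sup>1\<close>.
\<close>

lemma y_hit_L1:
  assumes t: "0 < t" "t \<le> T"
  shows "(\<lambda>n. \<integral>\<omega>. \<bar>y n t \<omega> - hit n (Gs t) \<omega>\<bar> \<partial>M n) \<longlonglongrightarrow> 0"
proof (rule LIMSEQ_I)
  fix r :: real assume r: "0 < r"
  have lam1: "1 \<le> 1 + lam" using lam by simp
  \<comment> \<open>Each of the error terms below is at most \<open>r / 8\<close>.\<close>
  define h where "h = Gs t - r / 8"
  have h: "h < Gs t" using r by (simp add: h_def)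
  have g0: "0 \<le> Gs t" by (rule Gs_nonneg[OF t])
  have "\<forall>\<^sub>F n in sequentially. deficit n t h < r / 8"
    using r by (intro order_tendstoD(2)[OF deficit_tendsto[OF t h]]) auto
  moreover have "\<forall>\<^sub>F n in sequentially. (\<integral>\<omega>. y n t \<omega> \<partial>M n) < Gs t / (1 + lam) + r / 8"
    using mean_upper[OF t] r by auto
  ultimately have "\<forall>\<^sub>F n in sequentially. norm ((\<integral>\<omega>. \<bar>y n t \<omega> - hit n (Gs t) \<omega>\<bar> \<partial>M n) - 0) < r"
    using eventually_ge_at_top[of 1]
  proof eventually_elim
    case (elim n)
    note n = elim(3)
    let ?E = "{\<omega> \<in> space (M n). y n t \<omega> < hit n h \<omega>}"
    have t0: "0 \<le> t" using t by simp
    note I = y_facts(1)[OF n t0 t(2)] hit_moments(1)[OF n] deficit_integrable[OF n t0 t(2)]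
    have "(\<integral>\<omega>. \<bar>y n t \<omega> - hit n (Gs t) \<omega>\<bar> \<partial>M n)
      \<le> (\<integral>\<omega>. (y n t \<omega> - hit n h \<omega>) + 2 * (hit n h \<omega> * indicator ?E \<omega>) + (hit n (Gs t) \<omega> - hit n h \<omega>) \<partial>M n)"
    proof (rule integral_mono_AE)
      show "AE \<omega> in M n. \<bar>y n t \<omega> - hit n (Gs t) \<omega>\<bar>
        \<le> (y n t \<omega> - hit n h \<omega>) + 2 * (hit n h \<omega> * indicator ?E \<omega>) + (hit n (Gs t) \<omega> - hit n h \<omega>)"
        using hit_moments(4)[OF n less_imp_le[OF h]] AE_space
      proof eventually_elim
        case (elim \<omega>)
        then show ?case using y_facts(2)[OF n t0 t(2) elim(2)] by (cases "\<omega> \<in> ?E") auto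
      qed
    qed (use I in auto)
    also have "\<dots> = (\<integral>\<omega>. y n t \<omega> \<partial>M n) - max 0 h / (1 + lam) + 2 * deficit n t h
        + (Gs t / (1 + lam) - max 0 h / (1 + lam))"
      using I hit_moments(2)[OF n] g0 by (simp add: deficit_def)
    also have "\<dots> < Gs t / (1 + lam) + r / 8 + 2 * (r / 8) + Gs t / (1 + lam) - 2 * (max 0 h / (1 + lam))"
      using elim(1,2) by simp
    also have "\<dots> \<le> r"
    proof -
      have "(Gs t - max 0 h) / (1 + lam) \<le> r / 8 / (1 + lam)"
      proof (rule divide_right_mono)
        show "Gs t - max 0 h \<le> r / 8" using max.cobounded2[of h 0] unfolding h_def by linarith
        show "0 \<le> 1 + lam" using lam1 by linarith
      qed
      also have "\<dots> \<le> r / 8" using lam1 r by (simp add: divide_le_eq mult_left_mono)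
      finally have "Gs t / (1 + lam) - max 0 h / (1 + lam) \<le> r / 8" by (simp add: diff_divide_distrib)
      then show ?thesis using r by linarith
    qed
    finally show ?case by simp
  qed
  then show "\<exists>n0. \<forall>n\<ge>n0. norm ((\<integral>\<omega>. \<bar>y n t \<omega> - hit n (Gs t) \<omega>\<bar> \<partial>M n) - 0) < r"
    by (simp add: eventually_sequentially)
qed

lemma y_hit_in_probability:
  assumes t: "0 < t" "t \<le> T" and e: "0 < e"
  shows "(\<lambda>n. measure (M n) {\<omega> \<in> space (M n). e \<le> \<bar>y n t \<omega> - hit n (Gs t) \<omega>\<bar>}) \<longlonglongrightarrow> 0"
proof (rule tendsto_sandwich[where f = "\<lambda>_. 0" and h = "\<lambda>n. (\<integral>\<omega>. \<bar>y n t \<omega> - hit n (Gs t) \<omega>\<bar> \<partial>M n) / e"])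
  show "\<forall>\<^sub>F n in sequentially. measure (M n) {\<omega> \<in> space (M n). e \<le> \<bar>y n t \<omega> - hit n (Gs t) \<omega>\<bar>}
      \<le> (\<integral>\<omega>. \<bar>y n t \<omega> - hit n (Gs t) \<omega>\<bar> \<partial>M n) / e"
    using eventually_ge_at_top[of 1]
  proof eventually_elim
    case (elim n)
    have "integrable (M n) (\<lambda>\<omega>. \<bar>y n t \<omega> - hit n (Gs t) \<omega>\<bar>)"
      using y_facts(1)[OF elim, of t] hit_moments(1)[OF elim] t by auto
    then show ?case by (rule integral_Markov_inequality_measure[where A = "{}"]) (use e in auto)
  qed
  show "(\<lambda>n. (\<integral>\<omega>. \<bar>y n t \<omega> - hit n (Gs t) \<omega>\<bar> \<partial>M n) / e) \<longlonglongrightarrow> 0"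
    using tendsto_divide[OF y_hit_L1[OF t] tendsto_const[of e]] e by simp
qed auto

end

section \<open>The limit in path space\<close>

lemma grid_osc_measurable: "grid_osc N k \<in> borel_measurable path_space"
proof -
  have "(\<lambda>\<phi>. SUP t\<in>{0..real N} \<inter> \<rat>. \<bar>\<phi> t - \<phi> (of_int \<lfloor>t * Suc k\<rfloor> / Suc k)\<bar>) \<in> borel_measurable path_space"
  proof (rule borel_measurable_cSUP)
    show "countable ({0..real N} \<inter> \<rat>)" by (intro countable_Int2 countable_rat)
    show "(\<lambda>\<phi>. \<bar>\<phi> t - \<phi> (of_int \<lfloor>t * Suc k\<rfloor> / Suc k)\<bar>) \<in> borel_measurable path_space"
      if "t \<in> {0..real N} \<inter> \<rat>" for t :: real
    proof -
      have t0: "0 \<le> t" and f0: "0 \<le> of_int \<lfloor>t * Suc k\<rfloor> / real (Suc k)" using that by auto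
      from eval_measurable[OF t0] eval_measurable[OF f0] show ?thesis by measurable
    qed
  qed (use grid_osc_bdd in auto)
  then show ?thesis by (simp add: grid_osc_def[abs_def])
qed

lemma C_tests_measurable: "h \<in> C_tests \<Longrightarrow> h \<in> borel_measurable path_space"
  by (auto simp: C_tests_def intro: eval_measurable grid_osc_measurable)

context time_change
begin

text \<open>
  Almost every Brownian path is good. On the others the passage process is set to \<open>0\<close>, so that it always
  belongs to the path space.
\<close>

definition good_path :: "(real \<Rightarrow> real) \<Rightarrow> bool" where
  "good_path \<phi> \<longleftrightarrow> (\<forall>g. \<exists>s\<ge>0. g < drifted \<phi> s)"

definition passage_process :: "real \<Rightarrow> (real \<Rightarrow> real) \<Rightarrow> (real \<Rightarrow> real) \<Rightarrow> real \<Rightarrow> real" where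
  "passage_process T g \<phi> = (\<lambda>t\<in>{0..T}. if good_path \<phi> then passage (g t) \<phi> else 0)"

lemma passage_eq: "passage g \<phi> = Inf {s. 0 \<le> s \<and> g < drifted \<phi> s}"
  unfolding passage_def first_passage_eq ..

lemma passage_mono:
  assumes "good_path \<phi>" "g \<le> g'"
  shows "passage g \<phi> \<le> passage g' \<phi>"
  unfolding passage_eq
proof (rule cInf_superset_mono)
  show "{s. 0 \<le> s \<and> g' < drifted \<phi> s} \<noteq> {}" using assms(1) by (auto simp: good_path_def)
  show "bdd_below {s. 0 \<le> s \<and> g < drifted \<phi> s}" by (rule bdd_belowI[of _ 0]) auto
qed (use assms in auto)

lemma passage_nonneg: "good_path \<phi> \<Longrightarrow> 0 \<le> passage g \<phi>"
  unfolding passage_eq good_path_def by (intro cInf_greatest) auto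

text \<open>
  A value of the drifted path above \<open>g\<close> is also above every level slightly larger than \<open>g\<close>.
\<close>

lemma passage_right_continuous:
  assumes "good_path \<phi>" "0 < e"
  obtains g' where "g < g'" "passage g' \<phi> < passage g \<phi> + e"
proof -
  have lt: "Inf {s. 0 \<le> s \<and> g < drifted \<phi> s} < passage g \<phi> + e" using assms(2) by (simp add: passage_eq)
  have "{s. 0 \<le> s \<and> g < drifted \<phi> s} \<noteq> {}" using assms(1) by (auto simp: good_path_def)
  from cInf_lessD[OF this lt] obtain s where s: "0 \<le> s" "g < drifted \<phi> s" "s < passage g \<phi> + e"
    by blast
  obtain g' where g': "g < g'" "g' < drifted \<phi> s" using dense[OF s(2)] by blast
  have "passage g' \<phi> \<le> s" unfolding passage_eq
    using g' s by (intro cInf_lower) (auto intro!: bdd_belowI[of _ 0])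
  then show ?thesis using that g' s by force
qed

lemma passage_process_in_D_up:
  assumes T: "0 < T" and g: "continuous_on {0..T} g" "mono_on {0..T} g"
  shows "passage_process T g \<phi> \<in> D_up_paths T"
proof (cases "good_path \<phi>")
  case False
  define p where "p = passage_process T g \<phi>"
  have ext: "p \<in> extensional {0..T}" by (simp add: p_def passage_process_def)
  have z: "p s = 0" if "s \<in> {0..T}" for s using False that by (simp add: p_def passage_process_def)
  have "(p \<longlongrightarrow> 0) (at_right t)" if "t \<in> {0..<T}" for t
    by (rule tendsto_eventually, subst eventually_at_right[of _ T]) (use that z in auto)
  moreover have "(p \<longlongrightarrow> 0) (at_left t)" if "t \<in> {0<..T}" for t
    by (rule tendsto_eventually, subst eventually_at_left[of 0]) (use that z in \<open>auto intro!: exI[of _ 0]\<close>)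
  ultimately have "cadlag_on T p" unfolding cadlag_on_def using z by fastforce
  then have "p \<in> D_up_paths T" using z ext by (auto simp: D_up_paths_def mono_on_def)
  then show ?thesis by (simp add: p_def)
next
  case good: True
  define p where "p = passage_process T g \<phi>"
  have p: "p s = passage (g s) \<phi>" if "s \<in> {0..T}" for s using that good by (simp add: p_def passage_process_def)
  have mono: "p s \<le> p t" if "0 \<le> s" "s \<le> t" "t \<le> T" for s t
    using that g(2) p passage_mono[OF good] by (auto simp: mono_on_def)
  have right: "(p \<longlongrightarrow> p t) (at_right t)" if t: "t \<in> {0..<T}" for t
  proof (rule decreasing_tendsto)
    show "\<forall>\<^sub>F r in at_right t. p t \<le> p r"
      by (subst eventually_at_right[of _ T]) (use t mono in auto)
    fix x assume x: "p t < x"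
    obtain g' where g': "g t < g'" "passage g' \<phi> < x"
      using passage_right_continuous[OF good, of "x - p t" "g t"] x p[of t] t by auto
    have "(g \<longlongrightarrow> g t) (at t within {0..T})" using g(1) t by (auto simp: continuous_on_def)
    then have "\<forall>\<^sub>F r in at t within {0..T}. g r < g'" using g'(1) by (rule order_tendstoD)
    then obtain d where d: "0 < d" "\<And>r. r \<in> {0..T} \<Longrightarrow> r \<noteq> t \<Longrightarrow> dist r t < d \<Longrightarrow> g r < g'"
      unfolding eventually_at by blast
    have "p r < x" if r: "t < r" "r < min T (t + d)" for r
    proof -
      have "g r < g'" using r t by (intro d(2)) (auto simp: dist_real_def)
      then have "passage (g r) \<phi> \<le> passage g' \<phi>" by (intro passage_mono[OF good]) simp
      then show ?thesis using g'(2) p[of r] r t by auto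
    qed
    then show "\<forall>\<^sub>F r in at_right t. p r < x"
      using t d(1) by (subst eventually_at_right[of _ T]) (auto intro!: exI[of _ "min T (t + d)"])
  qed
  have left: "\<exists>l. (p \<longlongrightarrow> l) (at_left t)" if t: "t \<in> {0<..T}" for t
  proof (rule exI[of _ "Sup (p ` {0..<t})"], rule increasing_tendsto)
    have bdd: "bdd_above (p ` {0..<t})" by (rule bdd_aboveI2[of _ _ "p T"]) (use mono t in auto)
    show "\<forall>\<^sub>F r in at_left t. p r \<le> Sup (p ` {0..<t})"
      by (subst eventually_at_left[of 0]) (use t bdd in \<open>auto intro!: exI[of _ 0] cSUP_upper\<close>)
    fix x assume "x < Sup (p ` {0..<t})"
    then obtain s where s: "s \<in> {0..<t}" "x < p s"
      using less_cSUP_iff[of "{0..<t}" p x] bdd t by auto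
    have "x < p r" if "s < r" "r < t" for r using mono[of s r] s t that by auto
    then show "\<forall>\<^sub>F r in at_left t. x < p r"
      using s by (subst eventually_at_left[of s]) (auto intro!: exI[of _ s])
  qed
  have "0 \<le> p s" if "s \<in> {0..T}" for s using p[OF that] passage_nonneg[OF good] by simp
  moreover have "p \<in> extensional {0..T}" by (simp add: p_def passage_process_def)
  moreover have "cadlag_on T p" unfolding cadlag_on_def using right left by blast
  ultimately have "p \<in> D_up_paths T" using mono by (auto simp: D_up_paths_def mono_on_def)
  then show ?thesis by (simp add: p_def)
qed

lemma good_path_sets: "{\<phi> \<in> space path_space. good_path \<phi>} \<in> sets path_space"
proof -
  have "{\<phi> \<in> space path_space. \<exists>s\<ge>0. g < drifted (\<lambda>t. \<phi> t) s} \<in> sets path_space" for g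
    by (rule passage_sets(2)) (auto intro: eval_measurable C_path_continuous)
  then have "(\<Inter>n::nat. {\<phi> \<in> space path_space. \<exists>s\<ge>0. real n < drifted \<phi> s}) \<in> sets path_space" by auto
  also have "(\<Inter>n::nat. {\<phi> \<in> space path_space. \<exists>s\<ge>0. real n < drifted \<phi> s}) = {\<phi> \<in> space path_space. good_path \<phi>}"
  proof (intro equalityI subsetI)
    fix \<phi> assume \<phi>: "\<phi> \<in> (\<Inter>n::nat. {\<phi> \<in> space path_space. \<exists>s\<ge>0. real n < drifted \<phi> s})"
    have "\<exists>s\<ge>0. g < drifted \<phi> s" for g
    proof -
      obtain n :: nat where n: "g < real n" using reals_Archimedean2 by blast
      obtain s where "0 \<le> s" "real n < drifted \<phi> s" using \<phi> by auto
      then show ?thesis using n by (intro exI[of _ s]) auto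
    qed
    then show "\<phi> \<in> {\<phi> \<in> space path_space. good_path \<phi>}" using \<phi> by (auto simp: good_path_def)
  qed (auto simp: good_path_def)
  finally show ?thesis .
qed

lemma passage_process_measurable:
  assumes "t \<in> {0..T}"
  shows "(\<lambda>\<phi>. passage_process T g \<phi> t) \<in> borel_measurable path_space"
proof -
  have "(\<lambda>\<phi>. if good_path \<phi> then passage (g t) \<phi> else 0) \<in> borel_measurable path_space"
    using passage_measurable by (intro measurable_If good_path_sets) auto
  then show ?thesis using assms by (simp add: passage_process_def)
qed

end

lemma (in passage_bm) good_path_AE: "AE \<omega> in M. good_path (path \<omega>)"
proof -
  have "AE \<omega> in M. \<forall>n::nat. \<exists>s\<ge>0. real n < level \<omega> s"
    using first_passage_mean(1) by (simp add: AE_all_countable)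
  then show ?thesis
  proof eventually_elim
    case (elim \<omega>)
    show ?case unfolding good_path_def
    proof
      fix g
      obtain n :: nat where n: "g < real n" using reals_Archimedean2 by blast
      obtain s where s: "0 \<le> s" "real n < level \<omega> s" using elim by blast
      have "drifted (path \<omega>) s = level \<omega> s"
        using s(1) f_nonneg by (simp add: level_def drifted_def path_eq)
      then show "\<exists>s\<ge>0. g < drifted (path \<omega>) s" using s n by (intro exI[of _ s]) simp
    qed
  qed
qed

context scaling_limit
begin

text \<open>
  The coupling argument with \<open>J\<close> the map from a Brownian path to the pair of the path and its passage
  process. The tests of the first component agree exactly; those of the second component are evaluations
  at the times \<open>i T / m\<close>, and at time \<open>0\<close> if the convention for \<open>\<tau>(0-)\<close> includes it, in which case
  both processes start at \<open>0\<close>.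
\<close>

lemma weak_limit:
  assumes cont: "continuous_on {0..T} Gs" and mono: "mono_on {0..T} Gs"
    and init: "init = (\<lambda>_. 0) \<or> init = (\<lambda>\<tau>. \<tau> 0) \<and> Gs 0 = 0"
  shows "converges_weakly_as (prod_topology C_topology (M1_topology_init T init)) M
    (\<lambda>n. path_pair T (w n) (y n)) N (path_pair T B (\<lambda>t. first_passage lam \<nu> fs B (Gs t)))"
proof -
  interpret PN: passage_bm N FB B lam \<nu> fs C by (rule pbN)
  define Q where "Q = (\<lambda>(i, m). real i * T / real m) ` {(i, m). i \<in> {1..m}} \<union> (if init = (\<lambda>_. 0) then {} else {0})"
  have Q_grid: "real i * T / real m \<in> Q" if "i \<in> {1..m}" for i m using that by (auto simp: Q_def)
  have Q_cases: "0 < q \<and> q \<le> T \<or> q = 0 \<and> Gs 0 = 0" if qQ: "q \<in> Q" for q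
  proof (cases "q = 0")
    case True
    then show ?thesis using qQ init T by (auto simp: Q_def split: if_splits)
  next
    case False
    then obtain i m where q: "q = real i * T / real m" "i \<in> {1..m}" using qQ False by (auto simp: Q_def split: if_splits)
    have "real i * T \<le> real m * T" using q T by (intro mult_right_mono) auto
    then have "q \<le> T" using q by (simp add: divide_le_eq mult.commute)
    moreover have "0 < q" using q T by simp
    ultimately show ?thesis by simp
  qed
  then have Q_T: "q \<in> {0..T}" if "q \<in> Q" for q using that T by force
  have init': "init = (\<lambda>_. 0) \<or> init = (\<lambda>\<tau>. \<tau> 0) \<and> 0 \<in> Q" using init by (auto simp: Q_def)
  have "countable {(i::nat, m::nat). i \<in> {1..m}}" by (rule countable_subset[OF subset_UNIV]) simp
  then have Qc: "countable Q" by (auto simp: Q_def)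
  define J where "J \<phi> = (\<phi>, lim.passage_process T Gs \<phi>)" for \<phi>
  define H2 :: "((real \<Rightarrow> real) \<Rightarrow> real) set" where "H2 = (\<lambda>q \<tau>. \<tau> q) ` Q"
  define H where "H = (\<lambda>h. h \<circ> fst) ` C_tests \<union> (\<lambda>h. h \<circ> snd) ` H2"
  have tested: "tested_by (prod_topology C_topology (M1_topology_init T init)) H"
    unfolding H_def H2_def by (rule tested_by_prod[OF tested_by_C tested_by_M1[OF T Qc Q_grid init']])
  have pp: "path_pair T (w n) (y n) \<omega> = (wpath n \<omega>, \<lambda>t\<in>{0..T}. y n t \<omega>)" if "1 \<le> n" for n \<omega>
  proof -
    interpret passage_bm "M n" "\<lambda>t. F n (t / (c n)\<^sup>2)" "w n" lam \<nu> fs C by (rule pb[OF that])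
    show ?thesis by (simp add: path_pair_def path_def)
  qed
  have conv: "converges_weakly (prod_topology C_topology (M1_topology_init T init)) M
    (\<lambda>n. path_pair T (w n) (y n)) N (\<lambda>\<omega>. J (PN.path \<omega>))"
  proof (rule converges_weakly_coupling[OF tested, where S = path_space and w = "\<lambda>n. wpath n"])
    show "prob_space (M n)" if "1 \<le> n" for n by (rule prob_M[OF that])
    show "prob_space N" by (rule PN.prob_space_axioms)
    show "path_pair T (w n) (y n) \<omega> \<in> topspace (prod_topology C_topology (M1_topology_init T init))"
      if n: "1 \<le> n" and \<omega>: "\<omega> \<in> space (M n)" for n \<omega>
    proof -
      interpret weak_sol K lam \<nu> f "M n" "F n" "W n" "X n" "real n * T" G by (rule ws[OF n])
      have n0: "0 < real n" using n by simp
      define p where "p = (\<lambda>t\<in>{0..T}. y n t \<omega>)"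
      have p: "p t = c n * X n (real n * t) \<omega>" if "t \<in> {0..T}" for t using that by (simp add: p_def y_def)
      have nt: "real n * t \<in> {0..real n * T}" if "t \<in> {0..T}" for t using that by (auto intro: mult_left_mono)
      have "continuous_on {0..T} (\<lambda>t. c n * X n (real n * t) \<omega>)"
        by (intro continuous_intros continuous_on_compose2[OF X_continuous[OF \<omega>]]) (use nt in auto)
      then have pc: "continuous_on {0..T} p" using continuous_on_cong[of "{0..T}" "{0..T}" p] p by auto
      have "p s \<le> p t" if "0 \<le> s" "s \<le> t" "t \<le> T" for s t
      proof -
        have "X n (real n * s) \<omega> \<le> X n (real n * t) \<omega>"
          using that n0 by (intro X_mono[OF \<omega>]) (auto intro: mult_left_mono)
        then show ?thesis using that c[of n] by (auto simp: p intro: mult_left_mono)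
      qed
      moreover have "0 \<le> p t" if "t \<in> {0..T}" for t
        using y_facts(2)[OF n _ _ \<omega>, of t] that by (simp add: p_def)
      moreover have "cadlag_on T p"
        unfolding cadlag_on_def
      proof (intro conjI ballI)
        fix t assume t: "t \<in> {0..<T}"
        show "(p \<longlongrightarrow> p t) (at_right t)"
      proof -
        have lim: "(p \<longlongrightarrow> p t) (at t within {0..T})" using pc t by (auto simp: continuous_on_def)
        have "at_right t \<le> at t within {0..T}"
        proof (rule filter_leI)
          fix P assume "eventually P (at t within {0..T})"
          then obtain d where d: "0 < d" "\<And>r. r \<in> {0..T} \<Longrightarrow> r \<noteq> t \<Longrightarrow> dist r t < d \<Longrightarrow> P r"
            unfolding eventually_at by blast
          show "eventually P (at_right t)"
            by (subst eventually_at_right[of _ T])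
              (use t d in \<open>auto simp: dist_real_def intro!: exI[of _ "min T (t + d)"]\<close>)
        qed
        from tendsto_mono[OF this lim] show ?thesis .
      qed
      next
        fix t assume t: "t \<in> {0<..T}"
        have lim: "(p \<longlongrightarrow> p t) (at t within {0..T})" using pc t by (auto simp: continuous_on_def)
        have "at_left t \<le> at t within {0..T}"
        proof (rule filter_leI)
          fix P assume "eventually P (at t within {0..T})"
          then obtain d where d: "0 < d" "\<And>r. r \<in> {0..T} \<Longrightarrow> r \<noteq> t \<Longrightarrow> dist r t < d \<Longrightarrow> P r"
            unfolding eventually_at by blast
          show "eventually P (at_left t)"
            by (subst eventually_at_left[of 0])
              (use t d in \<open>auto simp: dist_real_def intro!: exI[of _ "max 0 (t - d)"]\<close>)
        qed
        from tendsto_mono[OF this lim] show "\<exists>l. (p \<longlongrightarrow> l) (at_left t)" by blast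
      qed
      moreover have "p \<in> extensional {0..T}" by (simp add: p_def)
      ultimately have "p \<in> D_up_paths T"
        by (auto simp: D_up_paths_def mono_on_def)
      moreover have "wpath n \<omega> \<in> C_paths" using measurable_space[OF wpath_measurable[OF n] \<omega>] by simp
      ultimately show ?thesis by (simp add: pp[OF n] p_def)
    qed
    show "(\<lambda>\<omega>. h (path_pair T (w n) (y n) \<omega>)) \<in> borel_measurable (M n)" if n: "1 \<le> n" and "h \<in> H" for n h
      using that(2) unfolding H_def
    proof
      assume "h \<in> (\<lambda>h. h \<circ> fst) ` C_tests"
      then obtain k where "h = k \<circ> fst" "k \<in> C_tests" by auto
      then show ?thesis using measurable_compose[OF wpath_measurable[OF n] C_tests_measurable[of k]] by (simp add: pp[OF n])
    next
      assume "h \<in> (\<lambda>h. h \<circ> snd) ` H2"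
      then obtain q where "h = (\<lambda>\<tau>. \<tau> q) \<circ> snd" "q \<in> Q" by (auto simp: H2_def)
      then show ?thesis using Q_T[of q] borel_measurable_integrable[OF y_facts(1)[OF n, of q]] by (simp add: pp[OF n])
    qed
    show "J \<phi> \<in> topspace (prod_topology C_topology (M1_topology_init T init))" if "\<phi> \<in> space path_space" for \<phi>
      using that lim.passage_process_in_D_up[OF T cont mono] by (simp add: J_def)
    show "(\<lambda>\<phi>. h (J \<phi>)) \<in> borel_measurable path_space" if "h \<in> H" for h
      using that unfolding H_def
    proof
      assume "h \<in> (\<lambda>h. h \<circ> fst) ` C_tests"
      then show ?thesis using C_tests_measurable by (auto simp: J_def)
    next
      assume "h \<in> (\<lambda>h. h \<circ> snd) ` H2"
      then show ?thesis using lim.passage_process_measurable[OF Q_T] by (auto simp: J_def H2_def)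
    qed
    show "wpath n \<in> measurable (M n) path_space" if "1 \<le> n" for n by (rule wpath_measurable[OF that])
    show "PN.path \<in> measurable N path_space" by (rule PN.path_measurable)
    show "distr (M n) path_space (wpath n) = distr N path_space PN.path" if "1 \<le> n" for n
      using w_law[OF that] by (simp add: wiener_def)
    fix h and e :: real assume h: "h \<in> H" and e: "0 < e"
    let ?D = "\<lambda>n. {\<omega> \<in> space (M n). e \<le> \<bar>h (path_pair T (w n) (y n) \<omega>) - h (J (wpath n \<omega>))\<bar>}"
    show "(\<lambda>n. measure (M n) (?D n)) \<longlonglongrightarrow> 0"
      using h unfolding H_def
    proof
      assume "h \<in> (\<lambda>h. h \<circ> fst) ` C_tests"
      then have "\<forall>\<^sub>F n in sequentially. measure (M n) (?D n) = 0"
        using e by (intro eventually_mono[OF eventually_ge_at_top[of 1]]) (auto simp: pp J_def)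
      then show ?thesis by (rule tendsto_eventually)
    next
      assume "h \<in> (\<lambda>h. h \<circ> snd) ` H2"
      then obtain q where hq: "h = (\<lambda>\<tau>. \<tau> q) \<circ> snd" and q: "q \<in> Q" by (auto simp: H2_def)
      let ?D' = "\<lambda>n. {\<omega> \<in> space (M n). e \<le> \<bar>y n q \<omega> - hit n (Gs q) \<omega>\<bar>}"
      have "\<forall>\<^sub>F n in sequentially. measure (M n) (?D' n) = measure (M n) (?D n)"
        using eventually_ge_at_top[of 1]
      proof eventually_elim
        case (elim n)
        interpret P: passage_bm "M n" "\<lambda>t. F n (t / (c n)\<^sup>2)" "w n" lam \<nu> fs C by (rule pb[OF elim])
        have ym: "y n q \<in> borel_measurable (M n)" using borel_measurable_integrable[OF y_facts(1)[OF elim]] Q_T[OF q] by auto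
        have hm: "hit n (Gs q) \<in> borel_measurable (M n)" using borel_measurable_integrable[OF hit_moments(1)[OF elim]] .
        have pm: "(\<lambda>\<omega>. lim.passage_process T Gs (wpath n \<omega>) q) \<in> borel_measurable (M n)"
          using measurable_compose[OF wpath_measurable[OF elim] lim.passage_process_measurable[OF Q_T[OF q]]] .
        have D_eq: "?D n = {\<omega> \<in> space (M n). e \<le> \<bar>y n q \<omega> - lim.passage_process T Gs (wpath n \<omega>) q\<bar>}"
          using Q_T[OF q] by (auto simp: hq pp[OF elim] J_def)
        show ?case
        proof (rule P.finite_measure_eq_AE)
          show "AE \<omega> in M n. \<omega> \<in> ?D' n \<longleftrightarrow> \<omega> \<in> ?D n"
            using P.good_path_AE
          proof eventually_elim
            fix \<omega> assume "lim.good_path (P.path \<omega>)"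
            then show "\<omega> \<in> ?D' n \<longleftrightarrow> \<omega> \<in> ?D n"
              using Q_T[OF q] by (simp add: D_eq lim.passage_process_def hit_path[OF elim])
          qed
          show "?D' n \<in> P.events" using ym hm by measurable
          show "?D n \<in> P.events" unfolding D_eq using ym pm by measurable
        qed
      qed
      moreover have "(\<lambda>n. measure (M n) (?D' n)) \<longlonglongrightarrow> 0"
      proof (cases "0 < q")
        case True
        then show ?thesis using y_hit_in_probability[OF True _ e] Q_cases[OF q] by auto
      next
        case False
        then have q0: "q = 0" "Gs 0 = 0" using Q_cases[OF q] by auto
        have "\<forall>\<^sub>F n in sequentially. measure (M n) (?D' n) = 0"
          using eventually_ge_at_top[of 1]
        proof eventually_elim
          case (elim n)
          interpret weak_sol K lam \<nu> f "M n" "F n" "W n" "X n" "real n * T" G by (rule ws[OF elim])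
          note hm = hit_moments[OF elim, of 0]
          have "AE \<omega> in M n. hit n 0 \<omega> = 0"
            using integral_nonneg_eq_0_iff_AE[OF hm(1,3)] hm(2) by simp
          then have "AE \<omega> in M n. \<omega> \<notin> ?D' n"
            using AE_space by eventually_elim (use e in \<open>simp add: q0 y_def X_0\<close>)
          moreover have "?D' n \<in> sets (M n)"
          proof -
            have "y n 0 \<in> borel_measurable (M n)"
              using borel_measurable_integrable[OF y_facts(1)[OF elim, of 0]] T by auto
            then show ?thesis
              using borel_measurable_integrable[OF hm(1)] unfolding q0 by measurable
          qed
          ultimately show ?case by (subst prob_eq_0) auto
        qed
        then show ?thesis by (rule tendsto_eventually)
      qed
      ultimately show ?thesis by (rule Lim_transform_eventually[rotated])
    qed
  qed
  have ae: "AE \<omega> in N. J (PN.path \<omega>) = path_pair T B (\<lambda>t. first_passage lam \<nu> fs B (Gs t)) \<omega>"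
    using PN.good_path_AE
  proof eventually_elim
    case (elim \<omega>)
    then show ?case
      by (auto simp: J_def path_pair_def PN.path_def[of \<omega>, symmetric] lim.passage_process_def PN.passage_path fun_eq_iff)
  qed
  show ?thesis
    unfolding converges_weakly_as_def
    by (rule exI[of _ "\<lambda>\<omega>. J (PN.path \<omega>)"]) (rule conjI[OF ae conv])
qed

end

section \<open>Locally uniform convergence and the scaling limits\<close>

text \<open>
  The two time arguments vary independently, which is why the limit is continuous, whatever the functions
  of the sequence are.
\<close>

lemma locally_uniformly_convergesD:
  assumes "locally_uniformly_converges fn f" "0 \<le> x" "0 < e"
  obtains d where "0 < d"
    "\<forall>\<^sub>F n in sequentially. \<forall>s r. \<bar>s - x\<bar> \<le> d \<longrightarrow> \<bar>r - x\<bar> \<le> d \<longrightarrow> 0 \<le> s \<longrightarrow> 0 \<le> r \<longrightarrow> \<bar>fn n s - f r\<bar> < e"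
proof -
  let ?A = "\<lambda>d. ({x - d..x + d} \<inter> {0..}) \<times> ({x - d..x + d} \<inter> {0..})"
  let ?S = "\<lambda>d n. SUP (s, r) \<in> ?A d. ereal \<bar>fn n s - f r\<bar>"
  have "((\<lambda>d. limsup (?S d)) \<longlongrightarrow> 0) (at_right 0)"
    using assms(1,2) by (simp add: locally_uniformly_converges_def)
  from order_tendstoD(2)[OF this, of "ereal e"] assms(3)
  have "\<forall>\<^sub>F d in at_right 0. limsup (?S d) < ereal e" by simp
  from this[unfolded eventually_at_right[OF zero_less_one]]
  obtain b where b: "0 < b" "\<And>d. 0 < d \<Longrightarrow> d < b \<Longrightarrow> limsup (?S d) < ereal e"
    by blast
  define d where "d = b / 2"
  have d: "0 < d" "d < b" using b by (auto simp: d_def)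
  have "\<forall>\<^sub>F n in sequentially. ?S d n < ereal e" by (rule Limsup_lessD[OF b(2)[OF d]])
  then have "\<forall>\<^sub>F n in sequentially. \<forall>s r. \<bar>s - x\<bar> \<le> d \<longrightarrow> \<bar>r - x\<bar> \<le> d \<longrightarrow> 0 \<le> s \<longrightarrow> 0 \<le> r \<longrightarrow> \<bar>fn n s - f r\<bar> < e"
  proof eventually_elim
    case (elim n)
    show ?case
    proof (intro allI impI)
      fix s r assume "\<bar>s - x\<bar> \<le> d" "\<bar>r - x\<bar> \<le> d" "0 \<le> s" "0 \<le> r"
      then have "(s, r) \<in> ?A d" by auto
      then have "ereal \<bar>fn n s - f r\<bar> \<le> ?S d n" by (intro SUP_upper2[of "(s, r)"]) auto
      also have "\<dots> < ereal e" by (rule elim)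
      finally show "\<bar>fn n s - f r\<bar> < e" by simp
    qed
  qed
  with d(1) show ?thesis by (rule that)
qed

lemma locally_uniformly_converges_pointwise:
  assumes "locally_uniformly_converges fn f" "0 \<le> x"
  shows "(\<lambda>n. fn n x) \<longlonglongrightarrow> f x"
proof (rule LIMSEQ_I)
  fix e :: real assume "0 < e"
  from locally_uniformly_convergesD[OF assms this] obtain d where "0 < d"
    and ev: "\<forall>\<^sub>F n in sequentially. \<forall>s r. \<bar>s - x\<bar> \<le> d \<longrightarrow> \<bar>r - x\<bar> \<le> d \<longrightarrow> 0 \<le> s \<longrightarrow> 0 \<le> r \<longrightarrow> \<bar>fn n s - f r\<bar> < e"
    by blast
  from ev have "\<forall>\<^sub>F n in sequentially. norm (fn n x - f x) < e"
    by eventually_elim (use \<open>0 < d\<close> assms(2) in auto)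
  then show "\<exists>n0. \<forall>n\<ge>n0. norm (fn n x - f x) < e" by (simp add: eventually_sequentially)
qed

lemma locally_uniformly_converges_continuous:
  assumes "locally_uniformly_converges fn f"
  shows "continuous_on {0..} f"
  unfolding continuous_on_iff
proof (intro ballI allI impI)
  fix x e :: real assume x: "x \<in> {0..}" and e: "0 < e"
  have x0: "0 \<le> x" and e2: "0 < e / 2" using x e by auto
  from locally_uniformly_convergesD[OF assms x0 e2] obtain d where d: "0 < d"
    and ev: "\<forall>\<^sub>F n in sequentially. \<forall>s r. \<bar>s - x\<bar> \<le> d \<longrightarrow> \<bar>r - x\<bar> \<le> d \<longrightarrow> 0 \<le> s \<longrightarrow> 0 \<le> r \<longrightarrow> \<bar>fn n s - f r\<bar> < e / 2"
    by blast
  obtain n where n: "\<And>s r. \<bar>s - x\<bar> \<le> d \<Longrightarrow> \<bar>r - x\<bar> \<le> d \<Longrightarrow> 0 \<le> s \<Longrightarrow> 0 \<le> r \<Longrightarrow> \<bar>fn n s - f r\<bar> < e / 2"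
    using ev by (auto simp: eventually_sequentially)
  show "\<exists>d>0. \<forall>r\<in>{0..}. dist r x < d \<longrightarrow> dist (f r) (f x) < e"
  proof (intro exI[of _ d] conjI ballI impI d)
    fix r assume r: "r \<in> {0..}" "dist r x < d"
    have "\<bar>fn n x - f r\<bar> < e / 2" "\<bar>fn n x - f x\<bar> < e / 2"
      by (rule n; use r d x0 in \<open>auto simp: dist_real_def\<close>)+
    then show "dist (f r) (f x) < e" unfolding dist_real_def by linarith
  qed
qed

lemma locally_uniformly_converges_uniform:
  assumes "locally_uniformly_converges fn f" "0 < e"
  shows "\<forall>\<^sub>F n in sequentially. \<forall>x\<in>{0..R}. \<bar>fn n x - f x\<bar> \<le> e"
proof -
  have "\<exists>d>0. \<forall>\<^sub>F n in sequentially. \<forall>s. \<bar>s - x\<bar> \<le> d \<longrightarrow> 0 \<le> s \<longrightarrow> \<bar>fn n s - f s\<bar> < e" if x: "x \<in> {0..R}" for x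
  proof -
    have x0: "0 \<le> x" using x by simp
    from locally_uniformly_convergesD[OF assms(1) x0 assms(2)] obtain d where d: "0 < d"
      and ev: "\<forall>\<^sub>F n in sequentially. \<forall>s r. \<bar>s - x\<bar> \<le> d \<longrightarrow> \<bar>r - x\<bar> \<le> d \<longrightarrow> 0 \<le> s \<longrightarrow> 0 \<le> r \<longrightarrow> \<bar>fn n s - f r\<bar> < e"
      by blast
    from ev have "\<forall>\<^sub>F n in sequentially. \<forall>s. \<bar>s - x\<bar> \<le> d \<longrightarrow> 0 \<le> s \<longrightarrow> \<bar>fn n s - f s\<bar> < e"
      by (rule eventually_mono) blast
    then show ?thesis using d by blast
  qed
  then have "\<forall>x\<in>{0..R}. \<exists>d>0. \<forall>\<^sub>F n in sequentially. \<forall>s. \<bar>s - x\<bar> \<le> d \<longrightarrow> 0 \<le> s \<longrightarrow> \<bar>fn n s - f s\<bar> < e"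
    by (rule ballI)
  from bchoice[OF this] obtain d where dd: "\<forall>x\<in>{0..R}. 0 < d x \<and>
      (\<forall>\<^sub>F n in sequentially. \<forall>s. \<bar>s - x\<bar> \<le> d x \<longrightarrow> 0 \<le> s \<longrightarrow> \<bar>fn n s - f s\<bar> < e)"
    by (rule exE)
  have d: "0 < d x" "\<forall>\<^sub>F n in sequentially. \<forall>s. \<bar>s - x\<bar> \<le> d x \<longrightarrow> 0 \<le> s \<longrightarrow> \<bar>fn n s - f s\<bar> < e"
    if "x \<in> {0..R}" for x
    using bspec[OF dd that] by (rule conjunct1, rule conjunct2)
  have cpt: "compact {0..R}" by simp
  have cover: "{0..R} \<subseteq> (\<Union>x\<in>{0..R}. ball x (d x))" using d(1) by auto
  obtain I where I: "I \<subseteq> {0..R}" "finite I" "{0..R} \<subseteq> (\<Union>x\<in>I. ball x (d x))"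
    using compactE_image[OF cpt open_ball cover] by metis
  have "\<forall>\<^sub>F n in sequentially. \<forall>x\<in>I. \<forall>s. \<bar>s - x\<bar> \<le> d x \<longrightarrow> 0 \<le> s \<longrightarrow> \<bar>fn n s - f s\<bar> < e"
    using d(2) I(1) by (intro eventually_ball_finite[OF I(2)]) blast
  then show ?thesis
  proof eventually_elim
    case (elim n)
    show ?case
    proof
      fix s assume s: "s \<in> {0..R}"
      then obtain x where x: "x \<in> I" "s \<in> ball x (d x)" using I(3) by blast
      then have "\<bar>s - x\<bar> \<le> d x" by (simp add: dist_real_def)
      then show "\<bar>fn n s - f s\<bar> \<le> e" using elim x(1) s by force
    qed
  qed
qed

lemma quadratic_bound_of_linear_derivative:
  assumes "\<forall>x\<ge>0. (f has_real_derivative f' x) (at x within {0..})" "f 0 = 0" "\<forall>x\<ge>0. \<bar>f' x\<bar> \<le> C * (1 + x)"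
    and x: "0 \<le> x"
  shows "f x \<le> C * (1 + x)\<^sup>2"
proof (cases "x = 0")
  case True
  then show ?thesis using assms(2) spec[OF assms(3), of 0] by simp
next
  case False
  then have x0: "0 < x" using x by simp
  have "\<exists>z\<in>{0<..<x}. f x - f 0 = (x - 0) * f' z"
  proof (rule mvt_simple[OF x0, where f = f and f' = "\<lambda>z h. h * f' z"])
    fix z assume "0 \<le> z" "z \<le> x"
    then have "(f has_real_derivative f' z) (at z within {0..})" using assms(1) by simp
    then have "(f has_real_derivative f' z) (at z within {0..x})" by (rule DERIV_subset) auto
    then show "(f has_derivative (\<lambda>h. h * f' z)) (at z within {0..x})"
      unfolding has_field_derivative_def by (simp only: mult.commute[of _ "f' z"])
  qed
  then obtain z where z: "0 < z" "z < x" "f x = x * f' z" using assms(2) by auto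
  have C: "0 \<le> C" using spec[OF assms(3), of 0] by simp
  have "f' z \<le> C * (1 + z)" using assms(3) z by (metis abs_le_D1 less_imp_le)
  also have "\<dots> \<le> C * (1 + x)" using C z by (intro mult_left_mono) auto
  finally have "f x \<le> x * (C * (1 + x))" unfolding z(3) using x by (intro mult_left_mono) auto
  also have "\<dots> \<le> (1 + x) * (C * (1 + x))" using C x by (intro mult_right_mono) auto
  finally show ?thesis by (simp add: power2_eq_square algebra_simps)
qed

theorem theorem4p2:
  fixes lam \<nu> T :: real
    and f f' K G\<^sub>0 :: "real \<Rightarrow> real"
    and M :: "real \<Rightarrow> 'a measure"
    and F :: "real \<Rightarrow> real \<Rightarrow> 'a measure"
    and W X :: "real \<Rightarrow> real \<Rightarrow> 'a \<Rightarrow> real"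
    and N :: "'b measure"
    and B :: "real \<Rightarrow> 'b \<Rightarrow> real"
  assumes "0 \<le> lam" and "0 \<le> \<nu>"
    and f_nonneg: "\<forall>x\<ge>0. 0 \<le> f x"
    and f_C1: "\<forall>x\<ge>0. (f has_real_derivative f' x) (at x within {0..})" "continuous_on {0..} f'"
    and f_mono: "mono_on {0..} f" and f_0: "f 0 = 0"
    and f'_growth: "\<exists>C. \<forall>x\<ge>0. \<bar>f' x\<bar> \<le> C * (1 + x)"
    and K_nonneg: "\<forall>x\<ge>0. 0 \<le> K x"
    and K_L1: "set_integrable lborel {0..} K" "(LINT x:{0..}|lborel. \<bar>K x\<bar>) = 1"
    and G\<^sub>0_nonneg: "\<forall>t\<ge>0. 0 \<le> G\<^sub>0 t"
    and G\<^sub>0_mono: "mono_on {0..} G\<^sub>0" and G\<^sub>0_0: "G\<^sub>0 0 = 0"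
    and sol: "\<forall>S>0. weak_solution (M S) (F S) (W S) (X S) S G\<^sub>0 K f lam \<nu>"
    and T: "0 < T"
    and B: "standard_brownian_motion N B"
  shows "(\<forall>Gstar. (G\<^sub>0 \<longlongrightarrow> Gstar) at_top \<longrightarrow>
           converges_weakly_as (D_circ_0 T)
             (\<lambda>n. M (real n * T))
             (\<lambda>n. path_pair T (W (real n * T)) (\<lambda>t. X (real n * T) (real n * t)))
             N (path_pair T B (\<lambda>t. first_passage lam \<nu> f B Gstar)))
       \<and> (\<forall>c Gstar fstar.
           (\<forall>n. 0 < c n) \<and> decseq c \<and> c \<longlonglongrightarrow> 0 \<and>
           continuous_on {0..T} Gstar \<and>
           (\<forall>t\<in>{0..T}. (\<lambda>n. c n * G\<^sub>0 (real n * t)) \<longlonglongrightarrow> Gstar t) \<and>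
           locally_uniformly_converges (\<lambda>n x. (c n)\<^sup>2 * f (x / c n)) fstar \<longrightarrow>
           converges_weakly_as (D_circ T)
             (\<lambda>n. M (real n * T))
             (\<lambda>n. path_pair T
                (\<lambda>t \<omega>. c n * W (real n * T) (t / (c n)\<^sup>2) \<omega>)
                (\<lambda>t \<omega>. c n * X (real n * T) (real n * t) \<omega>))
             N (path_pair T B (\<lambda>t. first_passage lam \<nu> fstar B (Gstar t))))"
proof -
  obtain C where C: "\<forall>x\<ge>0. \<bar>f' x\<bar> \<le> C * (1 + x)" using f'_growth by blast
  note f_growth = quadratic_bound_of_linear_derivative[OF f_C1(1) f_0 C]
  have f_cont: "continuous_on {0..} f"
    by (rule DERIV_continuous_on) (use f_C1(1) in auto)
  have tc: "time_change lam \<nu> f"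
    using assms(1,2) f_cont f_mono f_0 by (simp add: time_change_def)
  have "(LINT x:{0..}|lborel. K x) = (LINT x:{0..}|lborel. \<bar>K x\<bar>)"
    by (rule set_lebesgue_integral_cong) (use K_nonneg in auto)
  then have pk: "prob_kernel K"
    using K_nonneg K_L1 by (simp add: prob_kernel_def)
  have bmB: "bm N (natural_filtration N B) B"
    using B by (simp add: bm_def standard_brownian_motion_def)
  have sols: "weak_solution (M (real n * T)) (F (real n * T)) (W (real n * T)) (X (real n * T)) (real n * T) G\<^sub>0 K f lam \<nu>"
    if "1 \<le> n" for n
    using sol T that by simp
  show ?thesis
  proof (intro conjI allI impI)
    fix Gstar assume lim: "(G\<^sub>0 \<longlongrightarrow> Gstar) at_top"
    have Glim: "(\<lambda>n. 1 * G\<^sub>0 (real n * t)) \<longlonglongrightarrow> Gstar" if "0 < t" for t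
    proof -
      have "filterlim (\<lambda>n. real n * t) at_top sequentially"
        by (rule filterlim_at_top_mult_tendsto_pos[OF tendsto_const that filterlim_real_sequentially])
      from filterlim_compose[OF lim this] show ?thesis by simp
    qed
    interpret scaling_limit K lam \<nu> f f "\<lambda>n. M (real n * T)" "\<lambda>n. F (real n * T)" "\<lambda>n. W (real n * T)"
        "\<lambda>n. X (real n * T)" G\<^sub>0 "\<lambda>_. 1" T "\<lambda>_. Gstar" C N "natural_filtration N B" B
    proof (intro scaling_limit.intro scaling_limit_axioms.intro pk tc bmB sols T f_growth G\<^sub>0_mono)
      show "\<exists>t'. 0 < t' \<and> t' < t \<and> h < Gstar" if "0 < t" "t \<le> T" "h < Gstar" for t h
        using that by (intro exI[of _ "t / 2"]) auto
    qed (use G\<^sub>0_nonneg Glim in auto)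
    have "w n = W (real n * T)" "y n = (\<lambda>t. X (real n * T) (real n * t))" for n
      by (auto simp: w_def y_def fun_eq_iff)
    then show "converges_weakly_as (D_circ_0 T) (\<lambda>n. M (real n * T))
        (\<lambda>n. path_pair T (W (real n * T)) (\<lambda>t. X (real n * T) (real n * t)))
        N (path_pair T B (\<lambda>t. first_passage lam \<nu> f B Gstar))"
      using weak_limit[of "\<lambda>_. 0"] by (simp add: D_circ_0_def M1_topology_0_def mono_on_def)
  next
    fix c :: "nat \<Rightarrow> real" and Gstar fstar
    assume *: "(\<forall>n. 0 < c n) \<and> decseq c \<and> c \<longlonglongrightarrow> 0 \<and> continuous_on {0..T} Gstar \<and>
        (\<forall>t\<in>{0..T}. (\<lambda>n. c n * G\<^sub>0 (real n * t)) \<longlonglongrightarrow> Gstar t) \<and>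
        locally_uniformly_converges (\<lambda>n x. (c n)\<^sup>2 * f (x / c n)) fstar"
    then have c: "\<And>n. 0 < c n" "c \<longlonglongrightarrow> 0" and Gc: "continuous_on {0..T} Gstar"
      and Glim: "\<And>t. t \<in> {0..T} \<Longrightarrow> (\<lambda>n. c n * G\<^sub>0 (real n * t)) \<longlonglongrightarrow> Gstar t"
      and loc: "locally_uniformly_converges (\<lambda>n x. (c n)\<^sup>2 * f (x / c n)) fstar"
      by auto
    note pw = locally_uniformly_converges_pointwise[OF loc]
    have fs_mono: "mono_on {0..} fstar"
    proof (rule mono_onI)
      fix r s :: real assume rs: "r \<in> {0..}" "s \<in> {0..}" "r \<le> s"
      have "(c n)\<^sup>2 * f (r / c n) \<le> (c n)\<^sup>2 * f (s / c n)" for n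
        using rs c(1)[of n] f_mono by (intro mult_left_mono) (auto simp: mono_on_def divide_right_mono)
      then show "fstar r \<le> fstar s" using rs by (intro LIMSEQ_le[OF pw pw]) auto
    qed
    have fs_0: "fstar 0 = 0" using pw[of 0] by (simp add: f_0 LIMSEQ_const_iff)
    have C0: "0 \<le> C" using spec[OF C, of 0] by simp
    have fs_growth: "fstar x \<le> C * (1 + x)\<^sup>2" if x: "0 \<le> x" for x
    proof (rule LIMSEQ_le)
      show "(\<lambda>n. (c n)\<^sup>2 * f (x / c n)) \<longlonglongrightarrow> fstar x" by (rule pw[OF x])
      have "(\<lambda>n. C * (c n + x)\<^sup>2 + C * (1 + 2 * x)) \<longlonglongrightarrow> C * (0 + x)\<^sup>2 + C * (1 + 2 * x)"
        by (intro tendsto_intros c)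
      also have "C * (0 + x)\<^sup>2 + C * (1 + 2 * x) = C * (1 + x)\<^sup>2"
        by (simp add: power2_eq_square algebra_simps)
      finally show "(\<lambda>n. C * (c n + x)\<^sup>2 + C * (1 + 2 * x)) \<longlonglongrightarrow> C * (1 + x)\<^sup>2" .
      show "\<exists>N. \<forall>n\<ge>N. (c n)\<^sup>2 * f (x / c n) \<le> C * (c n + x)\<^sup>2 + C * (1 + 2 * x)"
      proof (intro exI allI impI)
        fix n
        have "(c n)\<^sup>2 * f (x / c n) \<le> (c n)\<^sup>2 * (C * (1 + x / c n)\<^sup>2)"
          using c(1)[of n] x by (intro mult_left_mono f_growth) auto
        also have "\<dots> = C * (c n + x)\<^sup>2"
        proof -
          have "c n * (1 + x / c n) = c n + x" using c(1)[of n] by (simp add: field_simps)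
          then show ?thesis by (metis mult.left_commute power_mult_distrib)
        qed
        also have "\<dots> \<le> C * (c n + x)\<^sup>2 + C * (1 + 2 * x)" using C0 x by simp
        finally show "(c n)\<^sup>2 * f (x / c n) \<le> C * (c n + x)\<^sup>2 + C * (1 + 2 * x)" .
      qed
    qed
    have tcs: "time_change lam \<nu> fstar"
      using assms(1,2) locally_uniformly_converges_continuous[OF loc] fs_mono fs_0 by (simp add: time_change_def)
    have Gstar_mono: "mono_on {0..T} Gstar"
    proof (rule mono_onI)
      fix r s assume rs: "r \<in> {0..T}" "s \<in> {0..T}" "r \<le> s"
      have "c n * G\<^sub>0 (real n * r) \<le> c n * G\<^sub>0 (real n * s)" for n
        using rs c(1)[of n] G\<^sub>0_mono by (intro mult_left_mono) (auto simp: mono_on_def mult_left_mono)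
      then show "Gstar r \<le> Gstar s" using rs by (intro LIMSEQ_le[OF Glim Glim]) auto
    qed
    have G0: "Gstar 0 = 0" using Glim[of 0] T by (simp add: G\<^sub>0_0 LIMSEQ_const_iff)
    interpret scaling_limit K lam \<nu> f fstar "\<lambda>n. M (real n * T)" "\<lambda>n. F (real n * T)" "\<lambda>n. W (real n * T)"
        "\<lambda>n. X (real n * T)" G\<^sub>0 c T Gstar C N "natural_filtration N B" B
    proof (intro scaling_limit.intro scaling_limit_axioms.intro pk tc tcs bmB sols T fs_growth G\<^sub>0_mono c(1)
        locally_uniformly_converges_uniform[OF loc])
      show "\<exists>t'. 0 < t' \<and> t' < t \<and> h < Gstar t'" if t: "0 < t" "t \<le> T" "h < Gstar t" for t h
      proof -
        have "(Gstar \<longlongrightarrow> Gstar t) (at t within {0..T})" using Gc t by (auto simp: continuous_on_def)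
        then have "\<forall>\<^sub>F r in at t within {0..T}. h < Gstar r" using t(3) by (rule order_tendstoD)
        then obtain d where d: "0 < d" "\<And>r. r \<in> {0..T} \<Longrightarrow> r \<noteq> t \<Longrightarrow> dist r t < d \<Longrightarrow> h < Gstar r"
          unfolding eventually_at by blast
        have "h < Gstar (max (t / 2) (t - d / 2))" using d(1) t by (intro d(2)) (auto simp: dist_real_def)
        then show ?thesis using t d(1) by (intro exI[of _ "max (t / 2) (t - d / 2)"]) auto
      qed
    qed (use G\<^sub>0_nonneg Glim in auto)
    have "w n = (\<lambda>t \<omega>. c n * W (real n * T) (t / (c n)\<^sup>2) \<omega>)" "y n = (\<lambda>t \<omega>. c n * X (real n * T) (real n * t) \<omega>)" for n
      by (auto simp: w_def y_def fun_eq_iff)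
    then show "converges_weakly_as (D_circ T) (\<lambda>n. M (real n * T))
        (\<lambda>n. path_pair T (\<lambda>t \<omega>. c n * W (real n * T) (t / (c n)\<^sup>2) \<omega>) (\<lambda>t \<omega>. c n * X (real n * T) (real n * t) \<omega>))
        N (path_pair T B (\<lambda>t. first_passage lam \<nu> fstar B (Gstar t)))"
      using weak_limit[OF Gc Gstar_mono, of "\<lambda>\<tau>. \<tau> 0"] G0 by (simp add: D_circ_def M1_topology_def)
  qed
qed

end
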